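(* Let $\Theta=\mathbb R^p$ and $\theta_0\in\mathbb R^p$. Let $D_k^j=(X_k^j,Y_k^j)$, $k\in[t]$, $j\in[m]$, be i.i.d. pairs with $X_k^j\in\mathbb R^p$, $Y_k^j\in\{0,1\}$, generated by the logistic regression model: conditionally on $X_k^j$, $Y_k^j\sim\mathrm{Ber}(\nu_k^j)$ with $\log\frac{\nu_k^j}{1-\nu_k^j}=\theta_0^TX_k^j$. Let $p_\theta(y\mid x)=\exp(\langle\theta,xy\rangle-\sigma(\langle\theta,x\rangle))$ with $\sigma(\eta)=\log(1+e^\eta)$ be every agent's model. Assume the communication graph is static and undirected, $G_t=G=([m],E)$, with weighted adjacency matrix $A$ symmetric and row stochastic with positive diagonal entries, and $G$ connected; and assume that for every $\theta\in\Theta$ the expectation of $|\log p_\theta(Y_1^1\mid X_1^1)|$ under the data distribution $\mathbb P_0=\mathbb P_{\theta_0}$ is finite. Let $$T_t^j=\sum_{k=1}^t\sum_{i=1}^m[A^{t-k}]_{ji}X_k^iY_k^i,\qquad B_t^j(\theta)=\sum_{k=1}^t\sum_{i=1}^m[A^{t-k}]_{ji}\,\sigma(\langle\theta,X_k^i\rangle),\qquad \hat\theta_t^j=\arg\max_{\theta\in\mathbb R^p}\{\langle\theta,T_t^j\rangle-B_t^j(\theta)\}.$$ Then $\hat\theta_t^j\to\theta_0$ in $\mathbb P_0$-probability. Moreover, let $q_t^j$ be the density of $\sqrt t(\theta-\hat\theta_t^j)$ when $\theta\sim P_t^j$. If i) $\mathbb P_{\theta_0}X_1^1X_1^{1\,T}$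 exists and is finite and nonsingular, and ii) $\mathbb P_{\theta_0}|X_{k,a}^1X_{k,b}^1X_{k,c}^1|<\infty$ for all $a,b,c\in[p]$, then $$\int_{\mathbb R^p}|q_t^j(x)-\hat\varphi_t(x)|\,dx\to0\quad\text{in }\mathbb P_0\text{-probability},$$ where $\hat\varphi_t$ is the density of $N(0,\hat V_{\theta_0}^{-1})$ and $\hat V_\theta=\frac1{mt}\sum_{i=1}^m{X^i}^TW^i(\theta)X^i$, with $X^i$ the $t\times p$ matrix whose $k$-th row is $(X_k^i)^T$ and $$W^i(\theta)=\mathrm{diag}\Big(\frac{e^{\langle\theta,X_1^i\rangle}}{(1+e^{\langle\theta,X_1^i\rangle})^2},\dots,\frac{e^{\langle\theta,X_t^i\rangle}}{(1+e^{\langle\theta,X_t^i\rangle})^2}\Big).$$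
   Context: There are $m$ agents, $[m]=\{1,\dots,m\}$; $k$ indexes time. $\mathbb P_0=\mathbb P_{\theta_0}$ denotes the law of the data and $\mathbb P_{\theta_0}g$ the expectation of $g$ under it; $X_{k,a}^j$ is the $a$-th coordinate of $X_k^j$. The agents have a prior with density $\pi$ with (full) support $\mathbb R^p$. The distributed Bayes posterior $P_t^j$ of agent $j$ at time $t$ is the probability measure on $\mathbb R^p$ with density proportional to $\exp(\langle\theta,T_t^j\rangle-B_t^j(\theta))\,\pi(\theta)$, i.e. proportional to $\pi(\theta)\prod_{k=1}^t\prod_{i=1}^mp_\theta(Y_k^i\mid X_k^i)^{[A^{t-k}]_{ji}}$, where $A^0$ is the identity (normalizing constant assumed finite).
   Formalization: Consistency is claimed only when θ0 is identifiable (else, e.g. X=0, the arg max is never unique); the L1 limit is claimed only when the prior density π is continuous at θ0 (it fails for π oscillating near θ0). Full support is read as π>0 everywhere. *)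

theory Defs
  imports "HOL-Probability.Probability"
begin

text \<open>
  Agents are the elements of a finite type \<open>'m\<close>, and \<open>\<real>\<^sup>p\<close> is \<open>real ^ 'p\<close>.  The data are families
  \<open>X k i\<close>, \<open>Y k i\<close> of random variables on one probability space \<open>M\<close> (whose law plays the role of
  \<open>\<bbbP>\<close> at \<open>\<theta>\<^sub>0\<close>), with times \<open>k \<ge> 1\<close>; the index \<open>k = 0\<close> is never used.  A response in \<open>{0, 1}\<close>
  is stored as a real number.
\<close>

text \<open>On \<open>real ^ 'm ^ 'm\<close> the library power \<open>A ^ n\<close> would be componentwise.\<close>

primrec matpow :: "real ^ 'm ^ 'm \<Rightarrow> nat \<Rightarrow> real ^ 'm ^ 'm" where
  "matpow A 0 = mat 1"
| "matpow A (Suc n) = A ** matpow A n"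

text \<open>
  Off the diagonal the positive entries of \<open>A\<close> are exactly those on edges; a loop in \<open>E\<close> carries
  no information.
\<close>

definition weighted_adjacency :: "('m::finite \<times> 'm) set \<Rightarrow> real ^ 'm ^ 'm \<Rightarrow> bool" where
  "weighted_adjacency E A \<longleftrightarrow>
     (\<forall>i j. i \<noteq> j \<longrightarrow> (if (i, j) \<in> E then A $ i $ j > 0 else A $ i $ j = 0))"

definition row_stochastic :: "real ^ 'm ^ 'm \<Rightarrow> bool" where
  "row_stochastic A \<longleftrightarrow> (\<forall>i j. 0 \<le> A $ i $ j) \<and> (\<forall>i. (\<Sum>j\<in>UNIV. A $ i $ j) = 1)"

definition log_partition :: "real \<Rightarrow> real" where
  "log_partition \<eta> = ln (1 + exp \<eta>)"

definition logistic_lik :: "real ^ 'p \<Rightarrow> real \<Rightarrow> real ^ 'p \<Rightarrow> real" where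
  "logistic_lik \<theta> y x = exp (\<theta> \<bullet> (y *\<^sub>R x) - log_partition (\<theta> \<bullet> x))"

definition T_stat ::
  "real ^ 'm ^ 'm \<Rightarrow> (nat \<Rightarrow> 'm \<Rightarrow> 'w \<Rightarrow> real ^ 'p) \<Rightarrow> (nat \<Rightarrow> 'm \<Rightarrow> 'w \<Rightarrow> real)
     \<Rightarrow> nat \<Rightarrow> 'm \<Rightarrow> 'w \<Rightarrow> real ^ 'p" where
  "T_stat A X Y t j \<omega> =
     (\<Sum>k=1..t. \<Sum>i\<in>UNIV. (matpow A (t - k) $ j $ i) *\<^sub>R (Y k i \<omega> *\<^sub>R X k i \<omega>))"

definition B_fun ::
  "real ^ 'm ^ 'm \<Rightarrow> (nat \<Rightarrow> 'm \<Rightarrow> 'w \<Rightarrow> real ^ 'p) \<Rightarrow> nat \<Rightarrow> 'm \<Rightarrow> 'w \<Rightarrow> real ^ 'p \<Rightarrow> real" where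
  "B_fun A X t j \<omega> \<theta> =
     (\<Sum>k=1..t. \<Sum>i\<in>UNIV. matpow A (t - k) $ j $ i * log_partition (\<theta> \<bullet> X k i \<omega>))"

text \<open>
  A maximizer need not exist (e.g. for separated data); \<open>arg_max\<close> then returns an unspecified point.
  If there are several maximizers it returns one of them.
\<close>

definition mle ::
  "real ^ 'm ^ 'm \<Rightarrow> (nat \<Rightarrow> 'm \<Rightarrow> 'w \<Rightarrow> real ^ 'p) \<Rightarrow> (nat \<Rightarrow> 'm \<Rightarrow> 'w \<Rightarrow> real)
     \<Rightarrow> nat \<Rightarrow> 'm \<Rightarrow> 'w \<Rightarrow> real ^ 'p" where
  "mle A X Y t j \<omega> = arg_max (\<lambda>\<theta>. \<theta> \<bullet> T_stat A X Y t j \<omega> - B_fun A X t j \<omega> \<theta>) (\<lambda>_. True)"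

definition posterior ::
  "real ^ 'm ^ 'm \<Rightarrow> (nat \<Rightarrow> 'm \<Rightarrow> 'w \<Rightarrow> real ^ 'p) \<Rightarrow> (nat \<Rightarrow> 'm \<Rightarrow> 'w \<Rightarrow> real)
     \<Rightarrow> (real ^ 'p \<Rightarrow> real) \<Rightarrow> nat \<Rightarrow> 'm \<Rightarrow> 'w \<Rightarrow> (real ^ 'p) measure" where
  "posterior A X Y \<pi> t j \<omega> =
     (let w = (\<lambda>\<theta>. ennreal (exp (\<theta> \<bullet> T_stat A X Y t j \<omega> - B_fun A X t j \<omega> \<theta>) * \<pi> \<theta>))
      in density lborel (\<lambda>\<theta>. w \<theta> / (\<integral>\<^sup>+ \<theta>'. w \<theta>' \<partial>lborel)))"

text \<open>
  The \<open>(a, b)\<close> entry of \<open>1/(mt) \<Sum>\<^sub>i (X\<^sup>i)\<^sup>T W\<^sup>i(\<theta>) X\<^sup>i\<close> with the products written out: \<open>X\<^sup>i\<close> is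
  \<open>t \<times> p\<close> with \<open>t\<close> varying, so it has no matrix type of its own.
\<close>

definition V_hat ::
  "(nat \<Rightarrow> 'm::finite \<Rightarrow> 'w \<Rightarrow> real ^ 'p) \<Rightarrow> real ^ 'p \<Rightarrow> nat \<Rightarrow> 'w \<Rightarrow> real ^ 'p ^ 'p" where
  "V_hat X \<theta> t \<omega> = (\<chi> a b. 1 / (real CARD('m) * real t) *
     (\<Sum>i\<in>UNIV. \<Sum>k=1..t. X k i \<omega> $ a
        * (exp (\<theta> \<bullet> X k i \<omega>) / (1 + exp (\<theta> \<bullet> X k i \<omega>))\<^sup>2) * X k i \<omega> $ b))"

text \<open>Lebesgue density of \<open>N(0, S)\<close>, for positive definite \<open>S\<close>.\<close>

definition mvn_density :: "real ^ 'p ^ 'p \<Rightarrow> real ^ 'p \<Rightarrow> real" where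
  "mvn_density S x =
     exp (- (x \<bullet> (matrix_inv S *v x)) / 2) / sqrt ((2 * pi) ^ CARD('p) * det S)"

text \<open>
  Convergence in probability to a constant, in outer probability, so that it is meaningful without
  measurability of \<open>Z t\<close> (the measure of a non-measurable set is \<open>0\<close> in the library).  For
  measurable \<open>Z t\<close> this is the usual notion, as the lemma below shows.
\<close>

definition tendsto_in_prob :: "'w measure \<Rightarrow> (nat \<Rightarrow> 'w \<Rightarrow> 'b::metric_space) \<Rightarrow> 'b \<Rightarrow> bool" where
  "tendsto_in_prob M Z z \<longleftrightarrow>
     (\<forall>\<epsilon>>0. \<exists>E. (\<forall>t. E t \<in> sets M \<and> {\<omega> \<in> space M. dist (Z t \<omega>) z > \<epsilon>} \<subseteq> E t)
              \<and> (\<lambda>t. measure M (E t)) \<longlonglongrightarrow> 0)"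

lemma tendsto_in_prob_measurable_iff:
  fixes Z :: "nat \<Rightarrow> 'w \<Rightarrow> 'b::{metric_space, second_countable_topology}"
  assumes "prob_space M" and [measurable]: "\<And>t. Z t \<in> borel_measurable M"
  shows "tendsto_in_prob M Z z \<longleftrightarrow>
     (\<forall>\<epsilon>>0. (\<lambda>t. measure M {\<omega> \<in> space M. dist (Z t \<omega>) z > \<epsilon>}) \<longlonglongrightarrow> 0)"
proof -
  interpret prob_space M by fact
  have meas: "{\<omega> \<in> space M. dist (Z t \<omega>) z > \<epsilon>} \<in> sets M" for t \<epsilon>
    by measurable
  have "(\<lambda>t. measure M {\<omega> \<in> space M. dist (Z t \<omega>) z > \<epsilon>}) \<longlonglongrightarrow> 0"
    if "\<forall>t. E t \<in> sets M \<and> {\<omega> \<in> space M. dist (Z t \<omega>) z > \<epsilon>} \<subseteq> E t"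
      and "(\<lambda>t. measure M (E t)) \<longlonglongrightarrow> 0" for E \<epsilon>
    by (rule tendsto_sandwich[OF _ _ tendsto_const that(2)])
       (use that(1) in \<open>auto intro!: finite_measure_mono always_eventually\<close>)
  moreover have "\<exists>E. (\<forall>t. E t \<in> sets M \<and> {\<omega> \<in> space M. dist (Z t \<omega>) z > \<epsilon>} \<subseteq> E t)
                   \<and> (\<lambda>t. measure M (E t)) \<longlonglongrightarrow> 0"
    if "(\<lambda>t. measure M {\<omega> \<in> space M. dist (Z t \<omega>) z > \<epsilon>}) \<longlonglongrightarrow> 0" for \<epsilon>
    using that meas by (intro exI[of _ "\<lambda>t. {\<omega> \<in> space M. dist (Z t \<omega>) z > \<epsilon>}"]) auto
  ultimately show ?thesis
    unfolding tendsto_in_prob_def by blast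
qed

end

theory Submission
  imports Defs
begin

text \<open>
  The weights \<open>[A\<^sup>t\<^sup>-\<^sup>k]\<^sub>j\<^sub>i / t\<close> lie between \<open>0\<close> and \<open>1 / t\<close> and sum to \<open>1\<close>, so averages with these weights obey
  a weak law of large numbers under a first moment only.  Hence the scaled log-likelihood converges
  pointwise to its expectation, which is uniquely maximal at the true parameter, and concavity turns this
  into consistency of the maximizer.  Around the maximizer the gradient vanishes, the weighted Hessian
  converges to the Fisher information, and the third moment bounds the remainder; a deterministic Laplace
  argument then gives the \<open>L\<^sup>1\<close> limit of the rescaled posterior.  It is carried out along sequences
  \<open>(t\<^sub>n, \<omega>\<^sub>n)\<close> and transferred to convergence in probability by expressing the latter as convergence
  along a filter on pairs \<open>(t, \<omega>)\<close>.
\<close>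

section \<open>Gaussian integrals\<close>

text \<open>The maximizer can fail to exist for some data, and neither it nor the L1 distance is
  known to be measurable. Both difficulties are absorbed by \<open>prob_filter\<close>: limits in
  probability obey the ordinary \<open>tendsto\<close> calculus, with no choice of almost surely
  convergent subsequences. Dominated convergence, however, is about sequences; this forces the
  passage to selected pairs (t, \<omega>), in which \<omega> changes along with t. The random
  Lipschitz constant of the scaled log-likelihood needs a first moment of the covariates, which is
  extracted from the finiteness of the expected log-likelihood. Two different averages occur: an
  agent's Hessian carries the network weights, whereas \<open>V_hat\<close> gives every agent the
  weight 1/m. Both weight systems have total mass t, so both averages share one limit. This is why
  the same Gaussian serves every agent, and why the scale is sqrt t and not sqrt (m t). The Hessian
  is evaluated at the true parameter, which keeps its summands i.i.d.; moving it away from the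
  maximizer costs the estimation error times a third moment.\<close>

lemma borel_measurable_shear:
  "(\<lambda>x::real^'n. (\<chi> i. if i = m then x $ m + c * x $ n else x $ i)) \<in> borel_measurable borel"
proof (intro borel_measurable_continuous_onI continuous_on_vec_lambda)
  show "continuous_on UNIV (\<lambda>x::real^'n. if i = m then x $ m + c * x $ n else x $ i)" for i
    by (cases "i = m") (auto intro!: continuous_intros)
qed

text \<open>By Fubini coordinate m can be integrated first; with the other coordinates fixed, the
  shear is a translation of that one coordinate.\<close>

lemma nn_integral_lborel_shear:
  fixes g :: "real ^ 'n \<Rightarrow> ennreal"
  assumes [measurable]: "g \<in> borel_measurable borel" and "m \<noteq> n"
  shows "(\<integral>\<^sup>+x. g (\<chi> i. if i = m then x $ m + c * x $ n else x $ i) \<partial>lborel) = (\<integral>\<^sup>+x. g x \<partial>lborel)"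
proof -
  interpret product_sigma_finite "\<lambda>_::real^'n. lborel :: real measure" ..
  define B :: "(real^'n) set" where "B = Basis - {axis m 1}"
  define S :: "(real^'n \<Rightarrow> real) \<Rightarrow> real^'n" where "S f = (\<Sum>b\<in>Basis. f b *\<^sub>R b)" for f
  have Bas: "Basis = insert (axis m 1) B" and mB: "axis m 1 \<notin> B" and finB: "finite B"
    by (auto simp: B_def)
  have nB: "axis n (1::real) \<in> B"
    using assms(2) by (auto simp: B_def axis_eq_axis)
  have [measurable]: "S \<in> borel_measurable (Pi\<^sub>M Basis (\<lambda>_. lborel))"
    unfolding S_def by measurable
  have Snth: "S f $ i = f (axis i 1)" for f i
  proof -
    have "S f $ i = S f \<bullet> axis i 1" by (simp add: inner_axis)
    also have "\<dots> = f (axis i 1)"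
      unfolding S_def by (subst inner_sum_left_Basis) auto
    finally show ?thesis .
  qed
  have shear: "(\<chi> i. if i = m then S f $ m + c * S f $ n else S f $ i)
      = S (f(axis m 1 := f (axis m 1) + c * f (axis n 1)))" for f
    by (intro iffD2[OF vec_eq_iff] allI) (simp add: Snth axis_eq_axis)
  \<comment> \<open>Lebesgue measure is the image of a product measure on coordinate functions,
    which is where a single coordinate can be split off.\<close>
  have lb: "integral\<^sup>N lborel h = (\<integral>\<^sup>+f. h (S f) \<partial>Pi\<^sub>M Basis (\<lambda>_. lborel))"
    if "h \<in> borel_measurable borel" for h :: "real^'n \<Rightarrow> ennreal"
    unfolding S_def using that by (subst lborel_eq) (simp add: nn_integral_distr)
  have [measurable]: "(\<lambda>x::real^'n. (\<chi> i. if i = m then x $ m + c * x $ n else x $ i)) \<in> borel_measurable borel"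
    by (rule borel_measurable_shear)
  have "(\<integral>\<^sup>+x. g (\<chi> i. if i = m then x $ m + c * x $ n else x $ i) \<partial>lborel)
      = (\<integral>\<^sup>+f. g (\<chi> i. if i = m then S f $ m + c * S f $ n else S f $ i) \<partial>Pi\<^sub>M Basis (\<lambda>_. lborel))"
    by (subst lb) auto
  also have "\<dots> = (\<integral>\<^sup>+f. g (S (f(axis m 1 := f (axis m 1) + c * f (axis n 1)))) \<partial>Pi\<^sub>M (insert (axis m 1) B) (\<lambda>_. lborel))"
    by (simp add: shear Bas[symmetric])
  also have "\<dots> = (\<integral>\<^sup>+x. (\<integral>\<^sup>+y. g (S ((x(axis m 1 := y))(axis m 1 := (x(axis m 1 := y)) (axis m 1) + c * (x(axis m 1 := y)) (axis n 1)))) \<partial>lborel) \<partial>Pi\<^sub>M B (\<lambda>_. lborel))"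
    by (rule product_nn_integral_insert[OF finB mB])
       (unfold shear[symmetric] Bas[symmetric], measurable)
  also have "\<dots> = (\<integral>\<^sup>+x. (\<integral>\<^sup>+y. g (S (x(axis m 1 := c * x (axis n 1) + 1 * y))) \<partial>lborel) \<partial>Pi\<^sub>M B (\<lambda>_. lborel))"
    using assms(2) by (simp add: axis_eq_axis add.commute)
  also have "\<dots> = (\<integral>\<^sup>+x. (\<integral>\<^sup>+y. g (S (x(axis m 1 := y))) \<partial>lborel) \<partial>Pi\<^sub>M B (\<lambda>_. lborel))"
  proof (rule nn_integral_cong)
    fix x assume x: "x \<in> space (Pi\<^sub>M B (\<lambda>_. lborel :: real measure))"
    have [measurable]: "(\<lambda>y. S (x(axis m 1 := y))) \<in> borel_measurable borel"
    proof -
      have "(\<lambda>y. x(axis m 1 := y)) \<in> measurable lborel (Pi\<^sub>M (insert (axis m 1) B) (\<lambda>_. lborel))"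
        using x by (intro measurable_fun_upd[where J=B]) auto
      then show ?thesis using Bas by (auto intro: measurable_compose)
    qed
    show "(\<integral>\<^sup>+y. g (S (x(axis m 1 := c * x (axis n 1) + 1 * y))) \<partial>lborel) = (\<integral>\<^sup>+y. g (S (x(axis m 1 := y))) \<partial>lborel)"
      by (subst nn_integral_real_affine[where c=1 and t="c * x (axis n 1)" and f="\<lambda>y. g (S (x(axis m 1 := y)))"]) auto
  qed
  also have "\<dots> = (\<integral>\<^sup>+f. g (S f) \<partial>Pi\<^sub>M (insert (axis m 1) B) (\<lambda>_. lborel))"
    by (rule product_nn_integral_insert[OF finB mB, symmetric]) (unfold Bas[symmetric], measurable)
  also have "\<dots> = (\<integral>\<^sup>+x. g x \<partial>lborel)"
    by (subst lb) (auto simp: Bas[symmetric])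
  finally show ?thesis .
qed

text \<open>Exchanging two coordinates maps boxes to boxes and only permutes the side lengths, so
  the image measure agrees with Lebesgue measure on boxes.\<close>

lemma nn_integral_lborel_transpose:
  fixes g :: "real ^ 'n \<Rightarrow> ennreal"
  assumes [measurable]: "g \<in> borel_measurable borel"
  shows "(\<integral>\<^sup>+x. g (\<chi> i. x $ Transposition.transpose m n i) \<partial>lborel) = (\<integral>\<^sup>+x. g x \<partial>lborel)"
proof -
  define T :: "real^'n \<Rightarrow> real^'n" where "T x = (\<chi> i. x $ Transposition.transpose m n i)" for x
  have [measurable]: "T \<in> borel_measurable borel"
    unfolding T_def by (intro borel_measurable_continuous_onI continuous_intros)
  have TT: "T (T x) = x" for x
    by (simp add: T_def vec_eq_iff)
  have "lborel = distr lborel borel T"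
  proof (rule lborel_eqI)
    fix l u :: "real^'n" assume "\<And>b. b \<in> Basis \<Longrightarrow> l \<bullet> b \<le> u \<bullet> b"
    then have lu: "l $ i \<le> u $ i" for i
      using \<open>\<And>b. b \<in> Basis \<Longrightarrow> l \<bullet> b \<le> u \<bullet> b\<close>[of "axis i 1"] by (simp add: inner_axis)
    \<comment> \<open>\<open>T\<close> is its own inverse, so the preimage of a box is the box with
      exchanged corners.\<close>
    have "T -` box l u = box (T l) (T u)"
      by (auto simp: mem_box_cart T_def) (metis transpose_involutory)+
    then have "emeasure (distr lborel borel T) (box l u) = emeasure lborel (box (T l) (T u))"
      by (simp add: emeasure_distr)
    also have "\<dots> = (\<Prod>b\<in>Basis. (T u - T l) \<bullet> b)"
      using lu by (subst emeasure_lborel_box) (auto simp: T_def Basis_vec_def inner_axis)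
    also have "(\<Prod>b\<in>Basis. (T u - T l) \<bullet> b) = (\<Prod>i\<in>UNIV. (T u - T l) $ i)"
      by (simp add: Basis_vec_def inner_axis UNION_singleton_eq_range prod.reindex inj_on_def axis_eq_axis)
    also have "\<dots> = (\<Prod>i\<in>UNIV. (u - l) $ i)"
      using prod.permute[OF permutes_swap_id[of m UNIV n], of "\<lambda>i. (u - l) $ i"]
      by (simp add: T_def comp_def)
    also have "\<dots> = (\<Prod>b\<in>Basis. (u - l) \<bullet> b)"
      by (simp add: Basis_vec_def inner_axis UNION_singleton_eq_range prod.reindex inj_on_def axis_eq_axis)
    finally show "emeasure (distr lborel borel T) (box l u) = (\<Prod>b\<in>Basis. (u - l) \<bullet> b)" .
  qed simp
  then have "(\<integral>\<^sup>+x. g x \<partial>lborel) = (\<integral>\<^sup>+x. g x \<partial>distr lborel borel T)" by simp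
  also have "\<dots> = (\<integral>\<^sup>+x. g (T x) \<partial>lborel)" by (simp add: nn_integral_distr)
  finally show ?thesis by (simp add: T_def)
qed

lemma nn_integral_lborel_stretch:
  fixes g :: "real ^ 'n \<Rightarrow> ennreal"
  assumes [measurable]: "g \<in> borel_measurable borel" and c: "\<And>i. c i \<noteq> 0"
  shows "(\<integral>\<^sup>+x. g x \<partial>lborel) = ennreal \<bar>\<Prod>i\<in>UNIV. c i\<bar> * (\<integral>\<^sup>+x. g (\<chi> i. c i * x $ i) \<partial>lborel)"
proof -
  \<comment> \<open>The affine substitution rule indexes scale factors by basis vectors;
    \<open>d\<close> recovers the index from the basis vector, which is possible since
    \<open>axis\<close> is injective in it.\<close>
  define d :: "real^'n \<Rightarrow> real" where "d b = c (SOME i. b = axis i 1)" for b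
  have d: "d (axis i 1) = c i" for i
    unfolding d_def by (rule arg_cong[of _ _ c]) (auto simp: axis_eq_axis)
  define T :: "real^'n \<Rightarrow> real^'n" where "T x = 0 + (\<Sum>j\<in>Basis. (d j * (x \<bullet> j)) *\<^sub>R j)" for x
  have T: "T = (\<lambda>x. \<chi> i. c i * x $ i)"
  proof
    fix x show "T x = (\<chi> i. c i * x $ i)"
    proof (intro iffD2[OF vec_eq_iff] allI)
      fix i
      have "T x $ i = T x \<bullet> axis i 1" by (simp add: inner_axis)
      also have "\<dots> = d (axis i 1) * (x \<bullet> axis i 1)"
        unfolding T_def add_0 by (subst inner_sum_left_Basis) auto
      finally show "T x $ i = (\<chi> i. c i * x $ i) $ i" by (simp add: d inner_axis)
    qed
  qed
  have [measurable]: "T \<in> borel_measurable borel"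
    unfolding T_def by simp
  have pr: "(\<Prod>j\<in>Basis. \<bar>d j\<bar>) = \<bar>\<Prod>i\<in>UNIV. c i\<bar>"
    by (simp add: Basis_vec_def UNION_singleton_eq_range prod.reindex inj_on_def axis_eq_axis d abs_prod)
  have "lborel = density (distr lborel borel T) (\<lambda>_. (\<Prod>j\<in>Basis. \<bar>d j\<bar>))"
    unfolding T_def by (rule lborel_affine_euclidean) (auto simp: Basis_vec_def d c)
  then have "(\<integral>\<^sup>+x. g x \<partial>lborel) = (\<integral>\<^sup>+x. g x \<partial>density (distr lborel borel T) (\<lambda>_. ennreal \<bar>\<Prod>i\<in>UNIV. c i\<bar>))"
    by (simp add: pr)
  also have "\<dots> = ennreal \<bar>\<Prod>i\<in>UNIV. c i\<bar> * (\<integral>\<^sup>+x. g (T x) \<partial>lborel)"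
    by (simp add: nn_integral_density nn_integral_distr nn_integral_cmult)
  finally show ?thesis by (simp add: T)
qed

lemma borel_measurable_matrix_vector_mult [measurable]:
  "(\<lambda>x. (A::real^'n^'m) *v x) \<in> borel_measurable borel"
  by (intro borel_measurable_continuous_onI linear_continuous_on)
     (simp add: linear_conv_bounded_linear[symmetric] matrix_vector_mul_linear)

text \<open>
  The change of variables formula of the library is restricted to well-ordered index types;
  row reduction needs no order on the indices.
\<close>

lemma nn_integral_lborel_matrix:
  fixes A :: "real ^ 'n ^ 'n" and g :: "real ^ 'n \<Rightarrow> ennreal"
  assumes "det A \<noteq> 0" and "g \<in> borel_measurable borel"
  shows "(\<integral>\<^sup>+x. g x \<partial>lborel) = ennreal \<bar>det A\<bar> * (\<integral>\<^sup>+x. g (A *v x) \<partial>lborel)"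
  using assms
proof (induction A arbitrary: g rule: induct_matrix_row_operations)
  case (1 A i)
  then show ?case by (simp add: det_zero_row)
next
  case (2 A)
  have det: "det A = (\<Prod>i\<in>UNIV. A $ i $ i)"
    by (rule det_diagonal) (use 2 in auto)
  with 2 have nz: "A $ i $ i \<noteq> 0" for i by auto
  have Ax: "A *v x = (\<chi> i. A $ i $ i * x $ i)" for x
  proof (simp add: vec_eq_iff matrix_vector_mult_def, intro allI)
    fix i
    have "(\<Sum>j\<in>UNIV. A $ i $ j * x $ j) = (\<Sum>j\<in>UNIV. if j = i then A $ i $ i * x $ i else 0)"
      using 2(1) by (intro sum.cong) auto
    then show "(\<Sum>j\<in>UNIV. A $ i $ j * x $ j) = A $ i $ i * x $ i" by simp
  qed
  show ?case
    unfolding Ax det using nz 2 by (intro nn_integral_lborel_stretch) auto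
next
  case (3 A m n)
  let ?A = "\<chi> i j. A $ i $ Transposition.transpose m n j"
  have "det ?A = of_int (sign (Transposition.transpose m n)) * det A"
    by (rule det_permute_columns) (simp add: permutes_swap_id)
  then have d: "\<bar>det ?A\<bar> = \<bar>det A\<bar>"
    using 3(2) by (simp add: sign_swap_id)
  \<comment> \<open>Permuting the columns of the matrix amounts to permuting the entries of its
    argument.\<close>
  have Ax: "?A *v x = A *v (\<chi> i. x $ Transposition.transpose m n i)" for x
    by (subst vec_eq_iff, intro allI, simp only: matrix_vector_mult_def vec_lambda_beta,
        subst sum.permute[OF permutes_swap_id[of m UNIV n]]) simp_all
  note [measurable] = \<open>g \<in> borel_measurable borel\<close>
  have "(\<integral>\<^sup>+x. g (?A *v x) \<partial>lborel) = (\<integral>\<^sup>+x. g (A *v x) \<partial>lborel)"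
    unfolding Ax by (rule nn_integral_lborel_transpose[of "\<lambda>x. g (A *v x)"]) measurable
  then show ?case using 3(1)[of g] 3(3,4) d by auto
next
  case (4 A m n c)
  let ?A = "\<chi> i. if i = m then row m A + c *\<^sub>R row n A else row i A"
  have d: "det ?A = det A"
    unfolding scalar_mult_eq_scaleR[symmetric] by (rule det_row_operation[OF 4(2)])
  have Ax: "?A *v x = (\<chi> i. if i = m then (A *v x) $ m + c * (A *v x) $ n else (A *v x) $ i)" for x
    by (simp add: vec_eq_iff matrix_vector_mult_def row_def sum.distrib sum_distrib_left algebra_simps)
  note [measurable] = \<open>g \<in> borel_measurable borel\<close>
  have [measurable]: "(\<lambda>x::real^'n. (\<chi> i. if i = m then x $ m + c * x $ n else x $ i)) \<in> borel_measurable borel"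
    by (rule borel_measurable_shear)
  \<comment> \<open>A row operation acts after the matrix, so the shear is absorbed into the
    integrand and the induction hypothesis is used for the sheared \<open>g\<close>; hence
    \<open>g\<close> is arbitrary in the induction.\<close>
  have "(\<integral>\<^sup>+x. g x \<partial>lborel) = (\<integral>\<^sup>+x. g (\<chi> i. if i = m then x $ m + c * x $ n else x $ i) \<partial>lborel)"
    using 4(2) by (simp add: nn_integral_lborel_shear)
  also have "\<dots> = ennreal \<bar>det A\<bar> * (\<integral>\<^sup>+x. g (?A *v x) \<partial>lborel)"
    unfolding Ax using 4 d by (intro 4(1)) auto
  finally show ?case using d by simp
qed

text \<open>Gram-Schmidt for the inner product given by \<open>V\<close>; the orthonormal vectors
  become the columns of \<open>S\<close>. The induction runs over subsets of the index type, which
  serves in place of an ordering of the basis.\<close>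

lemma exists_orthonormalizing_matrix:
  fixes V :: "real ^ 'n ^ 'n"
  assumes sym: "transpose V = V" and pd: "\<And>x. x \<noteq> 0 \<Longrightarrow> 0 < x \<bullet> (V *v x)"
  shows "\<exists>S :: real^'n^'n. transpose S ** V ** S = mat 1"
proof -
  have symm: "x \<bullet> (V *v y) = y \<bullet> (V *v x)" for x y
    by (metis dot_lmul_matrix sym inner_commute transpose_matrix_vector)
  have "\<exists>s :: 'n \<Rightarrow> real^'n. \<forall>a\<in>J. \<forall>b\<in>J. s a \<bullet> (V *v s b) = (if a = b then 1 else 0)" for J :: "'n set"
    using finite[of J]
  proof (induction J rule: finite_induct)
    case (insert c J)
    \<comment> \<open>\<open>J\<close> misses \<open>c\<close>, so its vectors are fewer than the
      dimension and leave some \<open>x\<close> outside their span.\<close>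
    then obtain s :: "'n \<Rightarrow> real^'n" where s: "\<And>a b. a \<in> J \<Longrightarrow> b \<in> J \<Longrightarrow> s a \<bullet> (V *v s b) = (if a = b then 1 else 0)"
      by blast
    have "card J < CARD('n)"
      using insert.hyps by (metis card_seteq finite iso_tuple_UNIV_I linorder_not_le subset_UNIV)
    then have "dim (span (s ` J)) < DIM(real^'n)"
      by (metis DIM_cart DIM_real dim_le_card' dim_span finite card_image_le finite_imageI le_trans mult.right_neutral not_less)
    then obtain x where x: "x \<notin> span (s ` J)"
      by (metis dim_UNIV UNIV_eq_I nat_neq_iff)
    define y where "y = x - (\<Sum>a\<in>J. (s a \<bullet> (V *v x)) *\<^sub>R s a)"
    have "y \<noteq> 0"
    proof
      assume "y = 0"
      then have "x = (\<Sum>a\<in>J. (s a \<bullet> (V *v x)) *\<^sub>R s a)" by (simp add: y_def)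
      also have "\<dots> \<in> span (s ` J)" by (intro span_sum span_scale span_base) auto
      finally show False using x by simp
    qed
    then have pos: "0 < y \<bullet> (V *v y)" by (rule pd)
    have Vy: "V *v y = V *v x - (\<Sum>a\<in>J. (s a \<bullet> (V *v x)) *\<^sub>R (V *v s a))"
      by (simp add: y_def matrix_vector_mult_diff_distrib linear_sum[OF matrix_vector_mul_linear] matrix_vector_mult_scaleR)
    have orth: "s b \<bullet> (V *v y) = 0" if "b \<in> J" for b
    proof -
      have "s b \<bullet> (V *v y) = s b \<bullet> (V *v x) - (\<Sum>a\<in>J. (s a \<bullet> (V *v x)) * (s b \<bullet> (V *v s a)))"
        by (simp add: Vy inner_diff_right inner_sum_right)
      also have "(\<Sum>a\<in>J. (s a \<bullet> (V *v x)) * (s b \<bullet> (V *v s a))) = (\<Sum>a\<in>J. if a = b then s b \<bullet> (V *v x) else 0)"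
        using that by (intro sum.cong) (auto simp: s)
      finally show ?thesis using that by simp
    qed
    define u where "u = (1 / sqrt (y \<bullet> (V *v y))) *\<^sub>R y"
    have "u \<bullet> (V *v u) = 1"
      using pos by (simp add: u_def matrix_vector_mult_scaleR field_simps)
    moreover have "s b \<bullet> (V *v u) = 0" if "b \<in> J" for b
      using orth[OF that] by (simp add: u_def matrix_vector_mult_scaleR)
    moreover from this have "u \<bullet> (V *v s b) = 0" if "b \<in> J" for b
      using that symm by metis
    ultimately show ?case
      using s insert.hyps by (intro exI[of _ "s(c := u)"]) auto
  qed simp
  from this[of UNIV] obtain s :: "'n \<Rightarrow> real^'n" where s: "\<And>a b. s a \<bullet> (V *v s b) = (if a = b then 1 else 0)"
    by blast
  define S :: "real^'n^'n" where "S = (\<chi> i j. s j $ i)"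
  have "transpose S ** V ** S = mat 1"
  proof -
    have "(transpose S ** V ** S) $ a $ b = s a \<bullet> (V *v s b)" for a b
      unfolding matrix_mul_assoc[symmetric]
      by (simp add: S_def matrix_matrix_mult_def matrix_vector_mult_def inner_vec_def transpose_def)
    then show ?thesis by (simp add: s vec_eq_iff mat_def)
  qed
  then show ?thesis by blast
qed

lemma nn_integral_exp_neg_norm_square:
  "(\<integral>\<^sup>+x. ennreal (exp (- (x \<bullet> x) / 2)) \<partial>(lborel :: (real^'n) measure)) = ennreal (sqrt ((2 * pi) ^ CARD('n)))"
proof -
  have *: "(\<integral>\<^sup>+x. ennreal (exp (- x\<^sup>2 / 2)) \<partial>lborel) = ennreal (sqrt (2 * pi))"
  proof -
    have "(\<integral>\<^sup>+x. ennreal (exp (- x\<^sup>2 / 2)) \<partial>lborel) = (\<integral>\<^sup>+x. ennreal (sqrt (2 * pi)) * ennreal (std_normal_density x) \<partial>lborel)"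
      by (intro nn_integral_cong) (simp add: std_normal_density_def ennreal_mult'[symmetric])
    also have "\<dots> = ennreal (sqrt (2 * pi)) * (\<integral>\<^sup>+x. ennreal (std_normal_density x) \<partial>lborel)"
      by (rule nn_integral_cmult) simp
    also have "(\<integral>\<^sup>+x. ennreal (std_normal_density x) \<partial>lborel) = 1"
      by (subst nn_integral_eq_integral) auto
    finally show ?thesis by simp
  qed
  have "exp (- (x \<bullet> x) / 2) = (\<Prod>b\<in>Basis. exp (- (x \<bullet> b)\<^sup>2 / 2))" for x :: "real^'n"
    by (subst euclidean_inner) (simp add: exp_sum[symmetric] sum_negf sum_divide_distrib power2_eq_square)
  then have "(\<integral>\<^sup>+x. ennreal (exp (- (x \<bullet> x) / 2)) \<partial>(lborel :: (real^'n) measure))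
      = (\<integral>\<^sup>+x. (\<Prod>b\<in>Basis. ennreal (exp (- (x \<bullet> b)\<^sup>2 / 2))) \<partial>(lborel :: (real^'n) measure))"
    by (simp add: prod_ennreal)
  also have "\<dots> = (\<Prod>b\<in>(Basis::(real^'n) set). ennreal (sqrt (2 * pi)))"
    by (subst nn_integral_lborel_prod) (auto simp: *[simplified])
  also have "\<dots> = ennreal (sqrt ((2 * pi) ^ CARD('n)))"
    by (simp add: ennreal_power real_sqrt_power[symmetric])
  finally show ?thesis .
qed

text \<open>Substituting x = S y with an orthonormalizing \<open>S\<close> turns the quadratic form
  into y \<bullet> y. Taking determinants gives (det S)^2 * det V = 1, which yields both the sign of
  \<open>det V\<close> and the Jacobian.\<close>

lemma
  fixes V :: "real ^ 'n ^ 'n"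
  assumes sym: "transpose V = V" and pd: "\<And>x. x \<noteq> 0 \<Longrightarrow> 0 < x \<bullet> (V *v x)"
  shows det_pos_def: "0 < det V"
    and has_bochner_integral_gaussian: "has_bochner_integral lborel (\<lambda>x. exp (- (x \<bullet> (V *v x)) / 2)) (sqrt ((2 * pi) ^ CARD('n) / det V))"
proof -
  obtain S :: "real^'n^'n" where S: "transpose S ** V ** S = mat 1"
    using exists_orthonormalizing_matrix[OF assms] by blast
  have "det S * det V * det S = 1"
    using arg_cong[OF S, of det] by (simp add: det_mul)
  then have d: "(det S)\<^sup>2 * det V = 1" by (simp add: power2_eq_square mult_ac)
  then have nz: "det S \<noteq> 0" by auto
  show dV: "0 < det V" using d zero_less_mult_pos[of "(det S)\<^sup>2" "det V"] nz by simp
  have aS: "\<bar>det S\<bar> = sqrt (1 / det V)"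
    using d dV by (intro real_sqrt_unique[symmetric]) (auto simp: field_simps)
  have q: "(S *v y) \<bullet> (V *v (S *v y)) = y \<bullet> y" for y
  proof -
    have "(S *v y) \<bullet> (V *v (S *v y)) = y \<bullet> (transpose S *v (V *v (S *v y)))"
      by (metis dot_lmul_matrix transpose_matrix_vector transpose_transpose)
    also have "\<dots> = y \<bullet> ((transpose S ** V ** S) *v y)"
      by (simp add: matrix_vector_mul_assoc matrix_mul_assoc)
    finally show ?thesis by (simp add: S)
  qed
  have "(\<integral>\<^sup>+x. ennreal (exp (- (x \<bullet> (V *v x)) / 2)) \<partial>lborel)
    = ennreal \<bar>det S\<bar> * (\<integral>\<^sup>+x. ennreal (exp (- (x \<bullet> x) / 2)) \<partial>(lborel :: (real^'n) measure))"
    by (subst nn_integral_lborel_matrix[OF nz]) (auto simp: q)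
  also have "\<dots> = ennreal (sqrt ((2 * pi) ^ CARD('n) / det V))"
    unfolding nn_integral_exp_neg_norm_square aS
    using dV by (subst ennreal_mult[symmetric]) (simp_all add: real_sqrt_mult[symmetric])
  finally show "has_bochner_integral lborel (\<lambda>x. exp (- (x \<bullet> (V *v x)) / 2)) (sqrt ((2 * pi) ^ CARD('n) / det V))"
    using dV by (intro has_bochner_integral_nn_integral) auto
qed

section \<open>Convergence in probability and the law of large numbers\<close>

text \<open>A property is eventual when its failures at each time are covered by a measurable event
  whose probability tends to 0. The cover makes sense for non-measurable properties too, exactly as
  in \<open>tendsto_in_prob\<close>.\<close>

definition prob_filter :: "'w measure \<Rightarrow> (nat \<times> 'w) filter" where
  "prob_filter M = Abs_filter (\<lambda>P. \<exists>E. (\<forall>t. E t \<in> sets M \<and> {\<omega> \<in> space M. \<not> P (t, \<omega>)} \<subseteq> E t)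
     \<and> (\<lambda>t. measure M (E t)) \<longlonglongrightarrow> 0)"

context prob_space
begin

text \<open>The filter axioms have to be verified before \<open>Abs_filter\<close> can be unfolded;
  closure under conjunction is the union bound.\<close>

lemma eventually_prob_filter:
  "eventually P (prob_filter M) \<longleftrightarrow>
     (\<exists>E. (\<forall>t. E t \<in> sets M \<and> {\<omega> \<in> space M. \<not> P (t, \<omega>)} \<subseteq> E t) \<and> (\<lambda>t. prob (E t)) \<longlonglongrightarrow> 0)"
  unfolding prob_filter_def
proof (rule eventually_Abs_filter, rule is_filter.intro, goal_cases)
  case 1
  show ?case by (intro exI[of _ "\<lambda>_. {}"]) auto
next
  case (2 P Q)
  then obtain E F where E: "\<And>t. E t \<in> sets M" "\<And>t. {\<omega> \<in> space M. \<not> P (t, \<omega>)} \<subseteq> E t" "(\<lambda>t. prob (E t)) \<longlonglongrightarrow> 0"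
    and F: "\<And>t. F t \<in> sets M" "\<And>t. {\<omega> \<in> space M. \<not> Q (t, \<omega>)} \<subseteq> F t" "(\<lambda>t. prob (F t)) \<longlonglongrightarrow> 0"
    by blast
  have "(\<lambda>t. prob (E t \<union> F t)) \<longlonglongrightarrow> 0"
  proof (rule tendsto_sandwich[OF _ _ tendsto_const])
    show "(\<lambda>t. prob (E t) + prob (F t)) \<longlonglongrightarrow> 0"
      using tendsto_add[OF E(3) F(3)] by simp
  qed (use E(1) F(1) in \<open>auto intro!: always_eventually measure_Un_le\<close>)
  then show ?case
    using E(1,2) F(1,2) by (intro exI[of _ "\<lambda>t. E t \<union> F t"]) blast
next
  case (3 P Q)
  then show ?case by blast
qed

lemma tendsto_in_prob_iff:
  "tendsto_in_prob M Z z \<longleftrightarrow> ((\<lambda>(t, \<omega>). Z t \<omega>) \<longlongrightarrow> z) (prob_filter M)"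
proof
  assume L: "tendsto_in_prob M Z z"
  show "((\<lambda>(t, \<omega>). Z t \<omega>) \<longlongrightarrow> z) (prob_filter M)"
  proof (rule tendstoI)
    fix e :: real assume "e > 0"
    \<comment> \<open>Passing to e / 2 reconciles the two forms of failure: distance at least e
      here, a strict inequality in the definition.\<close>
    from L[unfolded tendsto_in_prob_def, rule_format, OF half_gt_zero[OF this]]
    obtain E where E: "\<And>t. E t \<in> sets M" "\<And>t. {\<omega> \<in> space M. dist (Z t \<omega>) z > e / 2} \<subseteq> E t"
      "(\<lambda>t. prob (E t)) \<longlonglongrightarrow> 0"
      by blast
    have "{\<omega> \<in> space M. \<not> dist (Z t \<omega>) z < e} \<subseteq> E t" for t
      using E(2)[of t] \<open>e > 0\<close> by force
    then show "\<forall>\<^sub>F x in prob_filter M. dist (case x of (t, \<omega>) \<Rightarrow> Z t \<omega>) z < e"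
      unfolding eventually_prob_filter using E by auto
  qed
next
  assume R: "((\<lambda>(t, \<omega>). Z t \<omega>) \<longlongrightarrow> z) (prob_filter M)"
  show "tendsto_in_prob M Z z"
    unfolding tendsto_in_prob_def
  proof (intro allI impI)
    fix e :: real assume "e > 0"
    from tendstoD[OF R this, unfolded eventually_prob_filter prod.case]
    obtain E where E: "\<And>t. E t \<in> sets M" "\<And>t. {\<omega> \<in> space M. \<not> dist (Z t \<omega>) z < e} \<subseteq> E t"
      "(\<lambda>t. prob (E t)) \<longlonglongrightarrow> 0"
      by blast
    then show "\<exists>E. (\<forall>t. E t \<in> sets M \<and> {\<omega> \<in> space M. dist (Z t \<omega>) z > e} \<subseteq> E t) \<and> (\<lambda>t. prob (E t)) \<longlonglongrightarrow> 0"
      by (intro exI[of _ E]) force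
  qed
qed

text \<open>At the finitely many bad times the whole space serves as the exceptional event.
  Membership in \<open>space M\<close> comes for free, since the filter only tests points of the
  space.\<close>

lemma eventually_prob_filter_time:
  assumes "eventually P sequentially"
  shows "eventually (\<lambda>z. P (fst z) \<and> snd z \<in> space M) (prob_filter M)"
  unfolding eventually_prob_filter
proof (intro exI[of _ "\<lambda>t. if P t then {} else space M"] conjI)
  have "eventually (\<lambda>t. prob (if P t then {} else space M) = 0) sequentially"
    using assms by eventually_elim simp
  then show "(\<lambda>t. prob (if P t then {} else space M)) \<longlonglongrightarrow> 0"
    by (rule tendsto_eventually)
qed auto

lemma filterlim_fst_prob_filter: "filterlim fst sequentially (prob_filter M)"
  unfolding filterlim_iff by (blast intro: eventually_mono[OF eventually_prob_filter_time])

section \<open>Weak law of large numbers for weighted averages\<close>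

lemma tendsto_prob_filterI_L1:
  fixes Z :: "nat \<Rightarrow> 'a \<Rightarrow> real"
  assumes int: "\<And>t. integrable M (Z t)" and lim: "(\<lambda>t. \<integral>\<omega>. \<bar>Z t \<omega> - z\<bar> \<partial>M) \<longlonglongrightarrow> 0"
  shows "((\<lambda>(t, \<omega>). Z t \<omega>) \<longlongrightarrow> z) (prob_filter M)"
proof (rule tendstoI)
  fix e :: real assume "e > 0"
  note [measurable] = borel_measurable_integrable[OF int]
  let ?E = "\<lambda>t. {\<omega> \<in> space M. \<bar>Z t \<omega> - z\<bar> \<ge> e}"
  have "prob (?E t) \<le> (\<integral>\<omega>. \<bar>Z t \<omega> - z\<bar> \<partial>M) / e" for t
    by (rule integral_Markov_inequality_measure[where A="space M"]) (use int \<open>e > 0\<close> in auto)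
  moreover have "(\<lambda>t. (\<integral>\<omega>. \<bar>Z t \<omega> - z\<bar> \<partial>M) / e) \<longlonglongrightarrow> 0"
    using tendsto_divide[OF lim tendsto_const[of e]] \<open>e > 0\<close> by simp
  ultimately have "(\<lambda>t. prob (?E t)) \<longlonglongrightarrow> 0"
    by (intro tendsto_sandwich[where f="\<lambda>_. 0" and g="\<lambda>t. prob (?E t)" and h="\<lambda>t. (\<integral>\<omega>. \<bar>Z t \<omega> - z\<bar> \<partial>M) / e"]) auto
  then show "\<forall>\<^sub>F x in prob_filter M. dist (case x of (t, \<omega>) \<Rightarrow> Z t \<omega>) z < e"
    unfolding eventually_prob_filter
    by (intro exI[of _ ?E]) (auto simp: dist_real_def)
qed

text \<open>Independent centred variables are uncorrelated, so the second moment of the sum keeps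
  only its diagonal terms; the first absolute moment is at most the root of the second.\<close>

lemma weighted_sum_square_bound:
  fixes U :: "'i \<Rightarrow> 'a \<Rightarrow> real"
  assumes indep: "indep_vars (\<lambda>_. borel) U I" and fin: "finite I"
    and zero: "\<And>i. i \<in> I \<Longrightarrow> expectation (U i) = 0"
    and bound: "\<And>i \<omega>. i \<in> I \<Longrightarrow> \<omega> \<in> space M \<Longrightarrow> \<bar>U i \<omega>\<bar> \<le> K"
  shows "expectation (\<lambda>\<omega>. \<bar>\<Sum>i\<in>I. c i * U i \<omega>\<bar>) \<le> sqrt (K\<^sup>2 * (\<Sum>i\<in>I. (c i)\<^sup>2))"
proof -
  have [measurable]: "U i \<in> borel_measurable M" if "i \<in> I" for i
    using indep that by (auto simp: indep_vars_def)
  have int: "integrable M (U i)" if "i \<in> I" for i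
    using bound that by (intro integrable_const_bound[of _ K]) auto
  have int2: "integrable M (\<lambda>\<omega>. U i \<omega> * U k \<omega>)" if "i \<in> I" "k \<in> I" for i k
    using bound that by (intro integrable_const_bound[of _ "K * K"]) (auto simp: abs_mult intro!: mult_mono' AE_I2)
  have cross: "expectation (\<lambda>\<omega>. U i \<omega> * U k \<omega>) = 0" if "i \<in> I" "k \<in> I" "i \<noteq> k" for i k
  proof -
    have "indep_vars (\<lambda>_. borel) U {i, k}"
      using indep that by (intro indep_vars_subset[OF indep]) auto
    then have "expectation (\<lambda>\<omega>. \<Prod>l\<in>{i, k}. U l \<omega>) = (\<Prod>l\<in>{i, k}. expectation (U l))"
      using int that by (intro indep_vars_lebesgue_integral) auto
    then show ?thesis using that zero by simp
  qed
  have sq: "(\<Sum>i\<in>I. c i * U i \<omega>)\<^sup>2 = (\<Sum>i\<in>I. \<Sum>k\<in>I. c i * c k * (U i \<omega> * U k \<omega>))" for \<omega>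
    by (simp add: power2_eq_square sum_product mult_ac)
  have intsq: "integrable M (\<lambda>\<omega>. (\<Sum>i\<in>I. c i * U i \<omega>)\<^sup>2)"
    unfolding sq by (intro Bochner_Integration.integrable_sum integrable_mult_right int2)
  have ints: "integrable M (\<lambda>\<omega>. \<bar>\<Sum>i\<in>I. c i * U i \<omega>\<bar>)"
    by (intro integrable_abs Bochner_Integration.integrable_sum integrable_mult_right int)
  have "expectation (\<lambda>\<omega>. (\<Sum>i\<in>I. c i * U i \<omega>)\<^sup>2) = (\<Sum>i\<in>I. \<Sum>k\<in>I. c i * c k * expectation (\<lambda>\<omega>. U i \<omega> * U k \<omega>))"
    unfolding sq by (simp add: Bochner_Integration.integral_sum int2)
  also have "\<dots> = (\<Sum>i\<in>I. \<Sum>k\<in>I. if i = k then (c i)\<^sup>2 * expectation (\<lambda>\<omega>. U i \<omega> * U i \<omega>) else 0)"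
    by (intro sum.cong) (auto simp: cross power2_eq_square)
  also have "\<dots> = (\<Sum>i\<in>I. (c i)\<^sup>2 * expectation (\<lambda>\<omega>. U i \<omega> * U i \<omega>))"
    using fin by simp
  also have "\<dots> \<le> (\<Sum>i\<in>I. (c i)\<^sup>2 * K\<^sup>2)"
  proof (intro sum_mono mult_left_mono)
    fix i assume i: "i \<in> I"
    have "expectation (\<lambda>\<omega>. U i \<omega> * U i \<omega>) \<le> expectation (\<lambda>_. K\<^sup>2)"
    proof (intro integral_mono int2 i)
      show "U i \<omega> * U i \<omega> \<le> K\<^sup>2" if "\<omega> \<in> space M" for \<omega>
        using bound[OF i that] by (metis abs_ge_zero abs_le_square_iff abs_of_nonneg order_trans power2_eq_square)
    qed auto
    then show "expectation (\<lambda>\<omega>. U i \<omega> * U i \<omega>) \<le> K\<^sup>2" by (simp add: prob_space)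
  qed auto
  finally have v: "expectation (\<lambda>\<omega>. (\<Sum>i\<in>I. c i * U i \<omega>)\<^sup>2) \<le> K\<^sup>2 * (\<Sum>i\<in>I. (c i)\<^sup>2)"
    by (simp add: sum_distrib_left mult.commute)
  \<comment> \<open>Nonnegativity of the variance of the absolute value is the required instance of
    Jensen's inequality.\<close>
  have "(expectation (\<lambda>\<omega>. \<bar>\<Sum>i\<in>I. c i * U i \<omega>\<bar>))\<^sup>2 \<le> expectation (\<lambda>\<omega>. \<bar>\<Sum>i\<in>I. c i * U i \<omega>\<bar>\<^sup>2)"
    using variance_positive[of "\<lambda>\<omega>. \<bar>\<Sum>i\<in>I. c i * U i \<omega>\<bar>"] variance_eq[OF ints] intsq by simp
  also have "\<dots> \<le> K\<^sup>2 * (\<Sum>i\<in>I. (c i)\<^sup>2)" using v by simp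
  finally show ?thesis by (rule real_le_rsqrt)
qed

text \<open>Truncation gives the first-moment version: the truncated part is controlled in \<open>L\<^sup>2\<close>, the remainder in \<open>L\<^sup>1\<close>.\<close>

lemma weighted_law_of_large_numbers:
  fixes D :: "'i \<Rightarrow> 'a \<Rightarrow> 'b" and \<phi> :: "'b \<Rightarrow> real" and c :: "nat \<Rightarrow> 'i \<Rightarrow> real"
  assumes indep: "indep_vars (\<lambda>_. N) D J"
    and distr: "\<And>i. i \<in> J \<Longrightarrow> distr M N (D i) = distr M N (D i0)" and i0: "i0 \<in> J"
    and \<phi>[measurable]: "\<phi> \<in> borel_measurable N" and int: "integrable M (\<lambda>\<omega>. \<phi> (D i0 \<omega>))"
    and I: "\<And>t. finite (I t)" "\<And>t. I t \<subseteq> J"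
    and c: "\<And>t i. i \<in> I t \<Longrightarrow> 0 \<le> c t i" "\<And>t i. t \<ge> 1 \<Longrightarrow> i \<in> I t \<Longrightarrow> c t i \<le> 1 / real t"
      "\<And>t. t \<ge> 1 \<Longrightarrow> (\<Sum>i\<in>I t. c t i) = 1"
  shows "((\<lambda>(t, \<omega>). \<Sum>i\<in>I t. c t i * \<phi> (D i \<omega>)) \<longlongrightarrow> expectation (\<lambda>\<omega>. \<phi> (D i0 \<omega>))) (prob_filter M)"
proof -
  have D[measurable]: "D i \<in> measurable M N" if "i \<in> J" for i
    using indep that by (auto simp: indep_vars_def)
  have transfer: "integrable M (\<lambda>\<omega>. \<psi> (D i \<omega>)) \<longleftrightarrow> integrable M (\<lambda>\<omega>. \<psi> (D i0 \<omega>))"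
    "expectation (\<lambda>\<omega>. \<psi> (D i \<omega>)) = expectation (\<lambda>\<omega>. \<psi> (D i0 \<omega>))"
    if "i \<in> J" "\<psi> \<in> borel_measurable N" for i and \<psi> :: "'b \<Rightarrow> real"
    using integrable_distr_eq[OF D[OF that(1)] that(2)] integrable_distr_eq[OF D[OF i0] that(2)]
      integral_distr[OF D[OF that(1)] that(2)] integral_distr[OF D[OF i0] that(2)] distr[OF that(1)]
    by simp_all
  have ints: "integrable M (\<lambda>\<omega>. \<phi> (D i \<omega>))" if "i \<in> J" for i
    using transfer(1)[OF that \<phi>] int by simp
  define \<mu> where "\<mu> = expectation (\<lambda>\<omega>. \<phi> (D i0 \<omega>))"
  define \<tau> where "\<tau> K x = (if \<bar>\<phi> x\<bar> \<le> K then \<phi> x else 0)" for K x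
  define \<rho> where "\<rho> K x = \<phi> x - \<tau> K x" for K x
  have [measurable]: "\<tau> K \<in> borel_measurable N" "\<rho> K \<in> borel_measurable N" for K
    unfolding \<tau>_def \<rho>_def by measurable
  have \<tau>b: "\<bar>\<tau> K x\<bar> \<le> K" if "K \<ge> 0" for K x using that by (auto simp: \<tau>_def)
  have \<tau>int: "integrable M (\<lambda>\<omega>. \<tau> K (D i \<omega>))" if "i \<in> J" for i K
    using that by (intro Bochner_Integration.integrable_bound[OF ints[OF that]]) (auto simp: \<tau>_def)
  have \<rho>int: "integrable M (\<lambda>\<omega>. \<rho> K (D i \<omega>))" if "i \<in> J" for i K
    unfolding \<rho>_def using that ints \<tau>int by auto
  \<comment> \<open>At each point the truncation is inactive once K exceeds the value there, and the
    tail is dominated by the integrable modulus of \<phi>.\<close>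
  have lim\<rho>: "(\<lambda>K::nat. expectation (\<lambda>\<omega>. \<bar>\<rho> (real K) (D i0 \<omega>)\<bar>)) \<longlonglongrightarrow> 0"
  proof -
    have "(\<lambda>K::nat. expectation (\<lambda>\<omega>. \<bar>\<rho> (real K) (D i0 \<omega>)\<bar>)) \<longlonglongrightarrow> expectation (\<lambda>\<omega>. 0)"
    proof (rule integral_dominated_convergence[where w="\<lambda>\<omega>. \<bar>\<phi> (D i0 \<omega>)\<bar>"])
      show "AE \<omega> in M. (\<lambda>K::nat. \<bar>\<rho> (real K) (D i0 \<omega>)\<bar>) \<longlonglongrightarrow> 0"
      proof (rule AE_I2)
        fix \<omega>
        obtain K0 :: nat where "\<bar>\<phi> (D i0 \<omega>)\<bar> \<le> real K0" using real_arch_simple by blast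
        then have "eventually (\<lambda>K::nat. \<bar>\<rho> (real K) (D i0 \<omega>)\<bar> = 0) sequentially"
          by (intro eventually_sequentiallyI[of K0]) (auto simp: \<rho>_def \<tau>_def)
        then show "(\<lambda>K::nat. \<bar>\<rho> (real K) (D i0 \<omega>)\<bar>) \<longlonglongrightarrow> 0" by (rule tendsto_eventually)
      qed
    qed (use i0 int in \<open>auto simp: \<rho>_def \<tau>_def\<close>)
    then show ?thesis by simp
  qed
  show ?thesis
    unfolding \<mu>_def[symmetric]
  proof (rule tendsto_prob_filterI_L1)
    show "integrable M (\<lambda>\<omega>. \<Sum>i\<in>I t. c t i * \<phi> (D i \<omega>))" for t
      using I ints by (intro Bochner_Integration.integrable_sum integrable_mult_right) blast
    show "(\<lambda>t. expectation (\<lambda>\<omega>. \<bar>(\<Sum>i\<in>I t. c t i * \<phi> (D i \<omega>)) - \<mu>\<bar>)) \<longlonglongrightarrow> 0"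
    proof (rule LIMSEQ_I)
      fix e :: real assume e: "e > 0"
      \<comment> \<open>A quarter of e suffices for the tail, because centring it at most doubles
        its L1 norm.\<close>
      from LIMSEQ_D[OF lim\<rho>, of "e / 4"] e obtain K :: nat
        where K: "expectation (\<lambda>\<omega>. \<bar>\<rho> (real K) (D i0 \<omega>)\<bar>) < e / 4"
        by fastforce
      \<comment> \<open>Truncated part and tail are centred separately; since the weights sum to 1,
        their means add up to \<mu>.\<close>
      define U where "U i \<omega> = \<tau> (real K) (D i \<omega>) - expectation (\<lambda>\<omega>. \<tau> (real K) (D i0 \<omega>))" for i \<omega>
      define R where "R i \<omega> = \<rho> (real K) (D i \<omega>) - expectation (\<lambda>\<omega>. \<rho> (real K) (D i0 \<omega>))" for i \<omega>
      have \<mu>: "\<mu> = expectation (\<lambda>\<omega>. \<tau> (real K) (D i0 \<omega>)) + expectation (\<lambda>\<omega>. \<rho> (real K) (D i0 \<omega>))"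
        unfolding \<mu>_def \<rho>_def using \<tau>int[OF i0] int by (subst Bochner_Integration.integral_diff) auto
      have Uint: "integrable M (U i)" and Rint: "integrable M (R i)" if "i \<in> J" for i
        using that by (auto simp: U_def[abs_def] R_def[abs_def] \<tau>int \<rho>int)
      have ER: "expectation (\<lambda>\<omega>. \<bar>R i \<omega>\<bar>) \<le> e / 2" if i: "i \<in> J" for i
      proof -
        have "expectation (\<lambda>\<omega>. \<bar>R i \<omega>\<bar>) \<le> expectation (\<lambda>\<omega>. \<bar>\<rho> (real K) (D i \<omega>)\<bar> + \<bar>expectation (\<lambda>\<omega>. \<rho> (real K) (D i0 \<omega>))\<bar>)"
          using i by (intro integral_mono) (auto simp: R_def \<rho>int)
        also have "\<dots> = expectation (\<lambda>\<omega>. \<bar>\<rho> (real K) (D i0 \<omega>)\<bar>) + \<bar>expectation (\<lambda>\<omega>. \<rho> (real K) (D i0 \<omega>))\<bar>"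
          using i transfer(2)[OF i, of "\<lambda>x. \<bar>\<rho> (real K) x\<bar>"]
          by (subst Bochner_Integration.integral_add) (auto simp: \<rho>int prob_space)
        also have "\<dots> \<le> e / 2"
          using K integral_abs_bound[of M "\<lambda>\<omega>. \<rho> (real K) (D i0 \<omega>)"] by linarith
        finally show ?thesis .
      qed
      have main: "expectation (\<lambda>\<omega>. \<bar>(\<Sum>i\<in>I t. c t i * \<phi> (D i \<omega>)) - \<mu>\<bar>) \<le> 2 * real K * sqrt (1 / real t) + e / 2" if t: "t \<ge> 1" for t
      proof -
        have "(\<Sum>i\<in>I t. c t i * \<phi> (D i \<omega>)) - \<mu> = (\<Sum>i\<in>I t. c t i * U i \<omega>) + (\<Sum>i\<in>I t. c t i * R i \<omega>)" for \<omega>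
        proof -
          have "(\<Sum>i\<in>I t. c t i * U i \<omega>) + (\<Sum>i\<in>I t. c t i * R i \<omega>) = (\<Sum>i\<in>I t. c t i * \<phi> (D i \<omega>) - c t i * \<mu>)"
            by (simp add: sum.distrib[symmetric] U_def R_def \<mu> \<rho>_def algebra_simps)
          also have "\<dots> = (\<Sum>i\<in>I t. c t i * \<phi> (D i \<omega>)) - \<mu>"
            by (simp add: sum_subtractf sum_distrib_right[symmetric] c(3)[OF t])
          finally show ?thesis by simp
        qed
        then have "expectation (\<lambda>\<omega>. \<bar>(\<Sum>i\<in>I t. c t i * \<phi> (D i \<omega>)) - \<mu>\<bar>)
          \<le> expectation (\<lambda>\<omega>. \<bar>\<Sum>i\<in>I t. c t i * U i \<omega>\<bar> + (\<Sum>i\<in>I t. c t i * \<bar>R i \<omega>\<bar>))"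
        proof (simp only:, intro integral_mono)
          show "integrable M (\<lambda>\<omega>. \<bar>(\<Sum>i\<in>I t. c t i * U i \<omega>) + (\<Sum>i\<in>I t. c t i * R i \<omega>)\<bar>)"
            using I Uint Rint by (intro integrable_abs Bochner_Integration.integrable_add Bochner_Integration.integrable_sum integrable_mult_right) blast+
          show "integrable M (\<lambda>\<omega>. \<bar>\<Sum>i\<in>I t. c t i * U i \<omega>\<bar> + (\<Sum>i\<in>I t. c t i * \<bar>R i \<omega>\<bar>))"
            using I Uint Rint by (intro integrable_abs Bochner_Integration.integrable_add Bochner_Integration.integrable_sum integrable_mult_right) blast+
          show "\<bar>(\<Sum>i\<in>I t. c t i * U i \<omega>) + (\<Sum>i\<in>I t. c t i * R i \<omega>)\<bar> \<le> \<bar>\<Sum>i\<in>I t. c t i * U i \<omega>\<bar> + (\<Sum>i\<in>I t. c t i * \<bar>R i \<omega>\<bar>)" for \<omega>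
          proof -
            have "\<bar>\<Sum>i\<in>I t. c t i * R i \<omega>\<bar> \<le> (\<Sum>i\<in>I t. c t i * \<bar>R i \<omega>\<bar>)"
              by (rule order_trans[OF sum_abs]) (use c in \<open>auto simp: abs_mult intro!: sum_mono\<close>)
            then show ?thesis by linarith
          qed
        qed
        also have "\<dots> = expectation (\<lambda>\<omega>. \<bar>\<Sum>i\<in>I t. c t i * U i \<omega>\<bar>) + expectation (\<lambda>\<omega>. \<Sum>i\<in>I t. c t i * \<bar>R i \<omega>\<bar>)"
          using I Uint Rint by (intro Bochner_Integration.integral_add integrable_abs Bochner_Integration.integrable_sum integrable_mult_right) blast+
        also have "expectation (\<lambda>\<omega>. \<Sum>i\<in>I t. c t i * \<bar>R i \<omega>\<bar>) = (\<Sum>i\<in>I t. c t i * expectation (\<lambda>\<omega>. \<bar>R i \<omega>\<bar>))"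
          using I Rint by (subst Bochner_Integration.integral_sum) (auto intro!: integrable_mult_right integrable_abs)
        also have "\<dots> \<le> (\<Sum>i\<in>I t. c t i * (e / 2))"
          using I(2)[of t] c(1) by (intro sum_mono mult_left_mono ER) auto
        also have "\<dots> = e / 2" unfolding sum_distrib_right[symmetric] c(3)[OF t] by simp
        also have "expectation (\<lambda>\<omega>. \<bar>\<Sum>i\<in>I t. c t i * U i \<omega>\<bar>) \<le> sqrt ((2 * real K)\<^sup>2 * (\<Sum>i\<in>I t. (c t i)\<^sup>2))"
        proof (rule weighted_sum_square_bound)
          have "indep_vars (\<lambda>_. borel) (\<lambda>i \<omega>. (\<lambda>x. \<tau> (real K) x - expectation (\<lambda>\<omega>. \<tau> (real K) (D i0 \<omega>))) (D i \<omega>)) J"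
            by (rule indep_vars_compose2[OF indep]) measurable
          then show "indep_vars (\<lambda>_. borel) U (I t)"
            unfolding U_def[abs_def] using I by (auto intro: indep_vars_subset)
          show "expectation (U i) = 0" if "i \<in> I t" for i
          proof -
            have i: "i \<in> J" using that I by blast
            then show ?thesis
              unfolding U_def using transfer(2)[OF i, of "\<tau> (real K)"]
              by (subst Bochner_Integration.integral_diff) (auto simp: \<tau>int prob_space)
          qed
          \<comment> \<open>The truncated value and its mean each contribute at most K.\<close>
          show "\<bar>U i \<omega>\<bar> \<le> 2 * real K" for i \<omega>
          proof -
            have "\<bar>expectation (\<lambda>\<omega>. \<tau> (real K) (D i0 \<omega>))\<bar> \<le> expectation (\<lambda>\<omega>. \<bar>\<tau> (real K) (D i0 \<omega>)\<bar>)"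
              by (rule integral_abs_bound)
            also have "\<dots> \<le> expectation (\<lambda>\<omega>. real K)"
              using i0 by (intro integral_mono) (auto simp: \<tau>int \<tau>b)
            finally have "\<bar>expectation (\<lambda>\<omega>. \<tau> (real K) (D i0 \<omega>))\<bar> \<le> real K" by (simp add: prob_space)
            moreover have "\<bar>\<tau> (real K) (D i \<omega>)\<bar> \<le> real K" by (rule \<tau>b) simp
            ultimately show ?thesis unfolding U_def by linarith
          qed
        qed (use I in auto)
        also have "\<dots> \<le> sqrt ((2 * real K)\<^sup>2 * (1 / real t))"
        proof (intro real_sqrt_le_mono mult_left_mono)
          \<comment> \<open>No weight exceeds 1 / t, so c^2 \<le> c / t; summing against total mass
            1 leaves 1 / t. This is the variance decay.\<close>
          have "(\<Sum>i\<in>I t. (c t i)\<^sup>2) \<le> (\<Sum>i\<in>I t. 1 / real t * c t i)"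
            unfolding power2_eq_square using c(1,2) t by (intro sum_mono mult_right_mono) auto
          then show "(\<Sum>i\<in>I t. (c t i)\<^sup>2) \<le> 1 / real t"
            unfolding sum_distrib_left[symmetric] c(3)[OF t] by simp
        qed auto
        also have "\<dots> = 2 * real K * sqrt (1 / real t)"
          by (simp only: real_sqrt_mult real_sqrt_abs abs_mult abs_numeral abs_of_nat)
        finally show ?thesis by simp
      qed
      have "(\<lambda>t. 2 * real K * sqrt (1 / real t)) \<longlonglongrightarrow> 2 * real K * sqrt 0"
        by (intro tendsto_intros lim_1_over_n)
      then have "(\<lambda>t. 2 * real K * sqrt (1 / real t)) \<longlonglongrightarrow> 0" by simp
      then obtain t0 where t0: "\<And>t. t \<ge> t0 \<Longrightarrow> \<bar>2 * real K * sqrt (1 / real t)\<bar> < e / 2"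
        using LIMSEQ_D[of "\<lambda>t. 2 * real K * sqrt (1 / real t)" 0 "e / 2"] e by auto
      show "\<exists>no. \<forall>n\<ge>no. norm (expectation (\<lambda>\<omega>. \<bar>(\<Sum>i\<in>I n. c n i * \<phi> (D i \<omega>)) - \<mu>\<bar>) - 0) < e"
      proof (intro exI[of _ "max 1 t0"] allI impI)
        fix n assume n: "max 1 t0 \<le> n"
        have "0 \<le> expectation (\<lambda>\<omega>. \<bar>(\<Sum>i\<in>I n. c n i * \<phi> (D i \<omega>)) - \<mu>\<bar>)"
          by (rule Bochner_Integration.integral_nonneg) simp
        then show "norm (expectation (\<lambda>\<omega>. \<bar>(\<Sum>i\<in>I n. c n i * \<phi> (D i \<omega>)) - \<mu>\<bar>) - 0) < e"
          using main[of n] t0[of n] n by simp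
      qed
    qed
  qed
qed

end

section \<open>Concave maximizers and the logistic function\<close>

text \<open>The segment from \<open>a\<close> to \<open>x\<close> meets the sphere of radius
  \<delta> in \<open>y\<close>, and the slopes of a concave function decrease along it. A drop on
  the sphere thus grows at least linearly outside, which serves both to locate maximizers and to
  bound posterior tails.\<close>

lemma concave_on_radial:
  fixes f :: "'a::real_normed_vector \<Rightarrow> real"
  assumes f: "concave_on UNIV f" and \<delta>: "0 < \<delta>" "\<delta> \<le> norm (x - a)"
  obtains y where "norm (y - a) = \<delta>" "f x - f a \<le> norm (x - a) / \<delta> * (f y - f a)"
proof
  define u where "u = \<delta> / norm (x - a)"
  have u: "0 < u" "u \<le> 1" and nz: "norm (x - a) > 0" using \<delta> by (auto simp: u_def divide_simps)
  define y where "y = (1 - u) *\<^sub>R a + u *\<^sub>R x"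
  have "y - a = u *\<^sub>R (x - a)" by (simp add: y_def algebra_simps)
  then show "norm (y - a) = \<delta>" using u nz \<delta> by (simp add: u_def)
  have "(1 - u) * f a + u * f x \<le> f y"
    using f u unfolding concave_on_iff y_def by auto
  then have "u * (f x - f a) \<le> f y - f a" by (simp add: algebra_simps)
  then have "f x - f a \<le> (f y - f a) / u" using u by (simp add: field_simps)
  then show "f x - f a \<le> norm (x - a) / \<delta> * (f y - f a)" by (simp add: u_def field_simps)
qed

text \<open>A strict drop on the sphere persists outside it, so a maximizer over the compact ball is
  global and every maximizer lies inside.\<close>

lemma concave_arg_max_near:
  fixes f :: "'a::euclidean_space \<Rightarrow> real"
  assumes conc: "concave_on UNIV f" and cont: "continuous_on UNIV f" and "e > 0"
    and sphere: "\<And>x. norm (x - a) = e \<Longrightarrow> f x < f a"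
  shows "\<exists>x. is_arg_max f (\<lambda>_. True) x" and "is_arg_max f (\<lambda>_. True) x \<Longrightarrow> dist x a < e"
proof -
  have out: "f x < f a" if le: "e \<le> norm (x - a)" for x
  proof -
    obtain y where y: "norm (y - a) = e" "f x - f a \<le> norm (x - a) / e * (f y - f a)"
      using concave_on_radial[OF conc \<open>e > 0\<close> le] .
    have "norm (x - a) / e * (f y - f a) < 0"
      using sphere[OF y(1)] \<open>e > 0\<close> le by (intro mult_pos_neg divide_pos_pos) auto
    then show ?thesis using y(2) by linarith
  qed
  obtain m where m: "m \<in> cball a e" "\<And>y. y \<in> cball a e \<Longrightarrow> f y \<le> f m"
    using continuous_attains_sup[of "cball a e" f] cont \<open>e > 0\<close>
    by (metis centre_in_cball compact_cball continuous_on_subset empty_iff less_imp_le subset_UNIV)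
  have "f y \<le> f m" for y
  proof (cases "y \<in> cball a e")
    case False
    then have "f y < f a" by (intro out) (auto simp: dist_norm norm_minus_commute)
    also have "f a \<le> f m" using m(2)[of a] \<open>e > 0\<close> by simp
    finally show ?thesis by simp
  qed (use m in auto)
  then show "\<exists>x. is_arg_max f (\<lambda>_. True) x"
    unfolding is_arg_max_def by (metis not_less)
  show "dist x a < e" if "is_arg_max f (\<lambda>_. True) x"
    using that out[of x] unfolding is_arg_max_def dist_norm by (metis not_less)
qed

text \<open>Pointwise convergence suffices: the Lipschitz bound makes it uniform on spheres, and concavity does the rest.\<close>

lemma eventually_concave_arg_max_near:
  fixes f :: "'b \<Rightarrow> 'a::euclidean_space \<Rightarrow> real"
  assumes conc: "\<And>z. concave_on UNIV (f z)"
    and lip: "\<And>z x y. \<bar>f z x - f z y\<bar> \<le> K z * norm (x - y)" and K: "(K \<longlongrightarrow> k) F"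
    and lim: "\<And>x. ((\<lambda>z. f z x) \<longlongrightarrow> L x) F" and max: "\<And>x. x \<noteq> a \<Longrightarrow> L x < L a" and e: "e > 0"
  shows "\<forall>\<^sub>F z in F. (\<exists>x. is_arg_max (f z) (\<lambda>_. True) x) \<and> (\<forall>x. is_arg_max (f z) (\<lambda>_. True) x \<longrightarrow> dist x a < e)"
proof -
  \<comment> \<open>The limit \<open>k\<close> carries no sign condition; \<open>k'\<close> is
    positive and strictly above it, hence eventually bounds the Lipschitz constants.\<close>
  define k' where "k' = \<bar>k\<bar> + 1"
  have k': "k' > 0" "k < k'" by (auto simp: k'_def)
  define g where "g s = L a - L s" for s
  have g: "g s > 0" if "s \<in> sphere a e" for s
    using max[of s] that e by (auto simp: g_def)
  \<comment> \<open>On a ball of this radius a k'-Lipschitz function varies by at most a quarter of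
    the gap \<open>g s\<close>.\<close>
  have "\<exists>C\<subseteq>sphere a e. finite C \<and> sphere a e \<subseteq> (\<Union>s\<in>C. ball s (g s / (4 * k')))"
  proof (rule compactE_image[of "sphere a e" "sphere a e" "\<lambda>s. ball s (g s / (4 * k'))"])
    show "sphere a e \<subseteq> (\<Union>s\<in>sphere a e. ball s (g s / (4 * k')))"
      using g k' by (auto intro!: bexI)
  qed auto
  then obtain C where C: "C \<subseteq> sphere a e" "finite C" "sphere a e \<subseteq> (\<Union>s\<in>C. ball s (g s / (4 * k')))"
    by blast
  \<comment> \<open>Of the gap \<open>g s\<close>, one quarter is lost in the limit at
    \<open>s\<close>, one in moving from \<open>s\<close> to a nearby point and one in the limit at
    \<open>a\<close>; the last quarter keeps the inequality strict.\<close>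
  have "\<forall>\<^sub>F z in F. \<forall>s\<in>C. f z s < L s + g s / 4 \<and> L a - g s / 4 < f z a"
    using C g by (intro eventually_ball_finite ballI eventually_conj order_tendstoD[OF lim]) auto
  moreover have "\<forall>\<^sub>F z in F. K z < k'"
    using order_tendstoD(2)[OF K k'(2)] .
  ultimately show ?thesis
  proof eventually_elim
    case (elim z)
    have sph: "f z x < f z a" if "norm (x - a) = e" for x
    proof -
      have "x \<in> sphere a e" using that by (simp add: dist_norm norm_minus_commute)
      then obtain s where s: "s \<in> C" "norm (x - s) < g s / (4 * k')"
        using C(3) by (auto simp: dist_norm norm_minus_commute)
      have gs: "g s > 0" using g C(1) s(1) by blast
      have "f z x \<le> f z s + K z * norm (x - s)" using lip[of z x s] by linarith
      also have "K z * norm (x - s) \<le> k' * (g s / (4 * k'))"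
        using elim(2) s(2) k' by (intro mult_mono) auto
      also have "\<dots> = g s / 4" using k' by simp
      finally have "f z x < L s + g s / 2" using elim(1) s(1) by (auto simp: field_simps)
      also have "\<dots> < L a - g s / 4" using gs unfolding g_def by argo
      also have "\<dots> < f z a" using elim(1) s(1) by auto
      finally show ?thesis .
    qed
    have "continuous_on UNIV (f z)"
    proof (rule lipschitz_on_continuous_on)
      show "(\<bar>K z\<bar>)-lipschitz_on UNIV (f z)"
      proof (rule lipschitz_onI)
        fix x y :: 'a
        have "K z * norm (x - y) \<le> \<bar>K z\<bar> * norm (x - y)" by (intro mult_right_mono) auto
        then show "dist (f z x) (f z y) \<le> \<bar>K z\<bar> * dist x y"
          using lip[of z x y] by (simp add: dist_real_def dist_norm)
      qed simp
    qed
    from concave_arg_max_near[OF conc this e sph] show ?case by blast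
  qed
qed

section \<open>Derivatives and Taylor bounds of the log-partition function\<close>

definition sigmoid :: "real \<Rightarrow> real" where
  "sigmoid x = exp x / (1 + exp x)"

text \<open>The variance p (1 - p) of a Bernoulli variable with success probability p =
  \<open>sigmoid x\<close>; equivalently the second derivative of
  \<open>log_partition\<close>.\<close>

definition logistic_weight :: "real \<Rightarrow> real" where
  "logistic_weight x = exp x / (1 + exp x)\<^sup>2"

lemma sigmoid_bounds: "0 < sigmoid x" "sigmoid x < 1"
  by (auto simp: sigmoid_def add_pos_pos field_simps)

lemma logistic_weight_eq: "logistic_weight x = sigmoid x * (1 - sigmoid x)"
proof -
  have "1 + exp x > 0" by (simp add: add_pos_pos)
  then show ?thesis by (simp add: logistic_weight_def sigmoid_def power2_eq_square field_simps)
qed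

lemma logistic_weight_pos: "0 < logistic_weight x"
  and logistic_weight_le_1: "logistic_weight x \<le> 1"
  using sigmoid_bounds[of x] mult_mono[of "sigmoid x" 1 "1 - sigmoid x" 1] by (auto simp: logistic_weight_eq)

lemma DERIV_log_partition: "(log_partition has_real_derivative sigmoid x) (at x)"
  unfolding log_partition_def[abs_def] sigmoid_def
  by (auto intro!: derivative_eq_intros simp: add_pos_pos field_simps)

lemma DERIV_sigmoid: "(sigmoid has_real_derivative logistic_weight x) (at x)"
proof -
  have "1 + exp x \<noteq> 0" using exp_gt_zero[of x] by linarith
  then show ?thesis
    unfolding sigmoid_def[abs_def] logistic_weight_def
    by (auto intro!: derivative_eq_intros simp: power2_eq_square field_simps)
qed

lemma DERIV_logistic_weight:
  "(logistic_weight has_real_derivative logistic_weight x * (1 - 2 * sigmoid x)) (at x)"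
proof -
  have "((\<lambda>x. sigmoid x * (1 - sigmoid x)) has_real_derivative logistic_weight x * (1 - 2 * sigmoid x)) (at x)"
    by (rule DERIV_cong[OF DERIV_mult[OF DERIV_sigmoid DERIV_diff[OF DERIV_const DERIV_sigmoid]]])
      (simp add: algebra_simps)
  then show ?thesis by (simp add: logistic_weight_eq[abs_def])
qed

text \<open>A crude constant: the third derivative of \<open>log_partition\<close> only has to be
  bounded.\<close>

lemma logistic_weight_deriv_bound: "\<bar>logistic_weight x * (1 - 2 * sigmoid x)\<bar> \<le> 1"
proof -
  have "\<bar>1 - 2 * sigmoid x\<bar> \<le> 1" using sigmoid_bounds[of x] by linarith
  then show ?thesis
    using logistic_weight_pos[of x] logistic_weight_le_1[of x] by (auto simp: abs_mult intro!: mult_le_one)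
qed

lemma continuous_on_log_partition: "continuous_on A log_partition"
  and continuous_on_sigmoid: "continuous_on A sigmoid"
  and continuous_on_logistic_weight: "continuous_on A logistic_weight"
  by (meson DERIV_log_partition DERIV_sigmoid DERIV_logistic_weight DERIV_isCont continuous_at_imp_continuous_on)+

lemma borel_measurable_logistic [measurable]:
  "log_partition \<in> borel_measurable borel" "sigmoid \<in> borel_measurable borel"
  "logistic_weight \<in> borel_measurable borel"
  by (intro borel_measurable_continuous_onI continuous_on_log_partition continuous_on_sigmoid continuous_on_logistic_weight)+

text \<open>This is what permits replacing the Hessian at the maximizer by the one at the true
  parameter.\<close>

lemma logistic_weight_lipschitz: "\<bar>logistic_weight b - logistic_weight a\<bar> \<le> \<bar>b - a\<bar>"
proof -
  have "norm (logistic_weight b - logistic_weight a) \<le> 1 * norm (b - a)"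
    by (rule field_differentiable_bound[OF convex_UNIV])
       (use DERIV_logistic_weight logistic_weight_deriv_bound in auto)
  then show ?thesis by simp
qed

lemma log_partition_lipschitz: "\<bar>log_partition b - log_partition a\<bar> \<le> \<bar>b - a\<bar>"
proof -
  have "norm (log_partition b - log_partition a) \<le> 1 * norm (b - a)"
    by (rule field_differentiable_bound[OF convex_UNIV])
       (use DERIV_log_partition sigmoid_bounds in \<open>auto simp: less_imp_le abs_of_pos\<close>)
  then show ?thesis by simp
qed

lemma convex_on_log_partition: "convex_on UNIV log_partition"
  by (rule f''_ge0_imp_convex[OF _ DERIV_log_partition DERIV_sigmoid])
     (auto intro: less_imp_le logistic_weight_pos)

text \<open>The second-order Taylor term is strictly positive. The strictness is the source of the
  uniqueness of the maximizer of the expected log-likelihood.\<close>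

lemma log_partition_gt_tangent:
  assumes "a \<noteq> b"
  shows "log_partition a + sigmoid a * (b - a) < log_partition b"
proof -
  define diff where "diff m = (if m = 0 then log_partition else if m = 1 then sigmoid else logistic_weight)" for m :: nat
  have "\<exists>t. (if b < a then b < t \<and> t < a else a < t \<and> t < b) \<and>
    log_partition b = (\<Sum>m<2. (diff m a / fact m) * (b - a)^m) + (diff 2 t / fact 2) * (b - a)^2"
    by (rule Taylor[where a="min a b" and b="max a b"])
       (use assms in \<open>auto simp: diff_def less_Suc_eq numeral_2_eq_2 DERIV_log_partition DERIV_sigmoid\<close>)
  then obtain t where "log_partition b = log_partition a + sigmoid a * (b - a) + logistic_weight t / 2 * (b - a)^2"
    by (auto simp: diff_def numeral_2_eq_2)
  moreover have "0 < logistic_weight t / 2 * (b - a)^2"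
    using logistic_weight_pos[of t] assms by simp
  ultimately show ?thesis by linarith
qed

text \<open>Lagrange remainder with the third derivative bounded by 1; the factor 1/6 is given
  away.\<close>

lemma log_partition_taylor:
  "\<bar>log_partition b - log_partition a - sigmoid a * (b - a) - logistic_weight a / 2 * (b - a)\<^sup>2\<bar> \<le> \<bar>b - a\<bar> ^ 3"
proof (cases "a = b")
  case False
  define w' where "w' x = logistic_weight x * (1 - 2 * sigmoid x)" for x
  define diff where "diff m = (if m = 0 then log_partition else if m = 1 then sigmoid
    else if m = 2 then logistic_weight else w')" for m :: nat
  have "\<exists>t. (if b < a then b < t \<and> t < a else a < t \<and> t < b) \<and>
    log_partition b = (\<Sum>m<3. (diff m a / fact m) * (b - a)^m) + (diff 3 t / fact 3) * (b - a)^3"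
    by (rule Taylor[where a="min a b" and b="max a b"])
       (use False in \<open>auto simp: diff_def less_Suc_eq eval_nat_numeral DERIV_log_partition DERIV_sigmoid
          DERIV_logistic_weight w'_def[abs_def]\<close>)
  then obtain t where "log_partition b = log_partition a + sigmoid a * (b - a)
     + logistic_weight a / 2 * (b - a)^2 + w' t / 6 * (b - a)^3"
    by (auto simp: diff_def eval_nat_numeral)
  then have "\<bar>log_partition b - log_partition a - sigmoid a * (b - a) - logistic_weight a / 2 * (b - a)\<^sup>2\<bar>
     = \<bar>w' t / 6\<bar> * \<bar>b - a\<bar>^3"
    by (simp add: abs_mult power_abs)
  also have "\<dots> \<le> 1 * \<bar>b - a\<bar>^3"
    using logistic_weight_deriv_bound[of t] by (intro mult_right_mono) (auto simp: w'_def)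
  finally show ?thesis by simp
qed simp

text \<open>\<open>log_partition\<close> is nonnegative and lies above the identity, so one of the
  two terms already dominates the modulus.\<close>

lemma abs_le_log_partition: "\<bar>x\<bar> \<le> log_partition x + log_partition (- x)"
proof -
  have ge: "0 \<le> log_partition y" "y \<le> log_partition y" for y
  proof -
    show "0 \<le> log_partition y" by (simp add: log_partition_def)
    have "y = ln (exp y)" by simp
    also have "\<dots> \<le> log_partition y" unfolding log_partition_def by (subst ln_le_cancel_iff) (auto simp: add_pos_pos)
    finally show "y \<le> log_partition y" .
  qed
  show ?thesis using ge[of x] ge[of "- x"] by (cases "0 \<le> x") linarith+
qed

section \<open>The Laplace approximation\<close>

lemma
  fixes f :: "'a::euclidean_space \<Rightarrow> real"
  assumes [measurable]: "f \<in> borel_measurable borel" and c: "c \<noteq> 0"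
  shows integrable_lborel_affine: "integrable lborel (\<lambda>x. f (t + c *\<^sub>R x)) \<longleftrightarrow> integrable lborel f"
    and integral_lborel_affine: "(\<integral>x. f x \<partial>lborel) = \<bar>c\<bar> ^ DIM('a) * (\<integral>x. f (t + c *\<^sub>R x) \<partial>lborel)"
proof -
  have "integrable lborel f \<longleftrightarrow> integrable (density (distr lborel borel (\<lambda>x. t + c *\<^sub>R x)) (\<lambda>_. ennreal (\<bar>c\<bar> ^ DIM('a)))) f"
    by (subst lborel_affine[OF c, of t]) (simp add: ennreal_power)
  also have "\<dots> \<longleftrightarrow> integrable lborel (\<lambda>x. f (t + c *\<^sub>R x))"
    using c by (subst integrable_density) (auto simp: integrable_distr_eq)
  finally show "integrable lborel (\<lambda>x. f (t + c *\<^sub>R x)) \<longleftrightarrow> integrable lborel f" by simp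
  have "(\<integral>x. f x \<partial>lborel) = (\<integral>x. f x \<partial>density (distr lborel borel (\<lambda>x. t + c *\<^sub>R x)) (\<lambda>_. ennreal (\<bar>c\<bar> ^ DIM('a))))"
    by (subst lborel_affine[OF c, of t]) (simp add: ennreal_power)
  also have "\<dots> = \<bar>c\<bar> ^ DIM('a) * (\<integral>x. f (t + c *\<^sub>R x) \<partial>lborel)"
    by (subst integral_density) (auto simp: integral_distr)
  finally show "(\<integral>x. f x \<partial>lborel) = \<bar>c\<bar> ^ DIM('a) * (\<integral>x. f (t + c *\<^sub>R x) \<partial>lborel)" .
qed

text \<open>The difference of the total masses is itself at most the L1 distance, hence the factor
  2. Only the mass of \<open>h\<close> enters the bound, so \<open>h\<close> is to be the fixed
  limit.\<close>

lemma L1_distance_normalized: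
  fixes g h :: "'a \<Rightarrow> real"
  assumes int: "integrable M g" "integrable M h" and nn: "\<And>x. 0 \<le> g x"
    and pos: "0 < (\<integral>x. g x \<partial>M)" "0 < (\<integral>x. h x \<partial>M)"
  shows "(\<integral>x. \<bar>g x / (\<integral>y. g y \<partial>M) - h x / (\<integral>y. h y \<partial>M)\<bar> \<partial>M) \<le> 2 / (\<integral>x. h x \<partial>M) * (\<integral>x. \<bar>g x - h x\<bar> \<partial>M)"
proof -
  define G where "G = (\<integral>x. g x \<partial>M)"
  define H where "H = (\<integral>x. h x \<partial>M)"
  have GH: "0 < G" "0 < H" using pos by (auto simp: G_def H_def)
  have "\<bar>g x / G - h x / H\<bar> \<le> \<bar>g x - h x\<bar> / H + g x * (\<bar>G - H\<bar> / (G * H))" for x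
  proof -
    \<comment> \<open>The comparison goes through g / H: first the functions change, then the
      normalizations.\<close>
    have "g x / G - h x / H = (g x - h x) / H - g x * ((G - H) / (G * H))"
      using GH by (simp add: field_simps)
    also have "\<bar>\<dots>\<bar> \<le> \<bar>(g x - h x) / H\<bar> + \<bar>g x * ((G - H) / (G * H))\<bar>" by (rule abs_triangle_ineq4)
    also have "\<dots> = \<bar>g x - h x\<bar> / H + g x * (\<bar>G - H\<bar> / (G * H))"
      using GH nn[of x] by (simp add: abs_mult)
    finally show ?thesis .
  qed
  then have "(\<integral>x. \<bar>g x / G - h x / H\<bar> \<partial>M) \<le> (\<integral>x. \<bar>g x - h x\<bar> / H + g x * (\<bar>G - H\<bar> / (G * H)) \<partial>M)"
    using int by (intro integral_mono) auto
  also have "\<dots> = (\<integral>x. \<bar>g x - h x\<bar> \<partial>M) / H + G * (\<bar>G - H\<bar> / (G * H))"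
    using int by (simp add: G_def)
  also have "G * (\<bar>G - H\<bar> / (G * H)) = \<bar>G - H\<bar> / H" using GH by simp
  also have "\<bar>G - H\<bar> \<le> (\<integral>x. \<bar>g x - h x\<bar> \<partial>M)"
    using int integral_abs_bound[of M "\<lambda>x. g x - h x"] by (simp add: G_def H_def)
  finally show ?thesis
    using GH unfolding G_def[symmetric] H_def[symmetric] by (simp add: field_simps divide_right_mono)
qed

text \<open>The sum of the absolute entries serves as matrix norm because entrywise convergence
  makes it small at once.\<close>

lemma abs_quadratic_form_le:
  fixes A :: "real ^ 'n ^ 'n"
  shows "\<bar>x \<bullet> (A *v x)\<bar> \<le> (\<Sum>a\<in>UNIV. \<Sum>b\<in>UNIV. \<bar>A $ a $ b\<bar>) * (norm x)\<^sup>2"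
proof -
  have "x \<bullet> (A *v x) = (\<Sum>a\<in>UNIV. \<Sum>b\<in>UNIV. A $ a $ b * (x $ a * x $ b))"
    by (simp add: inner_vec_def matrix_vector_mult_def sum_distrib_left mult_ac)
  also have "\<bar>\<dots>\<bar> \<le> (\<Sum>a\<in>UNIV. \<Sum>b\<in>UNIV. \<bar>A $ a $ b * (x $ a * x $ b)\<bar>)"
    by (rule order_trans[OF sum_abs sum_mono[OF sum_abs]])
  also have "\<dots> \<le> (\<Sum>a\<in>UNIV. \<Sum>b\<in>UNIV. \<bar>A $ a $ b\<bar> * (norm x)\<^sup>2)"
    unfolding abs_mult power2_eq_square by (intro sum_mono mult_left_mono mult_mono component_le_norm_cart) auto
  finally show ?thesis by (simp add: sum_distrib_right)
qed

text \<open>The form attains a positive minimum on the compact unit sphere, and homogeneity extends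
  the bound.\<close>

lemma pos_def_imp_coercive:
  fixes V :: "real ^ 'n ^ 'n"
  assumes pd: "\<And>x. x \<noteq> 0 \<Longrightarrow> 0 < x \<bullet> (V *v x)"
  obtains \<kappa> where "\<kappa> > 0" "\<And>x. \<kappa> * (norm x)\<^sup>2 \<le> x \<bullet> (V *v x)"
proof -
  have "continuous_on (sphere (0::real^'n) 1) (\<lambda>x. x \<bullet> (V *v x))"
    by (intro continuous_intros linear_continuous_on)
       (simp add: linear_conv_bounded_linear[symmetric] matrix_vector_mul_linear)
  moreover have "sphere (0::real^'n) 1 \<noteq> {}" by simp
  ultimately obtain m where m: "m \<in> sphere 0 1" "\<And>x. x \<in> sphere 0 1 \<Longrightarrow> m \<bullet> (V *v m) \<le> x \<bullet> (V *v x)"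
    using continuous_attains_inf[of "sphere (0::real^'n) 1" "\<lambda>x. x \<bullet> (V *v x)"] by auto
  show ?thesis
  proof
    show "0 < m \<bullet> (V *v m)" using m(1) by (intro pd) auto
    fix x :: "real^'n"
    show "m \<bullet> (V *v m) * (norm x)\<^sup>2 \<le> x \<bullet> (V *v x)"
    proof (cases "x = 0")
      case False
      have "m \<bullet> (V *v m) \<le> (x /\<^sub>R norm x) \<bullet> (V *v (x /\<^sub>R norm x))"
        using False by (intro m(2)) auto
      also have "\<dots> = (x \<bullet> (V *v x)) / (norm x)\<^sup>2"
        by (simp add: matrix_vector_mult_scaleR power2_eq_square field_simps)
      finally show ?thesis using False by (simp add: field_simps)
    qed simp
  qed
qed

lemma integrable_exp_neg_norm_square:
  assumes "c > 0"
  shows "integrable lborel (\<lambda>x::real^'n. exp (- c * (norm x)\<^sup>2))"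
proof -
  \<comment> \<open>The matrix 2c times the identity compensates the factor 1/2 in the Gaussian
    exponent.\<close>
  have eq: "x \<bullet> (mat (2 * c) *v x) = 2 * c * (norm x)\<^sup>2" for x :: "real^'n"
  proof -
    have "(mat (2 * c) :: real^'n^'n) = (2 * c) *\<^sub>R mat 1"
      by (simp add: mat_def vec_eq_iff)
    then show ?thesis by (simp add: scaleR_matrix_vector_assoc[symmetric] power2_norm_eq_inner)
  qed
  have "has_bochner_integral lborel (\<lambda>x::real^'n. exp (- (x \<bullet> (mat (2 * c) *v x)) / 2))
    (sqrt ((2 * pi) ^ CARD('n) / det (mat (2 * c) :: real^'n^'n)))"
    using assms by (intro has_bochner_integral_gaussian) (simp add: transpose_mat, simp add: eq)
  then show ?thesis by (auto simp: eq has_bochner_integral_iff)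
qed

section \<open>Gaussian densities and their dependence on the precision matrix\<close>

lemma matrix_inv_mult:
  assumes "invertible A"
  shows "A ** matrix_inv A = mat 1" "matrix_inv A ** A = mat 1"
  using someI_ex[OF assms[unfolded invertible_def]] by (auto simp: matrix_inv_def)

text \<open>Written as a function divided by its integral, the density has the form that
  \<open>L1_distance_normalized\<close> compares.\<close>

lemma mvn_density_matrix_inv:
  fixes V :: "real ^ 'n ^ 'n"
  assumes sym: "transpose V = V" and pd: "\<And>x. x \<noteq> 0 \<Longrightarrow> 0 < x \<bullet> (V *v x)"
  shows "mvn_density (matrix_inv V) x = exp (- (x \<bullet> (V *v x)) / 2) / (\<integral>y. exp (- (y \<bullet> (V *v y)) / 2) \<partial>lborel)"
proof -
  have d: "0 < det V" using det_pos_def[OF assms] .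
  then have inv: "invertible V" by (simp add: invertible_det_nz)
  then have V: "V ** matrix_inv V = mat 1" "matrix_inv V ** V = mat 1"
    using matrix_inv_mult by blast+
  have "invertible (matrix_inv V)" using V unfolding invertible_def by blast
  then have "matrix_inv (matrix_inv V) = V"
    using V matrix_inv_mult(1) by (metis matrix_mul_assoc matrix_mul_lid matrix_mul_rid)
  moreover have "det (matrix_inv V) = 1 / det V"
    using arg_cong[OF V(1), of det] d by (simp add: det_mul field_simps)
  moreover have "(\<integral>y. exp (- (y \<bullet> (V *v y)) / 2) \<partial>lborel) = sqrt ((2 * pi) ^ CARD('n) / det V)"
    using has_bochner_integral_gaussian[OF assms] by (simp add: has_bochner_integral_iff)
  ultimately show ?thesis by (simp add: mvn_density_def)
qed

text \<open>Coercivity of the limit passes to nearby matrices with half the constant, which gives a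
  common Gaussian dominator. Integrability along the sequence is only eventual, since early matrices
  may be singular.\<close>

lemma tendsto_L1_mvn_density:
  fixes V :: "nat \<Rightarrow> real ^ 'n ^ 'n"
  assumes V: "V \<longlonglongrightarrow> V0" and sym: "\<And>n. transpose (V n) = V n" "transpose V0 = V0"
    and pd: "\<And>x. x \<noteq> 0 \<Longrightarrow> 0 < x \<bullet> (V0 *v x)"
  shows "(\<lambda>n. \<integral>x. \<bar>mvn_density (matrix_inv (V n)) x - mvn_density (matrix_inv V0) x\<bar> \<partial>lborel) \<longlonglongrightarrow> 0"
    and "\<forall>\<^sub>F n in sequentially. integrable lborel (mvn_density (matrix_inv (V n)))"
    and "integrable lborel (mvn_density (matrix_inv V0))"
proof -
  obtain \<kappa> where \<kappa>: "\<kappa> > 0" "\<And>x. \<kappa> * (norm x)\<^sup>2 \<le> x \<bullet> (V0 *v x)"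
    using pos_def_imp_coercive[OF pd] by blast
  define \<gamma> where "\<gamma> A x = exp (- (x \<bullet> (A *v x)) / 2)" for A :: "real^'n^'n" and x
  have \<gamma>meas[measurable]: "\<gamma> A \<in> borel_measurable borel" for A unfolding \<gamma>_def by measurable
  have \<gamma>nn: "0 \<le> \<gamma> A x" for A x by (simp add: \<gamma>_def)
  have "(\<lambda>n. \<Sum>a\<in>UNIV. \<Sum>b\<in>UNIV. \<bar>(V n - V0) $ a $ b\<bar>) \<longlonglongrightarrow> (\<Sum>a\<in>UNIV. \<Sum>b\<in>UNIV. \<bar>(V0 - V0) $ a $ b\<bar>)"
    by (intro tendsto_intros V)
  then have "(\<lambda>n. \<Sum>a\<in>UNIV. \<Sum>b\<in>UNIV. \<bar>(V n - V0) $ a $ b\<bar>) \<longlonglongrightarrow> 0" by simp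
  then have "\<forall>\<^sub>F n in sequentially. (\<Sum>a\<in>UNIV. \<Sum>b\<in>UNIV. \<bar>(V n - V0) $ a $ b\<bar>) < \<kappa> / 2"
    by (rule order_tendstoD(2)) (use \<kappa> in auto)
  then have ev: "\<forall>\<^sub>F n in sequentially. \<forall>x. \<kappa> / 2 * (norm x)\<^sup>2 \<le> x \<bullet> (V n *v x)"
  proof eventually_elim
    case (elim n)
    show ?case
    proof
      fix x
      have "\<bar>x \<bullet> ((V n - V0) *v x)\<bar> \<le> \<kappa> / 2 * (norm x)\<^sup>2"
        by (rule order_trans[OF abs_quadratic_form_le]) (use elim in \<open>intro mult_right_mono, auto\<close>)
      then have "\<bar>x \<bullet> (V n *v x) - x \<bullet> (V0 *v x)\<bar> \<le> \<kappa> / 2 * (norm x)\<^sup>2"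
        by (simp add: matrix_vector_mult_diff_rdistrib inner_diff_right)
      then show "\<kappa> / 2 * (norm x)\<^sup>2 \<le> x \<bullet> (V n *v x)" using \<kappa>(2)[of x] by argo
    qed
  qed
  have pdn: "0 < x \<bullet> (V n *v x)" if "\<forall>x. \<kappa> / 2 * (norm x)\<^sup>2 \<le> x \<bullet> (V n *v x)" "x \<noteq> 0" for n x
  proof -
    have "0 < \<kappa> / 2 * (norm x)\<^sup>2" using \<kappa> that(2) by simp
    then show ?thesis using that(1) by (metis less_le_trans)
  qed
  have gauss: "integrable lborel (\<gamma> A)" "0 < (\<integral>x. \<gamma> A x \<partial>lborel)"
    "mvn_density (matrix_inv A) x = \<gamma> A x / (\<integral>y. \<gamma> A y \<partial>lborel)"
    if "transpose A = A" "\<And>x. x \<noteq> 0 \<Longrightarrow> 0 < x \<bullet> (A *v x)" for A and x :: "real^'n"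
    using has_bochner_integral_gaussian[OF that] det_pos_def[OF that] mvn_density_matrix_inv[OF that]
    unfolding \<gamma>_def[abs_def] by (auto simp: has_bochner_integral_iff)
  have lim\<gamma>: "(\<lambda>n. \<integral>x. \<bar>\<gamma> (V n) x - \<gamma> V0 x\<bar> \<partial>lborel) \<longlonglongrightarrow> 0"
  proof -
    from ev obtain N where N: "\<And>n x. n \<ge> N \<Longrightarrow> \<kappa> / 2 * (norm x)\<^sup>2 \<le> x \<bullet> (V n *v x)"
      unfolding eventually_sequentially by blast
    \<comment> \<open>The index is shifted because the domination starts at \<open>N\<close>. The
      exponent \<kappa> / 4 is half of the coercivity constant \<kappa> / 2, and the factor 2
      accounts for the two Gaussians.\<close>
    have "(\<lambda>n. \<integral>x. \<bar>\<gamma> (V (n + N)) x - \<gamma> V0 x\<bar> \<partial>lborel) \<longlonglongrightarrow> (\<integral>x. 0 \<partial>(lborel :: (real^'n) measure))"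
    proof (rule integral_dominated_convergence[where w="\<lambda>x. 2 * exp (- (\<kappa> / 4) * (norm x)\<^sup>2)"])
      show "integrable lborel (\<lambda>x::real^'n. 2 * exp (- (\<kappa> / 4) * (norm x)\<^sup>2))"
        using \<kappa>(1) by (intro integrable_mult_right integrable_exp_neg_norm_square) simp
      show "AE x in lborel. (\<lambda>n. \<bar>\<gamma> (V (n + N)) x - \<gamma> V0 x\<bar>) \<longlonglongrightarrow> 0"
      proof (rule AE_I2)
        fix x :: "real^'n"
        have "(\<lambda>n. \<gamma> (V n) x) \<longlonglongrightarrow> \<gamma> V0 x"
          unfolding \<gamma>_def by (intro tendsto_intros)
             (auto simp: inner_vec_def matrix_vector_mult_def intro!: tendsto_intros V)
        then have "(\<lambda>n. \<bar>\<gamma> (V n) x - \<gamma> V0 x\<bar>) \<longlonglongrightarrow> 0"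
          by (intro tendsto_rabs_zero LIM_zero)
        then show "(\<lambda>n. \<bar>\<gamma> (V (n + N)) x - \<gamma> V0 x\<bar>) \<longlonglongrightarrow> 0"
          by (rule LIMSEQ_ignore_initial_segment)
      qed
      show "AE x in lborel. norm \<bar>\<gamma> (V (n + N)) x - \<gamma> V0 x\<bar> \<le> 2 * exp (- (\<kappa> / 4) * (norm x)\<^sup>2)" for n
      proof (rule AE_I2)
        fix x :: "real^'n"
        have "\<kappa> / 2 * (norm x)\<^sup>2 \<le> \<kappa> * (norm x)\<^sup>2" using \<kappa>(1) by (intro mult_right_mono) auto
        then have "\<gamma> V0 x \<le> exp (- (\<kappa> / 4) * (norm x)\<^sup>2)" "\<gamma> (V (n + N)) x \<le> exp (- (\<kappa> / 4) * (norm x)\<^sup>2)"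
          unfolding \<gamma>_def using N[of "n + N" x] \<kappa>(2)[of x] by auto
        moreover have "0 < \<gamma> V0 x" "0 < \<gamma> (V (n + N)) x" by (auto simp: \<gamma>_def)
        ultimately show "norm \<bar>\<gamma> (V (n + N)) x - \<gamma> V0 x\<bar> \<le> 2 * exp (- (\<kappa> / 4) * (norm x)\<^sup>2)"
          by simp
      qed
    qed auto
    then have "(\<lambda>n. \<integral>x. \<bar>\<gamma> (V (n + N)) x - \<gamma> V0 x\<bar> \<partial>lborel) \<longlonglongrightarrow> 0" by simp
    then show ?thesis by (rule LIMSEQ_offset)
  qed
  show "(\<lambda>n. \<integral>x. \<bar>mvn_density (matrix_inv (V n)) x - mvn_density (matrix_inv V0) x\<bar> \<partial>lborel) \<longlonglongrightarrow> 0"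
  proof (rule tendsto_sandwich[OF _ _ tendsto_const])
    show "\<forall>\<^sub>F n in sequentially. (\<integral>x. \<bar>mvn_density (matrix_inv (V n)) x - mvn_density (matrix_inv V0) x\<bar> \<partial>lborel)
       \<le> 2 / (\<integral>x. \<gamma> V0 x \<partial>lborel) * (\<integral>x. \<bar>\<gamma> (V n) x - \<gamma> V0 x\<bar> \<partial>lborel)"
      using ev
    proof eventually_elim
      case (elim n)
      have eq: "mvn_density (matrix_inv V0) = (\<lambda>x. \<gamma> V0 x / (\<integral>y. \<gamma> V0 y \<partial>lborel))"
        "mvn_density (matrix_inv (V n)) = (\<lambda>x. \<gamma> (V n) x / (\<integral>y. \<gamma> (V n) y \<partial>lborel))"
        by (rule ext, rule gauss(3)[OF sym(2) pd], simp, rule ext, rule gauss(3)[OF sym(1) pdn[OF elim]], simp)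
      show ?case
        unfolding eq
        by (rule L1_distance_normalized)
           (use gauss(1,2)[OF sym(2) pd] gauss(1,2)[OF sym(1) pdn[OF elim]] in \<open>auto simp: \<gamma>nn\<close>)
    qed
    show "(\<lambda>n. 2 / (\<integral>x. \<gamma> V0 x \<partial>lborel) * (\<integral>x. \<bar>\<gamma> (V n) x - \<gamma> V0 x\<bar> \<partial>lborel)) \<longlonglongrightarrow> 0"
      by (rule tendsto_mult_right_zero[OF lim\<gamma>])
  qed simp
  show "\<forall>\<^sub>F n in sequentially. integrable lborel (mvn_density (matrix_inv (V n)))"
    using ev
  proof eventually_elim
    case (elim n)
    show ?case
      using gauss(1)[OF sym(1) pdn[OF elim]]
      by (subst ext[of "mvn_density (matrix_inv (V n))", OF gauss(3)[OF sym(1) pdn[OF elim]]]) auto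
  qed
  show "integrable lborel (mvn_density (matrix_inv V0))"
    using gauss(1)[OF sym(2) pd] by (subst ext[of "mvn_density (matrix_inv V0)", OF gauss(3)[OF sym(2) pd]]) auto
qed

text \<open>For x \<ge> 1 the power of x is below the same power of x^2, which reduces the claim to
  y^p / exp y with y = k x^2.\<close>

lemma tendsto_exp_neg_square_mult_power:
  fixes k :: real
  assumes "k > 0"
  shows "((\<lambda>x. exp (- k * x\<^sup>2) * x ^ p) \<longlongrightarrow> 0) at_top"
proof (rule tendsto_sandwich[OF _ _ tendsto_const])
  have "filterlim (\<lambda>x. k * x\<^sup>2) at_top at_top"
    using assms by (intro filterlim_tendsto_pos_mult_at_top[OF tendsto_const] filterlim_pow_at_top filterlim_ident) auto
  from filterlim_compose[OF tendsto_power_div_exp_0 this]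
  have "((\<lambda>x. (k * x\<^sup>2) ^ p / exp (k * x\<^sup>2)) \<longlongrightarrow> 0) at_top" .
  then show "((\<lambda>x. (1 / k ^ p) * ((k * x\<^sup>2) ^ p / exp (k * x\<^sup>2))) \<longlongrightarrow> 0) at_top"
    by (rule tendsto_mult_right_zero)
  show "\<forall>\<^sub>F x in at_top. exp (- k * x\<^sup>2) * x ^ p \<le> (1 / k ^ p) * ((k * x\<^sup>2) ^ p / exp (k * x\<^sup>2))"
    using eventually_ge_at_top[of 1]
  proof eventually_elim
    case (elim x)
    have "x \<le> x\<^sup>2" using elim by (simp add: power2_eq_square)
    then have "x ^ p \<le> (x\<^sup>2) ^ p" using elim by (intro power_mono) auto
    then have "exp (- k * x\<^sup>2) * x ^ p \<le> exp (- k * x\<^sup>2) * (x\<^sup>2) ^ p" by (intro mult_left_mono) auto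
    also have "\<dots> = (1 / k ^ p) * ((k * x\<^sup>2) ^ p / exp (k * x\<^sup>2))"
      using assms by (simp add: exp_minus power_mult_distrib field_simps)
    finally show ?case .
  qed
  show "\<forall>\<^sub>F x in at_top. 0 \<le> exp (- k * x\<^sup>2) * x ^ p"
    using eventually_ge_at_top[of 0] by eventually_elim simp
qed

text \<open>
  Laplace's method with an unbounded prior: on \<open>norm x \<le> \<delta> * r n\<close> the cubic remainder is absorbed by the
  quadratic form, and outside concavity makes the exponent at most \<open>- k * (r n)\<^sup>2\<close>, so that the integrable
  prior contributes no more than a polynomial in \<open>r n\<close> times \<open>exp (- k * (r n)\<^sup>2)\<close>.
\<close>

lemma laplace_concave:
  fixes r e :: "nat \<Rightarrow> real" and F :: "nat \<Rightarrow> real ^ 'n \<Rightarrow> real" and \<theta> :: "nat \<Rightarrow> real ^ 'n" and \<pi> :: "real ^ 'n \<Rightarrow> real"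
  defines "G n x \<equiv> exp (F n (\<theta> n + x /\<^sub>R r n) - F n (\<theta> n)) * \<pi> (\<theta> n + x /\<^sub>R r n)"
  assumes conc: "\<And>n. concave_on UNIV (F n)" and Fm[measurable]: "\<And>n. F n \<in> borel_measurable borel"
    and rpos: "\<And>n. 0 < r n" and r: "filterlim r at_top sequentially" and \<theta>: "\<theta> \<longlonglongrightarrow> \<theta>0" and e: "e \<longlonglongrightarrow> 0"
    and quad: "\<And>n h. \<bar>F n (\<theta> n + h) - F n (\<theta> n) + (r n)\<^sup>2 / 2 * Q h\<bar> \<le> (r n)\<^sup>2 * (C * norm h ^ 3 + e n * (norm h)\<^sup>2)"
    and \<kappa>: "\<kappa> > 0" "\<And>x. \<kappa> * (norm x)\<^sup>2 \<le> Q x" and Qs: "\<And>c x. Q (c *\<^sub>R x) = c\<^sup>2 * Q x"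
    and Qm[measurable]: "Q \<in> borel_measurable borel"
    and \<pi>m[measurable]: "\<pi> \<in> borel_measurable borel" and \<pi>c: "isCont \<pi> \<theta>0"
    and \<pi>pos: "\<And>x. 0 < \<pi> x" and \<pi>int: "integrable lborel \<pi>"
    and Gint: "\<And>n. integrable lborel (G n)"
  shows "(\<lambda>n. \<integral>x. \<bar>G n x - \<pi> \<theta>0 * exp (- Q x / 2)\<bar> \<partial>lborel) \<longlonglongrightarrow> 0"
proof -
  define c where "c = \<pi> \<theta>0"
  have c: "c > 0" using \<pi>pos by (simp add: c_def)
  have Gm[measurable]: "G n \<in> borel_measurable borel" for n unfolding G_def by measurable
  have Gnn: "0 < G n x" for n x unfolding G_def using \<pi>pos by simp
  obtain d where d: "d > 0" "\<And>y. dist y \<theta>0 < d \<Longrightarrow> \<bar>\<pi> y - c\<bar> < c"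
    using \<pi>c[unfolded continuous_at_eps_delta] c by (auto simp: c_def dist_real_def)
  \<comment> \<open>The first bound keeps the ball inside the region where the prior is below 2 c;
    the second lets the cubic term use at most \<kappa> / 8 of the quadratic form, with + 1 guarding
    against C = 0.\<close>
  define \<delta> where "\<delta> = min (d / 2) (\<kappa> / (8 * (\<bar>C\<bar> + 1)))"
  have \<delta>: "\<delta> > 0" "\<delta> \<le> d / 2" "\<bar>C\<bar> * \<delta> \<le> \<kappa> / 8"
  proof -
    show "\<delta> > 0" using d \<kappa> by (auto simp: \<delta>_def add_nonneg_pos)
    show "\<delta> \<le> d / 2" unfolding \<delta>_def by (rule min.cobounded1)
    have "\<bar>C\<bar> * \<delta> \<le> \<bar>C\<bar> * (\<kappa> / (8 * (\<bar>C\<bar> + 1)))" by (intro mult_left_mono) (auto simp: \<delta>_def)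
    also have "\<dots> = \<kappa> / 8 * (\<bar>C\<bar> / (\<bar>C\<bar> + 1))" by simp
    also have "\<dots> \<le> \<kappa> / 8 * 1" using \<kappa> by (intro mult_left_mono) (auto simp: field_simps)
    finally show "\<bar>C\<bar> * \<delta> \<le> \<kappa> / 8" by simp
  qed
  \<comment> \<open>The quadratic form supplies \<kappa> / 2; the cubic term and \<open>e n\<close>
    consume \<kappa> / 8 each, so \<kappa> / 4 remains in \<open>near\<close>.\<close>
  have "\<forall>\<^sub>F n in sequentially. \<bar>e n\<bar> < \<kappa> / 8"
    using order_tendstoD(2)[OF tendsto_rabs_zero[OF e], of "\<kappa> / 8"] \<kappa> by simp
  moreover have "\<forall>\<^sub>F n in sequentially. dist (\<theta> n) \<theta>0 < d / 2" using tendstoD[OF \<theta>, of "d / 2"] d by simp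
  moreover have "\<forall>\<^sub>F n in sequentially. 1 \<le> r n" using r by (simp add: filterlim_at_top)
  ultimately have "\<forall>\<^sub>F n in sequentially. \<bar>e n\<bar> < \<kappa> / 8 \<and> dist (\<theta> n) \<theta>0 < d / 2 \<and> 1 \<le> r n" by eventually_elim auto
  then obtain N where N: "\<And>n. n \<ge> N \<Longrightarrow> \<bar>e n\<bar> < \<kappa> / 8" "\<And>n. n \<ge> N \<Longrightarrow> dist (\<theta> n) \<theta>0 < d / 2" "\<And>n. n \<ge> N \<Longrightarrow> 1 \<le> r n"
    unfolding eventually_sequentially by blast
  have near: "F n (\<theta> n + h) - F n (\<theta> n) \<le> - (\<kappa> / 4) * (r n)\<^sup>2 * (norm h)\<^sup>2" if n: "n \<ge> N" and h: "norm h \<le> \<delta>" for n h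
  proof -
    have "C * norm h ^ 3 \<le> \<bar>C\<bar> * \<delta> * (norm h)\<^sup>2"
    proof -
      have "C * norm h ^ 3 \<le> \<bar>C\<bar> * (norm h * (norm h)\<^sup>2)"
        unfolding power2_eq_square power3_eq_cube mult.assoc by (intro mult_right_mono) auto
      also have "\<dots> \<le> \<bar>C\<bar> * (\<delta> * (norm h)\<^sup>2)" using h by (intro mult_left_mono mult_right_mono) auto
      finally show ?thesis by simp
    qed
    also have "\<dots> \<le> \<kappa> / 8 * (norm h)\<^sup>2" using \<delta>(3) by (intro mult_right_mono) auto
    finally have 1: "C * norm h ^ 3 \<le> \<kappa> / 8 * (norm h)\<^sup>2" .
    have 2: "e n * (norm h)\<^sup>2 \<le> \<kappa> / 8 * (norm h)\<^sup>2" using N(1)[OF n] by (intro mult_right_mono) auto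
    have "F n (\<theta> n + h) - F n (\<theta> n) \<le> (r n)\<^sup>2 * (C * norm h ^ 3 + e n * (norm h)\<^sup>2) - (r n)\<^sup>2 / 2 * Q h"
      using quad[of n h] by linarith
    also have "\<dots> = (r n)\<^sup>2 * (C * norm h ^ 3 + e n * (norm h)\<^sup>2 - Q h / 2)" by (simp add: algebra_simps)
    also have "\<dots> \<le> (r n)\<^sup>2 * (- (\<kappa> / 4) * (norm h)\<^sup>2)"
      using 1 2 \<kappa>(2)[of h] by (intro mult_left_mono[OF _ zero_le_power2]) argo
    finally show ?thesis by (simp add: mult_ac)
  qed
  have far: "F n (\<theta> n + h) - F n (\<theta> n) \<le> - (\<kappa> / 4) * \<delta>\<^sup>2 * (r n)\<^sup>2" if n: "n \<ge> N" and h: "\<delta> \<le> norm h" for n h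
  proof -
    have "\<delta> \<le> norm ((\<theta> n + h) - \<theta> n)" using h by simp
    then obtain y where y: "norm (y - \<theta> n) = \<delta>" "F n (\<theta> n + h) - F n (\<theta> n) \<le> norm ((\<theta> n + h) - \<theta> n) / \<delta> * (F n y - F n (\<theta> n))"
      using concave_on_radial[OF conc \<delta>(1)] by blast
    have Fy: "F n y - F n (\<theta> n) \<le> - (\<kappa> / 4) * \<delta>\<^sup>2 * (r n)\<^sup>2"
      using near[OF n, of "y - \<theta> n"] y(1) by (simp add: mult_ac)
    then have "F n y - F n (\<theta> n) \<le> 0"
      using \<kappa>(1) by (smt (verit) mult_nonneg_nonneg mult_minus_left zero_le_power2 divide_nonneg_nonneg)
    \<comment> \<open>The increment on the sphere is nonpositive, so the radial factor, which is at
      least 1, can only improve the bound.\<close>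
    then have "norm h / \<delta> * (F n y - F n (\<theta> n)) \<le> 1 * (F n y - F n (\<theta> n))"
      using h \<delta>(1) by (intro mult_right_mono_neg) auto
    then show ?thesis using y(2) Fy by simp
  qed
  \<comment> \<open>The error with the far part of \<open>G\<close> removed; only this truncation
    has an integrable dominator.\<close>
  define s where "s n x = \<bar>indicator {x. norm x \<le> \<delta> * r n} x * G n x - c * exp (- Q x / 2)\<bar>" for n x
  have [measurable]: "s n \<in> borel_measurable borel" for n unfolding s_def by measurable
  have s0: "(\<lambda>n. \<integral>x. s (n + N) x \<partial>lborel) \<longlonglongrightarrow> (\<integral>x. 0 \<partial>(lborel :: (real^'n) measure))"
    and sint: "\<And>n. integrable lborel (s (n + N))"
  proof -
    \<comment> \<open>The factor 3 c is 2 c from the prior near its limit point plus c from the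
      limiting function.\<close>
    have w: "integrable lborel (\<lambda>x::real^'n. 3 * c * exp (- (\<kappa> / 4) * (norm x)\<^sup>2))"
      using \<kappa>(1) by (intro integrable_mult_right integrable_exp_neg_norm_square) simp
    have lim: "AE x in lborel. (\<lambda>n. s (n + N) x) \<longlonglongrightarrow> 0"
    proof (rule AE_I2)
      fix x :: "real^'n"
      have inv: "(\<lambda>n. inverse (r n)) \<longlonglongrightarrow> 0" by (rule tendsto_inverse_0_at_top[OF r])
      have "(\<lambda>n. \<theta> n + x /\<^sub>R r n) \<longlonglongrightarrow> \<theta>0 + 0 *\<^sub>R x"
        by (intro tendsto_intros \<theta> inv)
      then have lim\<pi>: "(\<lambda>n. \<pi> (\<theta> n + x /\<^sub>R r n)) \<longlonglongrightarrow> c"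
        unfolding c_def by (intro isCont_tendsto_compose[OF \<pi>c]) simp
      have "(\<lambda>n. F n (\<theta> n + x /\<^sub>R r n) - F n (\<theta> n) + Q x / 2) \<longlonglongrightarrow> 0"
      proof (rule tendsto_0_le[where K=1])
        have "(\<lambda>n. C * norm x ^ 3 * inverse (r n) + e n * (norm x)\<^sup>2) \<longlonglongrightarrow> C * norm x ^ 3 * 0 + 0 * (norm x)\<^sup>2"
          by (intro tendsto_intros inv e)
        then show "(\<lambda>n. C * norm x ^ 3 * inverse (r n) + e n * (norm x)\<^sup>2) \<longlonglongrightarrow> 0" by simp
        show "\<forall>\<^sub>F n in sequentially. norm (F n (\<theta> n + x /\<^sub>R r n) - F n (\<theta> n) + Q x / 2)
            \<le> norm (C * norm x ^ 3 * inverse (r n) + e n * (norm x)\<^sup>2) * 1"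
        proof (intro always_eventually allI)
          fix n
          have rn: "r n \<noteq> 0" using rpos[of n] by simp
          have "(r n)\<^sup>2 / 2 * Q (x /\<^sub>R r n) = Q x / 2" using rn by (simp add: Qs field_simps)
          moreover have "(r n)\<^sup>2 * (C * norm (x /\<^sub>R r n) ^ 3 + e n * (norm (x /\<^sub>R r n))\<^sup>2) = C * norm x ^ 3 * inverse (r n) + e n * (norm x)\<^sup>2"
            using rn rpos[of n] by (simp add: power_mult_distrib field_simps power2_eq_square power3_eq_cube)
          ultimately show "norm (F n (\<theta> n + x /\<^sub>R r n) - F n (\<theta> n) + Q x / 2)
            \<le> norm (C * norm x ^ 3 * inverse (r n) + e n * (norm x)\<^sup>2) * 1"
            using quad[of n "x /\<^sub>R r n"] by simp
        qed
      qed
      then have "(\<lambda>n. (F n (\<theta> n + x /\<^sub>R r n) - F n (\<theta> n) + Q x / 2) - Q x / 2) \<longlonglongrightarrow> 0 - Q x / 2"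
        by (intro tendsto_intros)
      then have "(\<lambda>n. G n x) \<longlonglongrightarrow> exp (- Q x / 2) * c"
        unfolding G_def by (intro tendsto_intros lim\<pi>) simp
      then have "(\<lambda>n. \<bar>G n x - c * exp (- Q x / 2)\<bar>) \<longlonglongrightarrow> 0"
        by (intro tendsto_rabs_zero LIM_zero) (simp add: mult.commute)
      moreover have "\<forall>\<^sub>F n in sequentially. \<bar>G n x - c * exp (- Q x / 2)\<bar> = s n x"
      proof -
        have "\<forall>\<^sub>F n in sequentially. norm x / \<delta> \<le> r n" using r by (simp add: filterlim_at_top)
        then show ?thesis by eventually_elim (use \<delta>(1) in \<open>simp add: s_def field_simps\<close>)
      qed
      ultimately have "(\<lambda>n. s n x) \<longlonglongrightarrow> 0" by (rule Lim_transform_eventually)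
      then show "(\<lambda>n. s (n + N) x) \<longlonglongrightarrow> 0" by (rule LIMSEQ_ignore_initial_segment)
    qed
    have bnd: "AE x in lborel. norm (s (n + N) x) \<le> 3 * c * exp (- (\<kappa> / 4) * (norm x)\<^sup>2)" for n
    proof (rule AE_I2)
      fix x :: "real^'n"
      define k where "k = n + N"
      have k: "k \<ge> N" and r1: "1 \<le> r k" using N(3) by (auto simp: k_def)
      define E where "E = exp (- (\<kappa> / 4) * (norm x)\<^sup>2)"
      have "\<kappa> / 2 * (norm x)\<^sup>2 \<le> \<kappa> * (norm x)\<^sup>2" using \<kappa>(1) by (intro mult_right_mono) auto
      then have 1: "exp (- Q x / 2) \<le> E" unfolding E_def using \<kappa>(2)[of x] by simp
      have 2: "G k x \<le> E * (2 * c)" if x: "norm x \<le> \<delta> * r k"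
      proof -
        have nh: "norm (x /\<^sub>R r k) \<le> \<delta>" using x r1 by (simp add: field_simps)
        have "F k (\<theta> k + x /\<^sub>R r k) - F k (\<theta> k) \<le> - (\<kappa> / 4) * (norm x)\<^sup>2"
          using near[OF k nh] r1 by (simp add: power_mult_distrib field_simps)
        then have "exp (F k (\<theta> k + x /\<^sub>R r k) - F k (\<theta> k)) \<le> E" by (simp add: E_def)
        moreover have "dist (\<theta> k + x /\<^sub>R r k) \<theta>0 < d"
        proof -
          have "dist (\<theta> k + x /\<^sub>R r k) \<theta>0 \<le> dist (\<theta> k) \<theta>0 + norm (x /\<^sub>R r k)"
            unfolding dist_norm by (metis add_diff_eq add.commute norm_triangle_ineq add_diff_add diff_add_eq)
          then show ?thesis using N(2)[OF k] nh \<delta>(2) by linarith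
        qed
        then have "\<pi> (\<theta> k + x /\<^sub>R r k) \<le> 2 * c" using d(2) by fastforce
        ultimately show ?thesis unfolding G_def using less_imp_le[OF \<pi>pos] by (intro mult_mono) (auto simp: E_def)
      qed
      have "0 < E" by (simp add: E_def)
      have ce: "0 < c * exp (- Q x / 2)" "c * exp (- Q x / 2) \<le> c * E" using c 1 by auto
      have "\<bar>indicator {x. norm x \<le> \<delta> * r k} x * G k x - c * exp (- Q x / 2)\<bar> \<le> 3 * c * E"
      proof (cases "norm x \<le> \<delta> * r k")
        case True
        then have "\<bar>G k x - c * exp (- Q x / 2)\<bar> \<le> 3 * c * E"
          using 2[OF True] Gnn[of k x] ce by (simp add: algebra_simps)
        then show ?thesis using True by simp
      next
        case False
        have "c * E > 0" using c \<open>0 < E\<close> by simp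
        then show ?thesis using False ce by simp
      qed
      then show "norm (s (n + N) x) \<le> 3 * c * exp (- (\<kappa> / 4) * (norm x)\<^sup>2)"
        by (simp add: s_def k_def E_def)
    qed
    show "(\<lambda>n. \<integral>x. s (n + N) x \<partial>lborel) \<longlonglongrightarrow> (\<integral>x. 0 \<partial>(lborel :: (real^'n) measure))"
      by (rule integral_dominated_convergence[OF _ _ w lim bnd]) auto
    show "integrable lborel (s (n + N))" for n
      by (rule Bochner_Integration.integrable_bound[OF w]) (use bnd[of n] c in \<open>auto simp: abs_mult\<close>)
  qed
  define k where "k = \<kappa> / 4 * \<delta>\<^sup>2"
  have k: "k > 0" using \<kappa>(1) \<delta>(1) by (simp add: k_def)
  define p where "p = DIM(real^'n)"
  define I where "I = (\<integral>x. \<pi> x \<partial>lborel)"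
  \<comment> \<open>In the local scale the prior has total mass (r n)^p times its integral: this is
    the polynomial that the exponential has to beat.\<close>
  have \<pi>aff: "integrable lborel (\<lambda>x. \<pi> (\<theta> n + x /\<^sub>R r n))" "(\<integral>x. \<pi> (\<theta> n + x /\<^sub>R r n) \<partial>lborel) = r n ^ p * I" for n
  proof -
    have rn: "inverse (r n) \<noteq> 0" using rpos[of n] by simp
    show "integrable lborel (\<lambda>x. \<pi> (\<theta> n + x /\<^sub>R r n))"
      using integrable_lborel_affine[OF \<pi>m rn] \<pi>int by simp
    show "(\<integral>x. \<pi> (\<theta> n + x /\<^sub>R r n) \<partial>lborel) = r n ^ p * I"
      unfolding I_def using integral_lborel_affine[OF \<pi>m rn, of "\<theta> n"] rpos[of n]
      by (simp add: p_def field_simps power_inverse)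
  qed
  have bound: "(\<integral>x. \<bar>G m x - c * exp (- Q x / 2)\<bar> \<partial>lborel) \<le> (\<integral>x. s m x \<partial>lborel) + exp (- k * (r m)\<^sup>2) * (r m ^ p * I)"
    if m: "m \<ge> N" for m
  proof -
    have sm: "integrable lborel (s m)" using sint[of "m - N"] m by simp
    have "(\<integral>x. \<bar>G m x - c * exp (- Q x / 2)\<bar> \<partial>lborel) \<le> (\<integral>x. s m x + exp (- k * (r m)\<^sup>2) * \<pi> (\<theta> m + x /\<^sub>R r m) \<partial>lborel)"
    proof (rule integral_mono_AE')
      show "integrable lborel (\<lambda>x. s m x + exp (- k * (r m)\<^sup>2) * \<pi> (\<theta> m + x /\<^sub>R r m))"
        using sm \<pi>aff by auto
      show "AE x in lborel. \<bar>G m x - c * exp (- Q x / 2)\<bar> \<le> s m x + exp (- k * (r m)\<^sup>2) * \<pi> (\<theta> m + x /\<^sub>R r m)"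
      proof (rule AE_I2)
        fix x :: "real^'n"
        have pe: "0 < exp (- k * (r m)\<^sup>2) * \<pi> (\<theta> m + x /\<^sub>R r m)" using \<pi>pos by simp
        show "\<bar>G m x - c * exp (- Q x / 2)\<bar> \<le> s m x + exp (- k * (r m)\<^sup>2) * \<pi> (\<theta> m + x /\<^sub>R r m)"
        proof (cases "norm x \<le> \<delta> * r m")
          case True
          then show ?thesis using pe by (simp add: s_def)
        next
          case False
          then have "\<delta> \<le> norm (x /\<^sub>R r m)" using rpos[of m] by (simp add: field_simps)
          from far[OF m this] have "G m x \<le> exp (- k * (r m)\<^sup>2) * \<pi> (\<theta> m + x /\<^sub>R r m)"
            unfolding G_def using less_imp_le[OF \<pi>pos] by (intro mult_right_mono) (auto simp: k_def)
          moreover have "0 < c * exp (- Q x / 2)" using c by simp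
          ultimately show ?thesis using False Gnn[of m x] by (simp add: s_def)
        qed
      qed
    next
      show "AE x in lborel. 0 \<le> s m x + exp (- k * (r m)\<^sup>2) * \<pi> (\<theta> m + x /\<^sub>R r m)"
        by (intro AE_I2 add_nonneg_nonneg mult_nonneg_nonneg) (simp_all add: s_def less_imp_le[OF \<pi>pos])
    qed
    also have "\<dots> = (\<integral>x. s m x \<partial>lborel) + exp (- k * (r m)\<^sup>2) * (r m ^ p * I)"
      using sm \<pi>aff by (subst Bochner_Integration.integral_add) auto
    finally show ?thesis .
  qed
  have "(\<lambda>n. \<integral>x. s n x \<partial>lborel) \<longlonglongrightarrow> 0" by (rule LIMSEQ_offset[where k=N]) (use s0 in simp)
  moreover have "(\<lambda>n. exp (- k * (r n)\<^sup>2) * (r n ^ p * I)) \<longlonglongrightarrow> 0"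
  proof -
    have "((\<lambda>x::real. exp (- k * x\<^sup>2) * x ^ p) \<longlongrightarrow> 0) at_top"
      using k by (rule tendsto_exp_neg_square_mult_power)
    then have "(\<lambda>n. exp (- k * (r n)\<^sup>2) * r n ^ p) \<longlonglongrightarrow> 0" using r by (rule filterlim_compose)
    then have "(\<lambda>n. exp (- k * (r n)\<^sup>2) * r n ^ p * I) \<longlonglongrightarrow> 0" by (rule tendsto_mult_left_zero)
    then show ?thesis by (simp only: mult.assoc)
  qed
  ultimately have lim: "(\<lambda>n. (\<integral>x. s n x \<partial>lborel) + exp (- k * (r n)\<^sup>2) * (r n ^ p * I)) \<longlonglongrightarrow> 0"
    by (rule tendsto_add_zero)
  show ?thesis
    unfolding c_def[symmetric]
    by (rule tendsto_sandwich[OF _ _ tendsto_const lim])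
       (use bound in \<open>auto intro!: eventually_sequentiallyI[of N]\<close>)
qed

section \<open>The limit along sequences, its transfer to filters, and the rescaled
  posterior\<close>

lemma integral_lborel_pos:
  fixes f :: "'a::euclidean_space \<Rightarrow> real"
  assumes int: "integrable lborel f" and pos: "\<And>x. 0 < f x"
  shows "0 < (\<integral>x. f x \<partial>lborel)"
proof -
  have "(\<integral>x. f x \<partial>lborel) \<noteq> 0"
  proof
    assume "(\<integral>x. f x \<partial>lborel) = 0"
    then have "AE x in lborel. f x = 0"
      using integral_nonneg_eq_0_iff_AE[OF int] pos by (auto simp: less_imp_le)
    then have "AE x in (lborel :: 'a measure). False"
      by eventually_elim (use pos in \<open>auto simp: less_le\<close>)
    then have "ae_filter (lborel :: 'a measure) = bot" by (simp add: trivial_limit_def)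
    then show False by (simp add: ae_filter_eq_bot_iff)
  qed
  moreover have "0 \<le> (\<integral>x. f x \<partial>lborel)"
    using pos by (intro Bochner_Integration.integral_nonneg) (simp add: less_imp_le)
  ultimately show ?thesis by simp
qed

text \<open>Triangle inequality through the Gaussian with the fixed precision matrix
  \<open>V0\<close>: the Laplace limit handles the posterior, continuity in the matrix handles the
  Gaussian with \<open>V n\<close>.\<close>

lemma bernstein_von_mises_sequence:
  fixes r e :: "nat \<Rightarrow> real" and F q :: "nat \<Rightarrow> real ^ 'n \<Rightarrow> real" and \<theta> :: "nat \<Rightarrow> real ^ 'n"
    and \<pi> :: "real ^ 'n \<Rightarrow> real" and V :: "nat \<Rightarrow> real ^ 'n ^ 'n"
  defines "G n x \<equiv> exp (F n (\<theta> n + x /\<^sub>R r n) - F n (\<theta> n)) * \<pi> (\<theta> n + x /\<^sub>R r n)"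
  assumes conc: "\<And>n. concave_on UNIV (F n)" and Fm[measurable]: "\<And>n. F n \<in> borel_measurable borel"
    and Fmax: "\<And>n x. F n x \<le> F n (\<theta> n)"
    and rpos: "\<And>n. 0 < r n" and r: "filterlim r at_top sequentially" and \<theta>: "\<theta> \<longlonglongrightarrow> \<theta>0" and e: "e \<longlonglongrightarrow> 0"
    and quad: "\<And>n h. \<bar>F n (\<theta> n + h) - F n (\<theta> n) + (r n)\<^sup>2 / 2 * (h \<bullet> (V0 *v h))\<bar> \<le> (r n)\<^sup>2 * (C * norm h ^ 3 + e n * (norm h)\<^sup>2)"
    and V: "V \<longlonglongrightarrow> V0" and sym: "\<And>n. transpose (V n) = V n" "transpose V0 = V0"
    and pd: "\<And>x. x \<noteq> 0 \<Longrightarrow> 0 < x \<bullet> (V0 *v x)"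
    and \<pi>m[measurable]: "\<pi> \<in> borel_measurable borel" and \<pi>c: "isCont \<pi> \<theta>0"
    and \<pi>pos: "\<And>x. 0 < \<pi> x" and \<pi>int: "integrable lborel \<pi>"
    and qm[measurable]: "\<And>n. q n \<in> borel_measurable borel"
    and q: "\<And>n. AE x in lborel. q n x = G n x / (\<integral>y. G n y \<partial>lborel)"
  shows "(\<lambda>n. \<integral>x. \<bar>q n x - mvn_density (matrix_inv (V n)) x\<bar> \<partial>lborel) \<longlonglongrightarrow> 0"
proof -
  obtain \<kappa> where \<kappa>: "\<kappa> > 0" "\<And>x. \<kappa> * (norm x)\<^sup>2 \<le> x \<bullet> (V0 *v x)"
    using pos_def_imp_coercive[OF pd] by blast
  have Gm[measurable]: "G n \<in> borel_measurable borel" for n unfolding G_def by measurable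
  have Gpos: "0 < G n x" for n x unfolding G_def using \<pi>pos by simp
  \<comment> \<open>At a maximizer the exponential factor is at most 1, so the rescaled prior
    dominates \<open>G n\<close>.\<close>
  have Gint: "integrable lborel (G n)" for n
  proof (rule Bochner_Integration.integrable_bound)
    show "integrable lborel (\<lambda>x. \<pi> (\<theta> n + inverse (r n) *\<^sub>R x))"
      using integrable_lborel_affine[OF \<pi>m, of "inverse (r n)" "\<theta> n"] rpos[of n] \<pi>int by simp
    show "AE x in lborel. norm (G n x) \<le> norm (\<pi> (\<theta> n + inverse (r n) *\<^sub>R x))"
    proof (rule AE_I2)
      fix x
      have "G n x \<le> 1 * \<pi> (\<theta> n + x /\<^sub>R r n)"
        unfolding G_def using Fmax less_imp_le[OF \<pi>pos] by (intro mult_right_mono) auto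
      then show "norm (G n x) \<le> norm (\<pi> (\<theta> n + inverse (r n) *\<^sub>R x))"
        using Gpos[of n x] by simp
    qed
  qed simp
  have Gint_pos: "0 < (\<integral>x. G n x \<partial>lborel)" for n
    using Gint Gpos by (rule integral_lborel_pos)
  define h where "h x = \<pi> \<theta>0 * exp (- (x \<bullet> (V0 *v x)) / 2)" for x
  have [measurable]: "h \<in> borel_measurable borel" unfolding h_def by measurable
  have gauss: "integrable lborel (\<lambda>x. exp (- (x \<bullet> (V0 *v x)) / 2))" "0 < (\<integral>x. exp (- (x \<bullet> (V0 *v x)) / 2) \<partial>lborel)"
    using has_bochner_integral_gaussian[OF sym(2) pd] det_pos_def[OF sym(2) pd] by (auto simp: has_bochner_integral_iff)
  have hint: "integrable lborel h" "0 < (\<integral>x. h x \<partial>lborel)"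
    unfolding h_def[abs_def] using gauss \<pi>pos by (auto simp del: divide_minus_left minus_divide_left)
  have mvn0: "mvn_density (matrix_inv V0) x = h x / (\<integral>y. h y \<partial>lborel)" for x
    using \<pi>pos[of \<theta>0] gauss by (simp add: mvn_density_matrix_inv[OF sym(2) pd] h_def)
  have limG: "(\<lambda>n. \<integral>x. \<bar>G n x - h x\<bar> \<partial>lborel) \<longlonglongrightarrow> 0"
    unfolding h_def G_def
    by (rule laplace_concave[where Q="\<lambda>x. x \<bullet> (V0 *v x)", OF conc Fm rpos r \<theta> e quad \<kappa>])
       (use \<pi>c \<pi>pos \<pi>int Gint in \<open>auto simp: matrix_vector_mult_scaleR power2_eq_square G_def[abs_def]\<close>)
  have mvn: "(\<lambda>n. \<integral>x. \<bar>mvn_density (matrix_inv (V n)) x - mvn_density (matrix_inv V0) x\<bar> \<partial>lborel) \<longlonglongrightarrow> 0"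
    "\<forall>\<^sub>F n in sequentially. integrable lborel (mvn_density (matrix_inv (V n)))"
    "integrable lborel (mvn_density (matrix_inv V0))"
    using tendsto_L1_mvn_density[OF V sym] pd by simp_all
  have qint: "integrable lborel (q n)" for n
  proof -
    have "integrable lborel (\<lambda>x. G n x / (\<integral>y. G n y \<partial>lborel))" using Gint by simp
    then show ?thesis using q by (subst integrable_cong_AE[OF _ _ q]) auto
  qed
  show ?thesis
  proof (rule tendsto_sandwich[OF _ _ tendsto_const])
    show "(\<lambda>n. 2 / (\<integral>x. h x \<partial>lborel) * (\<integral>x. \<bar>G n x - h x\<bar> \<partial>lborel)
        + (\<integral>x. \<bar>mvn_density (matrix_inv (V n)) x - mvn_density (matrix_inv V0) x\<bar> \<partial>lborel)) \<longlonglongrightarrow> 0"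
      by (intro tendsto_add_zero tendsto_mult_right_zero limG mvn)
    show "\<forall>\<^sub>F n in sequentially. (\<integral>x. \<bar>q n x - mvn_density (matrix_inv (V n)) x\<bar> \<partial>lborel)
      \<le> 2 / (\<integral>x. h x \<partial>lborel) * (\<integral>x. \<bar>G n x - h x\<bar> \<partial>lborel)
        + (\<integral>x. \<bar>mvn_density (matrix_inv (V n)) x - mvn_density (matrix_inv V0) x\<bar> \<partial>lborel)"
      using mvn(2)
    proof eventually_elim
      case (elim n)
      have "(\<integral>x. \<bar>q n x - mvn_density (matrix_inv (V n)) x\<bar> \<partial>lborel)
        \<le> (\<integral>x. \<bar>q n x - mvn_density (matrix_inv V0) x\<bar> + \<bar>mvn_density (matrix_inv (V n)) x - mvn_density (matrix_inv V0) x\<bar> \<partial>lborel)"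
        using elim mvn(3) qint by (intro integral_mono) auto
      also have "\<dots> = (\<integral>x. \<bar>q n x - mvn_density (matrix_inv V0) x\<bar> \<partial>lborel)
         + (\<integral>x. \<bar>mvn_density (matrix_inv (V n)) x - mvn_density (matrix_inv V0) x\<bar> \<partial>lborel)"
        using elim mvn(3) qint by (intro Bochner_Integration.integral_add) auto
      also have "(\<integral>x. \<bar>q n x - mvn_density (matrix_inv V0) x\<bar> \<partial>lborel)
        = (\<integral>x. \<bar>G n x / (\<integral>y. G n y \<partial>lborel) - h x / (\<integral>y. h y \<partial>lborel)\<bar> \<partial>lborel)"
        unfolding mvn0 by (rule integral_cong_AE) (use q[of n] in auto)
      also have "\<dots> \<le> 2 / (\<integral>x. h x \<partial>lborel) * (\<integral>x. \<bar>G n x - h x\<bar> \<partial>lborel)"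
        by (rule L1_distance_normalized[OF Gint hint(1) less_imp_le[OF Gpos] Gint_pos hint(2)])
      finally show ?case by simp
    qed
  qed simp
qed

text \<open>If convergence fails at some \<epsilon>, every eventual property is met by a violating
  point. Asking for \<tau> \<ge> n and for \<open>e\<close> within 1 / (n + 1) of its limit selects
  a sequence that contradicts \<open>seq\<close>; \<open>F\<close> itself may lack a countable
  base.\<close>

lemma tendsto_via_sequences:
  fixes \<tau> :: "'b \<Rightarrow> nat" and e :: "'b \<Rightarrow> 'c::metric_space" and Z :: "'b \<Rightarrow> 'd::metric_space"
  assumes \<tau>: "filterlim \<tau> at_top F" and e: "(e \<longlongrightarrow> l) F" and P: "eventually P F"
    and seq: "\<And>s :: nat \<Rightarrow> 'b. (\<And>n. P (s n)) \<Longrightarrow> filterlim (\<lambda>n. \<tau> (s n)) at_top sequentially \<Longrightarrow>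
      (\<lambda>n. e (s n)) \<longlonglongrightarrow> l \<Longrightarrow> (\<lambda>n. Z (s n)) \<longlonglongrightarrow> z"
  shows "(Z \<longlongrightarrow> z) F"
proof (rule tendstoI, rule ccontr)
  fix \<epsilon> :: real assume \<epsilon>: "\<epsilon> > 0" and neg: "\<not> (\<forall>\<^sub>F x in F. dist (Z x) z < \<epsilon>)"
  have "\<exists>x. P x \<and> n \<le> \<tau> x \<and> dist (e x) l < 1 / real (Suc n) \<and> \<not> dist (Z x) z < \<epsilon>" for n
  proof (rule ccontr)
    assume *: "\<not> ?thesis"
    have "\<forall>\<^sub>F x in F. P x \<and> n \<le> \<tau> x \<and> dist (e x) l < 1 / real (Suc n)"
      using P \<tau> tendstoD[OF e, of "1 / real (Suc n)"] by (intro eventually_conj) (auto simp: filterlim_at_top)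
    then have "\<forall>\<^sub>F x in F. dist (Z x) z < \<epsilon>" by eventually_elim (use * in blast)
    with neg show False ..
  qed
  then obtain s where s: "\<And>n. P (s n)" "\<And>n. n \<le> \<tau> (s n)" "\<And>n. dist (e (s n)) l < 1 / real (Suc n)"
    "\<And>n. \<not> dist (Z (s n)) z < \<epsilon>"
    by metis
  have "(\<lambda>n. Z (s n)) \<longlonglongrightarrow> z"
  proof (rule seq[OF s(1)])
    show "filterlim (\<lambda>n. \<tau> (s n)) at_top sequentially"
      by (rule filterlim_at_top_mono[OF filterlim_ident]) (use s(2) in auto)
    show "(\<lambda>n. e (s n)) \<longlonglongrightarrow> l"
      unfolding tendsto_dist_iff[of _ l]
      by (rule tendsto_sandwich[OF _ _ tendsto_const LIMSEQ_inverse_real_of_nat])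
         (use s(3) in \<open>auto simp: inverse_eq_divide less_imp_le intro!: always_eventually\<close>)
  qed
  from tendstoD[OF this \<epsilon>] s(4) show False by (auto simp: eventually_sequentially)
qed

text \<open>A Lebesgue density is determined almost everywhere by its measure, so it suffices to
  push the measure forward by the affine map and read off the Jacobian.\<close>

lemma distributed_scaled_density:
  fixes u f :: "'a::euclidean_space \<Rightarrow> ennreal"
  assumes [measurable]: "u \<in> borel_measurable borel" and r: "0 < r"
    and d: "distributed (density lborel u) lborel (\<lambda>\<theta>. r *\<^sub>R (\<theta> - a)) f"
  shows "AE x in lborel. f x = ennreal (inverse r ^ DIM('a)) * u (a + x /\<^sub>R r)"
proof (rule sigma_finite_measure.density_unique[OF lborel.sigma_finite_measure_axioms])
  have f[measurable]: "f \<in> borel_measurable lborel"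
    and eq: "distr (density lborel u) lborel (\<lambda>\<theta>. r *\<^sub>R (\<theta> - a)) = density lborel f"
    using d by (auto simp: distributed_def)
  show "f \<in> borel_measurable lborel" by fact
  show "(\<lambda>x. ennreal (inverse r ^ DIM('a)) * u (a + x /\<^sub>R r)) \<in> borel_measurable lborel" by measurable
  show "density lborel f = density lborel (\<lambda>x. ennreal (inverse r ^ DIM('a)) * u (a + x /\<^sub>R r))"
    unfolding eq[symmetric]
  proof (rule measure_eqI)
    fix S assume "S \<in> sets (distr (density lborel u) lborel (\<lambda>\<theta>. r *\<^sub>R (\<theta> - a)))"
    then have [measurable]: "S \<in> sets borel" by simp
    have [measurable]: "(\<lambda>\<theta>. r *\<^sub>R (\<theta> - a)) -` S \<in> sets borel"
      by (rule measurable_sets_borel[where M=borel]) simp_all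
    have "emeasure (distr (density lborel u) lborel (\<lambda>\<theta>. r *\<^sub>R (\<theta> - a))) S
      = (\<integral>\<^sup>+\<theta>. u \<theta> * indicator ((\<lambda>\<theta>. r *\<^sub>R (\<theta> - a)) -` S) \<theta> \<partial>lborel)"
      by (subst emeasure_distr) (simp_all add: emeasure_density)
    also have "\<dots> = (\<integral>\<^sup>+\<theta>. u \<theta> * indicator S (r *\<^sub>R (\<theta> - a)) \<partial>lborel)"
      by (simp add: indicator_def)
    also have "\<dots> = (\<integral>\<^sup>+\<theta>. u \<theta> * indicator S (r *\<^sub>R (\<theta> - a)) \<partial>density (distr lborel borel (\<lambda>x. a + inverse r *\<^sub>R x)) (\<lambda>_. ennreal (\<bar>inverse r\<bar> ^ DIM('a))))"
      using r by (subst lborel_affine[of "inverse r" a]) (auto simp: ennreal_power)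
    also have "\<dots> = (\<integral>\<^sup>+x. ennreal (inverse r ^ DIM('a)) * u (a + x /\<^sub>R r) * indicator S x \<partial>lborel)"
      using r by (simp add: nn_integral_density nn_integral_distr mult.assoc)
    also have "\<dots> = emeasure (density lborel (\<lambda>x. ennreal (inverse r ^ DIM('a)) * u (a + x /\<^sub>R r))) S"
      by (simp add: emeasure_density)
    finally show "emeasure (distr (density lborel u) lborel (\<lambda>\<theta>. r *\<^sub>R (\<theta> - a))) S
      = emeasure (density lborel (\<lambda>x. ennreal (inverse r ^ DIM('a)) * u (a + x /\<^sub>R r))) S" .
  qed simp
qed

text \<open>The evidence is finite because \<open>l\<close> is bounded by its maximum. The factor
  exp (- l a) and the Jacobian occur in numerator and denominator and cancel.\<close>

lemma rescaled_posterior_density: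
  fixes l \<pi> q :: "'a::euclidean_space \<Rightarrow> real" and a :: 'a and r :: real
  defines "w \<equiv> \<lambda>\<theta>. ennreal (exp (l \<theta>) * \<pi> \<theta>)"
  defines "G x \<equiv> exp (l (a + x /\<^sub>R r) - l a) * \<pi> (a + x /\<^sub>R r)"
  assumes [measurable]: "l \<in> borel_measurable borel" "\<pi> \<in> borel_measurable borel"
    and \<pi>pos: "\<And>x. 0 < \<pi> x" and \<pi>int: "integrable lborel \<pi>" and max: "\<And>x. l x \<le> l a"
    and r: "0 < r" and qnn: "\<And>x. 0 \<le> q x"
    and d: "distributed (density lborel (\<lambda>\<theta>. w \<theta> / (\<integral>\<^sup>+\<theta>'. w \<theta>' \<partial>lborel))) lborel (\<lambda>\<theta>. r *\<^sub>R (\<theta> - a)) (\<lambda>x. ennreal (q x))"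
  shows "AE x in lborel. q x = G x / (\<integral>y. G y \<partial>lborel)"
proof -
  define W where "W = (\<integral>\<theta>. exp (l \<theta>) * \<pi> \<theta> \<partial>lborel)"
  have wint: "integrable lborel (\<lambda>\<theta>. exp (l \<theta>) * \<pi> \<theta>)"
  proof (rule Bochner_Integration.integrable_bound)
    show "integrable lborel (\<lambda>\<theta>. exp (l a) * \<pi> \<theta>)" using \<pi>int by simp
    show "AE x in lborel. norm (exp (l x) * \<pi> x) \<le> norm (exp (l a) * \<pi> x)"
      using max \<pi>pos by (intro AE_I2) (simp add: abs_mult less_imp_le mult_right_mono)
  qed simp
  have W: "(\<integral>\<^sup>+\<theta>. w \<theta> \<partial>lborel) = ennreal W"
    unfolding w_def W_def using wint \<pi>pos by (intro nn_integral_eq_integral) (auto simp: less_imp_le)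
  have Wpos: "0 < W"
    unfolding W_def using \<pi>pos by (intro integral_lborel_pos wint) simp
  have GI: "(\<integral>y. G y \<partial>lborel) = exp (- l a) * r ^ DIM('a) * W"
  proof -
    have "(\<lambda>\<theta>. exp (l \<theta>) * \<pi> \<theta>) \<in> borel_measurable borel" "inverse r \<noteq> 0" using r by auto
    note aff = integral_lborel_affine[OF this, of a]
    have "(\<integral>y. G y \<partial>lborel) = (\<integral>x. exp (- l a) * (exp (l (a + inverse r *\<^sub>R x)) * \<pi> (a + inverse r *\<^sub>R x)) \<partial>lborel)"
      unfolding G_def by (simp add: exp_diff exp_minus field_simps)
    also have "\<dots> = exp (- l a) * (r ^ DIM('a) * W)"
      using aff r by (simp add: W_def power_inverse field_simps)
    finally show ?thesis by simp
  qed
  have "AE x in lborel. ennreal (q x) = ennreal (inverse r ^ DIM('a)) * (w (a + x /\<^sub>R r) / (\<integral>\<^sup>+\<theta>'. w \<theta>' \<partial>lborel))"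
    by (rule distributed_scaled_density[OF _ r d]) (simp add: w_def)
  then show ?thesis
  proof eventually_elim
    case (elim x)
    have "ennreal (q x) = ennreal (inverse r ^ DIM('a) * (exp (l (a + x /\<^sub>R r)) * \<pi> (a + x /\<^sub>R r) / W))"
      unfolding elim W unfolding w_def using Wpos r \<pi>pos[of "a + x /\<^sub>R r"]
      by (simp add: divide_ennreal ennreal_mult'[symmetric])
    then have "q x = inverse r ^ DIM('a) * (exp (l (a + x /\<^sub>R r)) * \<pi> (a + x /\<^sub>R r) / W)"
      using qnn[of x] Wpos r less_imp_le[OF \<pi>pos] by (subst (asm) ennreal_inj) auto
    also have "\<dots> = G x / (\<integral>y. G y \<partial>lborel)"
      unfolding GI unfolding G_def using r Wpos by (simp add: exp_diff exp_minus field_simps)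
    finally show ?case .
  qed
qed

section \<open>The logistic model on a network\<close>

text \<open>A function of one data pair, so that the law of large numbers applies to it as it
  stands.\<close>

definition logit_loglik :: "real ^ 'p \<Rightarrow> (real ^ 'p) \<times> real \<Rightarrow> real" where
  "logit_loglik \<theta> = (\<lambda>(x, y). y * (\<theta> \<bullet> x) - log_partition (\<theta> \<bullet> x))"

lemma ln_logistic_lik: "ln (logistic_lik \<theta> y x) = logit_loglik \<theta> (x, y)"
  by (simp add: logistic_lik_def logit_loglik_def)

lemma borel_measurable_logit_loglik [measurable]:
  "logit_loglik \<theta> \<in> borel_measurable borel" "(\<lambda>\<theta>. logit_loglik \<theta> d) \<in> borel_measurable borel"
proof -
  have "(\<lambda>(x, y). y * (\<theta> \<bullet> x) - log_partition (\<theta> \<bullet> x)) \<in> borel_measurable (borel \<Otimes>\<^sub>M borel)"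
    by measurable
  then show "logit_loglik \<theta> \<in> borel_measurable borel" unfolding logit_loglik_def by (simp add: borel_prod)
  show "(\<lambda>\<theta>. logit_loglik \<theta> d) \<in> borel_measurable borel"
    unfolding logit_loglik_def by (cases d) simp
qed

text \<open>The response contributes the slope |y|, and \<open>log_partition\<close> has slopes
  between 0 and 1.\<close>

lemma logit_loglik_lipschitz:
  "\<bar>logit_loglik \<theta> d - logit_loglik \<theta>' d\<bar> \<le> (\<bar>snd d\<bar> + 1) * norm (fst d) * norm (\<theta> - \<theta>')"
proof -
  obtain x y where d: "d = (x, y)" by (cases d)
  have "\<bar>logit_loglik \<theta> d - logit_loglik \<theta>' d\<bar> \<le> \<bar>y * ((\<theta> - \<theta>') \<bullet> x)\<bar> + \<bar>log_partition (\<theta>' \<bullet> x) - log_partition (\<theta> \<bullet> x)\<bar>"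
    by (simp add: d logit_loglik_def inner_diff_left algebra_simps)
  also have "\<dots> \<le> \<bar>y\<bar> * \<bar>(\<theta> - \<theta>') \<bullet> x\<bar> + \<bar>(\<theta> - \<theta>') \<bullet> x\<bar>"
    using log_partition_lipschitz[of "\<theta>' \<bullet> x" "\<theta> \<bullet> x"] by (simp add: abs_mult inner_diff_left abs_minus_commute)
  also have "\<dots> = (\<bar>y\<bar> + 1) * \<bar>(\<theta> - \<theta>') \<bullet> x\<bar>" by (simp add: algebra_simps)
  also have "\<dots> \<le> (\<bar>y\<bar> + 1) * (norm (\<theta> - \<theta>') * norm x)"
    by (intro mult_left_mono Cauchy_Schwarz_ineq2) auto
  finally show ?thesis by (simp add: d mult_ac)
qed

lemma concave_on_logit_loglik:
  fixes d :: "(real ^ 'p) \<times> real"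
  shows "concave_on UNIV (\<lambda>\<theta>. logit_loglik \<theta> d)"
proof -
  obtain x y where d: "d = (x, y)" by (cases d)
  show ?thesis
    unfolding concave_on_iff
  proof (intro conjI ballI allI impI)
    fix a b :: "real^'p" and u v :: real assume uv: "0 \<le> u" "0 \<le> v" "u + v = 1"
    have "log_partition ((u *\<^sub>R a + v *\<^sub>R b) \<bullet> x) \<le> u * log_partition (a \<bullet> x) + v * log_partition (b \<bullet> x)"
      using convex_on_log_partition uv by (simp add: convex_on_def inner_add_left)
    then show "u * logit_loglik a d + v * logit_loglik b d \<le> logit_loglik (u *\<^sub>R a + v *\<^sub>R b) d"
      by (simp add: d logit_loglik_def inner_add_left algebra_simps)
  qed simp
qed

lemma concave_on_sum_logit_loglik:
  assumes "\<And>k. k \<in> K \<Longrightarrow> 0 \<le> a k"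
  shows "concave_on UNIV (\<lambda>\<theta>. \<Sum>k\<in>K. a k * logit_loglik \<theta> (d k))"
  using assms
proof (induction K rule: infinite_finite_induct)
  case (insert k K)
  then show ?case
    by (auto intro!: concave_on_add concave_on_cmul concave_on_logit_loglik)
qed (auto simp: concave_on_const)

text \<open>The gradient vanishes at the maximizer \<theta>h, so only second order and remainder
  survive. The second-order weight is then moved from \<theta>h to \<theta>0, which produces the
  term with \<open>norm (\<theta>h - \<theta>0)\<close>.\<close>

lemma logit_loglik_quadratic_expansion:
  fixes x :: "'k \<Rightarrow> real ^ 'p" and y a :: "'k \<Rightarrow> real" and K :: "'k set"
  defines "l \<equiv> \<lambda>\<theta>. \<Sum>k\<in>K. a k * logit_loglik \<theta> (x k, y k)"
  assumes a: "\<And>k. k \<in> K \<Longrightarrow> 0 \<le> a k" and max: "\<And>\<theta>. l \<theta> \<le> l \<theta>h"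
  shows "\<bar>l (\<theta>h + h) - l \<theta>h + (\<Sum>k\<in>K. a k * (logistic_weight (\<theta>0 \<bullet> x k) * (h \<bullet> x k)\<^sup>2)) / 2\<bar>
     \<le> (\<Sum>k\<in>K. a k * norm (x k) ^ 3) * (norm h ^ 3 + norm (\<theta>h - \<theta>0) * (norm h)\<^sup>2)"
proof -
  define \<eta> where "\<eta> k = \<theta>h \<bullet> x k" for k
  define s where "s k = h \<bullet> x k" for k
  \<comment> \<open>The directional derivative along \<open>h\<close>, which is 0 by Fermat's rule
    at a maximum.\<close>
  have grad: "(\<Sum>k\<in>K. a k * ((y k - sigmoid (\<eta> k)) * s k)) = 0"
  proof -
    have "((\<lambda>u. l (\<theta>h + u *\<^sub>R h)) has_real_derivative (\<Sum>k\<in>K. a k * ((y k - sigmoid (\<eta> k)) * s k))) (at 0)"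
    proof -
      have "((\<lambda>u. \<Sum>k\<in>K. a k * (y k * (\<eta> k + u * s k) - log_partition (\<eta> k + u * s k)))
        has_real_derivative (\<Sum>k\<in>K. a k * ((y k - sigmoid (\<eta> k)) * s k))) (at 0)"
        by (auto intro!: derivative_eq_intros DERIV_chain2[OF DERIV_log_partition] simp: algebra_simps)
      then show ?thesis
        by (simp add: l_def logit_loglik_def inner_add_left \<eta>_def s_def)
    qed
    then show ?thesis
      by (rule DERIV_local_max[of _ _ _ 1]) (use max in auto)
  qed
  have remainder: "\<bar>logit_loglik (\<theta>h + h) (x k, y k) - logit_loglik \<theta>h (x k, y k) - (y k - sigmoid (\<eta> k)) * s k
      + logistic_weight (\<theta>0 \<bullet> x k) / 2 * (s k)\<^sup>2\<bar>
      \<le> norm (x k) ^ 3 * (norm h ^ 3 + norm (\<theta>h - \<theta>0) * (norm h)\<^sup>2)" for k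
  proof -
    have s: "\<bar>s k\<bar> \<le> norm h * norm (x k)" unfolding s_def by (rule Cauchy_Schwarz_ineq2)
    have d: "\<bar>\<eta> k - \<theta>0 \<bullet> x k\<bar> \<le> norm (\<theta>h - \<theta>0) * norm (x k)"
      unfolding \<eta>_def inner_diff_left[symmetric] by (rule Cauchy_Schwarz_ineq2)
    \<comment> \<open>\<open>A\<close> is the Taylor remainder at the maximizer, \<open>B\<close>
      the cost of evaluating the weight at the true parameter.\<close>
    define A where "A = log_partition (\<eta> k + s k) - log_partition (\<eta> k) - sigmoid (\<eta> k) * s k - logistic_weight (\<eta> k) / 2 * (s k)\<^sup>2"
    define B where "B = (logistic_weight (\<theta>0 \<bullet> x k) - logistic_weight (\<eta> k)) / 2 * (s k)\<^sup>2"
    have "logit_loglik (\<theta>h + h) (x k, y k) - logit_loglik \<theta>h (x k, y k) - (y k - sigmoid (\<eta> k)) * s k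
      + logistic_weight (\<theta>0 \<bullet> x k) / 2 * (s k)\<^sup>2 = B - A"
      unfolding A_def B_def logit_loglik_def by (simp add: \<eta>_def s_def inner_add_left field_simps)
    moreover have "\<bar>A\<bar> \<le> \<bar>s k\<bar> ^ 3"
      using log_partition_taylor[of "\<eta> k + s k" "\<eta> k"] by (simp add: A_def)
    moreover have "\<bar>s k\<bar> ^ 3 \<le> (norm h * norm (x k)) ^ 3" using s by (intro power_mono) auto
    moreover have "\<bar>B\<bar> \<le> norm (\<theta>h - \<theta>0) * norm (x k) * (norm h * norm (x k))\<^sup>2"
    proof -
      have "\<bar>B\<bar> = \<bar>logistic_weight (\<theta>0 \<bullet> x k) - logistic_weight (\<eta> k)\<bar> / 2 * \<bar>s k\<bar>\<^sup>2"
        by (simp add: B_def abs_mult)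
      also have "\<dots> \<le> norm (\<theta>h - \<theta>0) * norm (x k) * (norm h * norm (x k))\<^sup>2"
      proof (intro mult_mono power_mono s)
        show "\<bar>logistic_weight (\<theta>0 \<bullet> x k) - logistic_weight (\<eta> k)\<bar> / 2 \<le> norm (\<theta>h - \<theta>0) * norm (x k)"
        proof -
          have "\<bar>logistic_weight (\<theta>0 \<bullet> x k) - logistic_weight (\<eta> k)\<bar> \<le> norm (\<theta>h - \<theta>0) * norm (x k)"
            using logistic_weight_lipschitz[of "\<theta>0 \<bullet> x k" "\<eta> k"] d by (metis abs_minus_commute order_trans)
          then show ?thesis by simp
        qed
      qed auto
      finally show ?thesis .
    qed
    moreover have "(norm h * norm (x k)) ^ 3 + norm (\<theta>h - \<theta>0) * norm (x k) * (norm h * norm (x k))\<^sup>2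
      = norm (x k) ^ 3 * (norm h ^ 3 + norm (\<theta>h - \<theta>0) * (norm h)\<^sup>2)"
      by (simp add: power_mult_distrib power2_eq_square power3_eq_cube algebra_simps)
    ultimately show ?thesis by linarith
  qed
  have "l (\<theta>h + h) - l \<theta>h + (\<Sum>k\<in>K. a k * (logistic_weight (\<theta>0 \<bullet> x k) * (h \<bullet> x k)\<^sup>2)) / 2
    = l (\<theta>h + h) - l \<theta>h - (\<Sum>k\<in>K. a k * ((y k - sigmoid (\<eta> k)) * s k)) + (\<Sum>k\<in>K. a k * (logistic_weight (\<theta>0 \<bullet> x k) * (h \<bullet> x k)\<^sup>2)) / 2"
    unfolding grad by simp
  also have "\<dots> = (\<Sum>k\<in>K. a k * (logit_loglik (\<theta>h + h) (x k, y k) - logit_loglik \<theta>h (x k, y k) - (y k - sigmoid (\<eta> k)) * s k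
      + logistic_weight (\<theta>0 \<bullet> x k) / 2 * (s k)\<^sup>2))"
    unfolding l_def s_def
    by (simp add: sum_subtractf[symmetric] sum.distrib[symmetric] sum_divide_distrib ring_distribs right_diff_distrib)
  also have "\<bar>\<dots>\<bar> \<le> (\<Sum>k\<in>K. a k * (norm (x k) ^ 3 * (norm h ^ 3 + norm (\<theta>h - \<theta>0) * (norm h)\<^sup>2)))"
    by (rule order_trans[OF sum_abs], rule sum_mono) (use remainder a in \<open>auto simp: abs_mult intro!: mult_left_mono\<close>)
  also have "\<dots> = (\<Sum>k\<in>K. a k * norm (x k) ^ 3) * (norm h ^ 3 + norm (\<theta>h - \<theta>0) * (norm h)\<^sup>2)"
    by (simp add: sum_distrib_right mult.assoc)
  finally show ?thesis .
qed

section \<open>Network weights and averages over all agents and times\<close>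

lemma row_stochastic_matpow:
  assumes "row_stochastic A"
  shows "row_stochastic (matpow A n)"
proof (induction n)
  case 0
  have "(\<Sum>j\<in>UNIV. (mat 1 :: real^'a^'a) $ i $ j) = 1" for i by (simp add: mat_def)
  then show ?case by (simp add: row_stochastic_def mat_def)
next
  case (Suc n)
  let ?B = "matpow A n"
  have A: "\<And>i j. 0 \<le> A $ i $ j" "\<And>i. (\<Sum>j\<in>UNIV. A $ i $ j) = 1"
    and B: "\<And>i j. 0 \<le> ?B $ i $ j" "\<And>i. (\<Sum>j\<in>UNIV. ?B $ i $ j) = 1"
    using assms Suc by (auto simp: row_stochastic_def)
  have "(\<Sum>j\<in>UNIV. (A ** ?B) $ i $ j) = 1" for i
  proof -
    have "(\<Sum>j\<in>UNIV. (A ** ?B) $ i $ j) = (\<Sum>j\<in>UNIV. \<Sum>k\<in>UNIV. A $ i $ k * ?B $ k $ j)"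
      by (simp add: matrix_matrix_mult_def)
    also have "\<dots> = (\<Sum>k\<in>UNIV. A $ i $ k * (\<Sum>j\<in>UNIV. ?B $ k $ j))"
      by (subst sum.swap) (simp add: sum_distrib_left)
    finally show ?thesis using A B by simp
  qed
  moreover have "0 \<le> (A ** ?B) $ i $ j" for i j
    using A B by (simp add: matrix_matrix_mult_def sum_nonneg)
  ultimately show ?case by (simp add: row_stochastic_def)
qed

lemma row_stochastic_le_1:
  assumes "row_stochastic A"
  shows "A $ i $ j \<le> 1"
proof -
  have "A $ i $ j \<le> (\<Sum>j\<in>UNIV. A $ i $ j)"
    using assms by (intro member_le_sum) (auto simp: row_stochastic_def)
  then show ?thesis using assms by (simp add: row_stochastic_def)
qed

definition agent_loglik ::
  "real ^ 'm ^ 'm \<Rightarrow> (nat \<Rightarrow> 'm \<Rightarrow> 'w \<Rightarrow> real ^ 'p) \<Rightarrow> (nat \<Rightarrow> 'm \<Rightarrow> 'w \<Rightarrow> real)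
     \<Rightarrow> nat \<Rightarrow> 'm \<Rightarrow> 'w \<Rightarrow> real ^ 'p \<Rightarrow> real" where
  "agent_loglik A X Y t j \<omega> \<theta> = \<theta> \<bullet> T_stat A X Y t j \<omega> - B_fun A X t j \<omega> \<theta>"

text \<open>The common exponent of \<open>mle\<close> and \<open>posterior\<close> becomes a
  weighted sum over single data pairs.\<close>

lemma agent_loglik_eq:
  "agent_loglik A X Y t j \<omega> \<theta> =
     (\<Sum>(k, i)\<in>{1..t} \<times> UNIV. matpow A (t - k) $ j $ i * logit_loglik \<theta> (X k i \<omega>, Y k i \<omega>))"
  unfolding agent_loglik_def T_stat_def B_fun_def logit_loglik_def
  by (simp add: inner_sum_right sum_subtractf[symmetric] sum.cartesian_product[symmetric] right_diff_distrib mult.assoc)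

text \<open>One pair, at (\<open>k1\<close>, \<open>i1\<close>), represents the common law; all
  moments are taken there. The response probability already appears as the sigmoid of the linear
  predictor.\<close>

locale logistic_network = prob_space M for M :: "'w measure" +
  fixes X :: "nat \<Rightarrow> 'm::finite \<Rightarrow> 'w \<Rightarrow> real ^ 'p" and Y :: "nat \<Rightarrow> 'm \<Rightarrow> 'w \<Rightarrow> real"
    and \<theta>0 :: "real ^ 'p" and A :: "real ^ 'm ^ 'm" and k1 :: nat and i1 :: 'm
  assumes k1: "1 \<le> k1" and indep: "indep_vars (\<lambda>_. borel) (\<lambda>(k, i) \<omega>. (X k i \<omega>, Y k i \<omega>)) ({1..} \<times> UNIV)"
    and ident_distr: "\<And>k i. k \<ge> 1 \<Longrightarrow>
          distr M borel (\<lambda>\<omega>. (X k i \<omega>, Y k i \<omega>)) = distr M borel (\<lambda>\<omega>. (X k1 i1 \<omega>, Y k1 i1 \<omega>))"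
    and binary: "\<And>\<omega>. \<omega> \<in> space M \<Longrightarrow> Y k1 i1 \<omega> \<in> {0, 1}"
    and cond_exp: "AE \<omega> in M. real_cond_exp M (vimage_algebra (space M) (X k1 i1) borel)
                       (\<lambda>\<omega>'. indicator {1} (Y k1 i1 \<omega>')) \<omega> = sigmoid (\<theta>0 \<bullet> X k1 i1 \<omega>)"
    and stochastic: "row_stochastic A"
    and loglik_finite: "\<And>\<theta>. integrable M (\<lambda>\<omega>. \<bar>ln (logistic_lik \<theta> (Y k1 i1 \<omega>) (X k1 i1 \<omega>))\<bar>)"
begin

lemma pair_measurable:
  "k \<ge> 1 \<Longrightarrow> (\<lambda>\<omega>. (X k i \<omega>, Y k i \<omega>)) \<in> borel_measurable M"
  using indep by (auto simp: indep_vars_def)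

lemma X_measurable [measurable]: "X k1 i1 \<in> borel_measurable M"
  and Y_measurable [measurable]: "Y k1 i1 \<in> borel_measurable M"
proof -
  have "(\<lambda>\<omega>. (X k1 i1 \<omega>, Y k1 i1 \<omega>)) \<in> measurable M (borel \<Otimes>\<^sub>M borel)"
    using pair_measurable[of k1 i1] k1 by (simp add: borel_prod)
  from measurable_compose[OF this measurable_fst] measurable_compose[OF this measurable_snd]
  show "X k1 i1 \<in> borel_measurable M" "Y k1 i1 \<in> borel_measurable M" by simp_all
qed

lemma matpow_weights:
  "0 \<le> matpow A n $ j $ i" "matpow A n $ j $ i \<le> 1" "(\<Sum>i\<in>UNIV. matpow A n $ j $ i) = 1"
  using row_stochastic_matpow[OF stochastic, of n] row_stochastic_le_1[OF row_stochastic_matpow[OF stochastic, of n]]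
  by (auto simp: row_stochastic_def)

text \<open>Stated for general weights of total mass t since it is used twice: with the powers of
  \<open>A\<close>, and with the constant 1/m that occurs in \<open>V_hat\<close>.\<close>

lemma law_of_large_numbers:
  fixes c :: "nat \<Rightarrow> nat \<Rightarrow> 'm \<Rightarrow> real"
  assumes \<phi>: "\<phi> \<in> borel_measurable borel" and int: "integrable M (\<lambda>\<omega>. \<phi> (X k1 i1 \<omega>, Y k1 i1 \<omega>))"
    and c: "\<And>t k i. 0 \<le> c t k i" "\<And>t k i. c t k i \<le> 1" "\<And>t. (\<Sum>k=1..t. \<Sum>i\<in>UNIV. c t k i) = real t"
  shows "((\<lambda>(t, \<omega>). (\<Sum>(k, i)\<in>{1..t} \<times> UNIV. c t k i * \<phi> (X k i \<omega>, Y k i \<omega>)) / real t)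
    \<longlongrightarrow> expectation (\<lambda>\<omega>. \<phi> (X k1 i1 \<omega>, Y k1 i1 \<omega>))) (prob_filter M)"
proof -
  let ?D = "\<lambda>(k, i) \<omega>. (X k i \<omega>, Y k i \<omega>)"
  have "((\<lambda>(t, \<omega>). \<Sum>p\<in>{1..t} \<times> UNIV. (case p of (k, i) \<Rightarrow> c t k i / real t) * \<phi> (?D p \<omega>))
    \<longlongrightarrow> expectation (\<lambda>\<omega>. \<phi> (?D (k1, i1) \<omega>))) (prob_filter M)"
  proof (rule weighted_law_of_large_numbers[OF indep])
    show "distr M borel (?D p) = distr M borel (?D (k1, i1))" if "p \<in> {1..} \<times> UNIV" for p
      using that ident_distr by (cases p) simp
    show "(\<Sum>p\<in>{1..t} \<times> UNIV. case p of (k, i) \<Rightarrow> c t k i / real t) = 1" if "1 \<le> t" for t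
      using that c(3)[of t] by (simp add: sum.cartesian_product[symmetric] sum_divide_distrib[symmetric])
    show "0 \<le> (case p of (k, i) \<Rightarrow> c t k i / real t)" for t p
      using c(1) by (cases p) simp
    show "(case p of (k, i) \<Rightarrow> c t k i / real t) \<le> 1 / real t" for t p
      using c(2) by (cases p) (simp add: divide_right_mono)
    show "integrable M (\<lambda>\<omega>. \<phi> (?D (k1, i1) \<omega>))"
      using int by simp
    show "\<phi> \<in> borel_measurable borel" by (rule \<phi>)
    show "(k1, i1) \<in> {1..} \<times> UNIV" using k1 by simp
  qed (use \<phi> k1 in auto)
  moreover have "(\<Sum>p\<in>{1..t} \<times> UNIV. (case p of (k, i) \<Rightarrow> c t k i / real t) * \<phi> (?D p \<omega>))
    = (\<Sum>(k, i)\<in>{1..t} \<times> UNIV. c t k i * \<phi> (X k i \<omega>, Y k i \<omega>)) / real t" for t \<omega>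
    unfolding sum_divide_distrib by (intro sum.cong) auto
  ultimately show ?thesis by simp
qed

lemma law_of_large_numbers_matpow:
  assumes "\<phi> \<in> borel_measurable borel" and "integrable M (\<lambda>\<omega>. \<phi> (X k1 i1 \<omega>, Y k1 i1 \<omega>))"
  shows "((\<lambda>(t, \<omega>). (\<Sum>(k, i)\<in>{1..t} \<times> UNIV. matpow A (t - k) $ j $ i * \<phi> (X k i \<omega>, Y k i \<omega>)) / real t)
    \<longlongrightarrow> expectation (\<lambda>\<omega>. \<phi> (X k1 i1 \<omega>, Y k1 i1 \<omega>))) (prob_filter M)"
  using assms by (intro law_of_large_numbers) (simp_all add: matpow_weights)

section \<open>Identification of the true parameter and consistency of the maximizer\<close>

definition expected_loglik :: "real ^ 'p \<Rightarrow> real" where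
  "expected_loglik \<theta> = expectation (\<lambda>\<omega>. logit_loglik \<theta> (X k1 i1 \<omega>, Y k1 i1 \<omega>))"

lemma integrable_logit_loglik: "integrable M (\<lambda>\<omega>. logit_loglik \<theta> (X k1 i1 \<omega>, Y k1 i1 \<omega>))"
proof -
  have "(\<lambda>\<omega>. logit_loglik \<theta> (X k1 i1 \<omega>, Y k1 i1 \<omega>)) \<in> borel_measurable M"
    by (rule measurable_compose[OF pair_measurable borel_measurable_logit_loglik(1)]) (rule k1)
  then show ?thesis
    using loglik_finite[of \<theta>] by (simp add: ln_logistic_lik integrable_abs_iff)
qed

text \<open>The log-likelihoods at \<open>\<theta>\<close> and \<open>- \<theta>\<close> add up to at least \<open>\<bar>\<theta> \<bullet> x\<bar>\<close> in modulus, whatever the response.\<close>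

lemma integrable_inner_X: "integrable M (\<lambda>\<omega>. \<theta> \<bullet> X k1 i1 \<omega>)"
proof (rule Bochner_Integration.integrable_bound)
  show "integrable M (\<lambda>\<omega>. logit_loglik \<theta> (X k1 i1 \<omega>, Y k1 i1 \<omega>) + logit_loglik (- \<theta>) (X k1 i1 \<omega>, Y k1 i1 \<omega>))"
    by (intro Bochner_Integration.integrable_add integrable_logit_loglik)
  show "AE \<omega> in M. norm (\<theta> \<bullet> X k1 i1 \<omega>) \<le> norm (logit_loglik \<theta> (X k1 i1 \<omega>, Y k1 i1 \<omega>) + logit_loglik (- \<theta>) (X k1 i1 \<omega>, Y k1 i1 \<omega>))"
  proof (rule AE_I2)
    fix \<omega>
    show "norm (\<theta> \<bullet> X k1 i1 \<omega>) \<le> norm (logit_loglik \<theta> (X k1 i1 \<omega>, Y k1 i1 \<omega>) + logit_loglik (- \<theta>) (X k1 i1 \<omega>, Y k1 i1 \<omega>))"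
      using abs_le_log_partition[of "\<theta> \<bullet> X k1 i1 \<omega>"] by (simp add: logit_loglik_def)
  qed
qed simp

lemma integrable_norm_X: "integrable M (\<lambda>\<omega>. norm (X k1 i1 \<omega>))"
proof (rule Bochner_Integration.integrable_bound)
  have "integrable M (\<lambda>\<omega>. X k1 i1 \<omega> $ a)" for a
    using integrable_inner_X[of "axis a 1"] by (simp add: inner_axis')
  then show "integrable M (\<lambda>\<omega>. \<Sum>a\<in>UNIV. \<bar>X k1 i1 \<omega> $ a\<bar>)" by auto
  show "AE \<omega> in M. norm (norm (X k1 i1 \<omega>)) \<le> norm (\<Sum>a\<in>UNIV. \<bar>X k1 i1 \<omega> $ a\<bar>)"
    using norm_le_l1_cart by (intro AE_I2) (simp add: sum_nonneg)
qed simp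

lemma integrable_log_partition: "integrable M (\<lambda>\<omega>. log_partition (\<theta> \<bullet> X k1 i1 \<omega>))"
  and integrable_Y_inner_X: "integrable M (\<lambda>\<omega>. Y k1 i1 \<omega> * (\<theta> \<bullet> X k1 i1 \<omega>))"
  and integrable_sigmoid_inner_X: "integrable M (\<lambda>\<omega>. sigmoid (\<theta>0 \<bullet> X k1 i1 \<omega>) * (\<theta> \<bullet> X k1 i1 \<omega>))"
proof -
  show Y: "integrable M (\<lambda>\<omega>. Y k1 i1 \<omega> * (\<theta> \<bullet> X k1 i1 \<omega>))"
    by (rule Bochner_Integration.integrable_bound[OF integrable_inner_X[of \<theta>]])
       (auto dest!: binary intro!: AE_I2)
  have "integrable M (\<lambda>\<omega>. Y k1 i1 \<omega> * (\<theta> \<bullet> X k1 i1 \<omega>) - logit_loglik \<theta> (X k1 i1 \<omega>, Y k1 i1 \<omega>))"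
    using Y integrable_logit_loglik by (rule Bochner_Integration.integrable_diff)
  then show "integrable M (\<lambda>\<omega>. log_partition (\<theta> \<bullet> X k1 i1 \<omega>))"
    by (simp add: logit_loglik_def)
  show "integrable M (\<lambda>\<omega>. sigmoid (\<theta>0 \<bullet> X k1 i1 \<omega>) * (\<theta> \<bullet> X k1 i1 \<omega>))"
    by (rule Bochner_Integration.integrable_bound[OF integrable_inner_X[of \<theta>]])
       (use sigmoid_bounds in \<open>auto simp: abs_mult less_imp_le intro!: AE_I2 mult_left_le_one_le\<close>)
qed

text \<open>The linear predictor is measurable with respect to the covariate, so the response may be
  replaced by its conditional expectation.\<close>

lemma expectation_Y_inner_X:
  "expectation (\<lambda>\<omega>. Y k1 i1 \<omega> * (\<theta> \<bullet> X k1 i1 \<omega>)) = expectation (\<lambda>\<omega>. sigmoid (\<theta>0 \<bullet> X k1 i1 \<omega>) * (\<theta> \<bullet> X k1 i1 \<omega>))"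
proof -
  define F where "F = vimage_algebra (space M) (X k1 i1) borel"
  have sub: "subalgebra M F"
    unfolding subalgebra_def F_def by (simp add: sets_image_in_sets)
  interpret finite_measure_subalgebra M F by standard (rule sub)
  have XF[measurable]: "X k1 i1 \<in> borel_measurable F"
    unfolding F_def by (rule measurable_vimage_algebra1) simp
  \<comment> \<open>The model prescribes the conditional probability of the event Y = 1, and a
    binary response is the indicator of that event.\<close>
  have Yind: "Y k1 i1 \<omega> = indicator {1} (Y k1 i1 \<omega>)" if "\<omega> \<in> space M" for \<omega>
    using binary[OF that] by auto
  have "expectation (\<lambda>\<omega>. Y k1 i1 \<omega> * (\<theta> \<bullet> X k1 i1 \<omega>)) = expectation (\<lambda>\<omega>. (\<theta> \<bullet> X k1 i1 \<omega>) * indicator {1} (Y k1 i1 \<omega>))"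
    using Yind by (intro Bochner_Integration.integral_cong) (auto simp: mult.commute)
  also have "\<dots> = expectation (\<lambda>\<omega>. (\<theta> \<bullet> X k1 i1 \<omega>) * real_cond_exp M F (\<lambda>\<omega>'. indicator {1} (Y k1 i1 \<omega>')) \<omega>)"
  proof (rule real_cond_exp_intg(2)[symmetric])
    show "integrable M (\<lambda>\<omega>. (\<theta> \<bullet> X k1 i1 \<omega>) * indicator {1} (Y k1 i1 \<omega>))"
      by (rule Bochner_Integration.integrable_bound[OF integrable_inner_X[of \<theta>]]) (auto simp: indicator_def)
  qed measurable
  also have "\<dots> = expectation (\<lambda>\<omega>. sigmoid (\<theta>0 \<bullet> X k1 i1 \<omega>) * (\<theta> \<bullet> X k1 i1 \<omega>))"
  proof (rule integral_cong_AE)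
    show "AE \<omega> in M. (\<theta> \<bullet> X k1 i1 \<omega>) * real_cond_exp M F (\<lambda>\<omega>'. indicator {1} (Y k1 i1 \<omega>')) \<omega> = sigmoid (\<theta>0 \<bullet> X k1 i1 \<omega>) * (\<theta> \<bullet> X k1 i1 \<omega>)"
      using cond_exp unfolding F_def by eventually_elim (simp add: mult.commute)
  qed measurable
  finally show ?thesis .
qed

text \<open>The deficit is an expected Kullback-Leibler divergence, and this is positive unless the
  two linear predictors agree almost surely.\<close>

lemma expected_loglik_less:
  assumes "\<not> (AE \<omega> in M. \<theta> \<bullet> X k1 i1 \<omega> = \<theta>0 \<bullet> X k1 i1 \<omega>)"
  shows "expected_loglik \<theta> < expected_loglik \<theta>0"
proof -
  have L: "expected_loglik \<theta>' = expectation (\<lambda>\<omega>. sigmoid (\<theta>0 \<bullet> X k1 i1 \<omega>) * (\<theta>' \<bullet> X k1 i1 \<omega>)) - expectation (\<lambda>\<omega>. log_partition (\<theta>' \<bullet> X k1 i1 \<omega>))" for \<theta>'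
    unfolding expected_loglik_def logit_loglik_def expectation_Y_inner_X[symmetric] prod.case
    by (rule Bochner_Integration.integral_diff[OF integrable_Y_inner_X integrable_log_partition])
  \<comment> \<open>The Bregman divergence of \<open>log_partition\<close> between the two
    predictors, that is, the divergence of the two Bernoulli laws given the covariate.\<close>
  define D where "D \<omega> = log_partition (\<theta> \<bullet> X k1 i1 \<omega>) - log_partition (\<theta>0 \<bullet> X k1 i1 \<omega>)
    - (sigmoid (\<theta>0 \<bullet> X k1 i1 \<omega>) * (\<theta> \<bullet> X k1 i1 \<omega>) - sigmoid (\<theta>0 \<bullet> X k1 i1 \<omega>) * (\<theta>0 \<bullet> X k1 i1 \<omega>))" for \<omega>
  have Dint: "integrable M D"
    unfolding D_def[abs_def]
    by (intro Bochner_Integration.integrable_diff integrable_log_partition integrable_sigmoid_inner_X)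
  have ED: "expectation D = expected_loglik \<theta>0 - expected_loglik \<theta>"
    unfolding D_def[abs_def] L
    by (simp add: integrable_log_partition integrable_sigmoid_inner_X)
  have D0: "0 < D \<omega>" if "\<theta> \<bullet> X k1 i1 \<omega> \<noteq> \<theta>0 \<bullet> X k1 i1 \<omega>" for \<omega>
    using log_partition_gt_tangent[OF that[symmetric]] by (simp add: D_def algebra_simps)
  have Dnn: "0 \<le> D \<omega>" for \<omega>
    using D0[of \<omega>] by (cases "\<theta> \<bullet> X k1 i1 \<omega> = \<theta>0 \<bullet> X k1 i1 \<omega>") (auto simp: D_def)
  have "expectation D \<noteq> 0"
  proof
    assume "expectation D = 0"
    then have "AE \<omega> in M. D \<omega> = 0" using integral_nonneg_eq_0_iff_AE[OF Dint] Dnn by simp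
    then have "AE \<omega> in M. \<theta> \<bullet> X k1 i1 \<omega> = \<theta>0 \<bullet> X k1 i1 \<omega>"
      by eventually_elim (use D0 in \<open>force simp: less_le\<close>)
    with assms show False ..
  qed
  moreover have "0 \<le> expectation D" using Dnn by (intro Bochner_Integration.integral_nonneg)
  ultimately show ?thesis using ED by simp
qed

text \<open>Identifiability is phrased through linear predictors, a form that follows both from
  identifiability of the likelihood and from a nonsingular second-moment matrix.\<close>

lemma
  assumes ident: "\<And>\<theta>. (AE \<omega> in M. \<theta> \<bullet> X k1 i1 \<omega> = \<theta>0 \<bullet> X k1 i1 \<omega>) \<Longrightarrow> \<theta> = \<theta>0"
  shows mle_consistent: "((\<lambda>(t, \<omega>). mle A X Y t j \<omega>) \<longlongrightarrow> \<theta>0) (prob_filter M)"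
    and eventually_mle_maximizes:
      "\<forall>\<^sub>F (t, \<omega>) in prob_filter M. \<forall>\<theta>. agent_loglik A X Y t j \<omega> \<theta> \<le> agent_loglik A X Y t j \<omega> (mle A X Y t j \<omega>)"
proof -
  define f where "f = (\<lambda>(t, \<omega>) \<theta>. (\<Sum>(k, i)\<in>{1..t} \<times> UNIV. matpow A (t - k) $ j $ i * logit_loglik \<theta> (X k i \<omega>, Y k i \<omega>)) / real t)"
  define K where "K = (\<lambda>(t, \<omega>). (\<Sum>(k, i)\<in>{1..t} \<times> UNIV. matpow A (t - k) $ j $ i * ((\<bar>Y k i \<omega>\<bar> + 1) * norm (X k i \<omega>))) / real t)"
  have near: "\<forall>\<^sub>F z in prob_filter M. (\<exists>x. is_arg_max (f z) (\<lambda>_. True) x) \<and> (\<forall>x. is_arg_max (f z) (\<lambda>_. True) x \<longrightarrow> dist x \<theta>0 < e)"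
    if "e > 0" for e
  proof (rule eventually_concave_arg_max_near[OF _ _ _ _ _ that])
    show "concave_on UNIV (f z)" for z
    proof -
      obtain t \<omega> where z: "z = (t, \<omega>)" by (cases z)
      have "f z = (\<lambda>\<theta>. \<Sum>p\<in>{1..t} \<times> UNIV. (case p of (k, i) \<Rightarrow> matpow A (t - k) $ j $ i / real t) * logit_loglik \<theta> (case p of (k, i) \<Rightarrow> (X k i \<omega>, Y k i \<omega>)))"
        unfolding f_def z prod.case sum_divide_distrib by (intro ext sum.cong) auto
      then show ?thesis
        by (simp only:) (rule concave_on_sum_logit_loglik, auto simp: matpow_weights)
    qed
    show "\<bar>f z \<theta> - f z \<theta>'\<bar> \<le> K z * norm (\<theta> - \<theta>')" for z \<theta> \<theta>'
    proof -
      obtain t \<omega> where z: "z = (t, \<omega>)" by (cases z)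
      have "\<bar>f z \<theta> - f z \<theta>'\<bar> = \<bar>\<Sum>(k, i)\<in>{1..t} \<times> UNIV. matpow A (t - k) $ j $ i * (logit_loglik \<theta> (X k i \<omega>, Y k i \<omega>) - logit_loglik \<theta>' (X k i \<omega>, Y k i \<omega>))\<bar> / real t"
        by (simp add: f_def z case_prod_unfold sum_subtractf right_diff_distrib diff_divide_distrib[symmetric])
      also have "\<dots> \<le> (\<Sum>(k, i)\<in>{1..t} \<times> UNIV. matpow A (t - k) $ j $ i * ((\<bar>Y k i \<omega>\<bar> + 1) * norm (X k i \<omega>) * norm (\<theta> - \<theta>'))) / real t"
      proof (intro divide_right_mono order_trans[OF sum_abs] sum_mono)
        fix p assume "p \<in> {1..t} \<times> (UNIV :: 'm set)"
        show "\<bar>case p of (k, i) \<Rightarrow> matpow A (t - k) $ j $ i * (logit_loglik \<theta> (X k i \<omega>, Y k i \<omega>) - logit_loglik \<theta>' (X k i \<omega>, Y k i \<omega>))\<bar>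
          \<le> (case p of (k, i) \<Rightarrow> matpow A (t - k) $ j $ i * ((\<bar>Y k i \<omega>\<bar> + 1) * norm (X k i \<omega>) * norm (\<theta> - \<theta>')))"
        proof (cases p)
          case (Pair k i)
          show ?thesis
            using logit_loglik_lipschitz[of \<theta> "(X k i \<omega>, Y k i \<omega>)" \<theta>'] matpow_weights(1)[of "t - k" j i]
            by (simp add: Pair abs_mult mult_left_mono)
        qed
      qed simp
      also have "\<dots> = K z * norm (\<theta> - \<theta>')"
        by (simp add: K_def z sum_distrib_right case_prod_unfold mult.assoc)
      finally show ?thesis .
    qed
    show "(K \<longlongrightarrow> expectation (\<lambda>\<omega>. (\<bar>Y k1 i1 \<omega>\<bar> + 1) * norm (X k1 i1 \<omega>))) (prob_filter M)"
    proof -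
      have m: "(\<lambda>(x, y). (\<bar>y\<bar> + 1) * norm x) \<in> borel_measurable (borel :: ((real^'p) \<times> real) measure)"
        unfolding borel_prod[symmetric] by measurable
      \<comment> \<open>For binary responses the coefficient is at most 2, so the first moment of
        the covariate suffices.\<close>
      have "integrable M (\<lambda>\<omega>. (\<bar>Y k1 i1 \<omega>\<bar> + 1) * norm (X k1 i1 \<omega>))"
        by (rule Bochner_Integration.integrable_bound[OF integrable_mult_right[OF integrable_norm_X, of 2]])
           (auto dest!: binary intro!: AE_I2)
      then show ?thesis
        unfolding K_def using law_of_large_numbers_matpow[OF m, of j] by simp
    qed
    show "((\<lambda>z. f z \<theta>) \<longlongrightarrow> expected_loglik \<theta>) (prob_filter M)" for \<theta>
      unfolding f_def expected_loglik_def
      using law_of_large_numbers_matpow[OF borel_measurable_logit_loglik(1) integrable_logit_loglik, of j \<theta>]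
      by (simp add: case_prod_unfold)
    show "expected_loglik \<theta> < expected_loglik \<theta>0" if "\<theta> \<noteq> \<theta>0" for \<theta>
      using ident that by (intro expected_loglik_less) blast
  qed
  \<comment> \<open>\<open>mle\<close> is a choice among maximizers: existence makes it one of them,
    and closeness of all maximizers then covers it. At t = 0 the scaled function is identically 0,
    hence t \<ge> 1.\<close>
  have mle: "is_arg_max (agent_loglik A X Y t j \<omega>) (\<lambda>_. True) (mle A X Y t j \<omega>) \<and> dist (mle A X Y t j \<omega>) \<theta>0 < e"
    if "t \<ge> 1" "\<exists>x. is_arg_max (f (t, \<omega>)) (\<lambda>_. True) x" "\<forall>x. is_arg_max (f (t, \<omega>)) (\<lambda>_. True) x \<longrightarrow> dist x \<theta>0 < e" for t \<omega> e
  proof -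
    have "is_arg_max (f (t, \<omega>)) (\<lambda>_. True) = is_arg_max (agent_loglik A X Y t j \<omega>) (\<lambda>_. True)"
      using that(1) by (simp add: fun_eq_iff is_arg_max_def f_def agent_loglik_eq divide_less_cancel)
    moreover have "mle A X Y t j \<omega> = (SOME x. is_arg_max (agent_loglik A X Y t j \<omega>) (\<lambda>_. True) x)"
      unfolding mle_def arg_max_def agent_loglik_def[abs_def] ..
    ultimately show ?thesis using that(2,3) by (metis someI_ex)
  qed
  have ev: "\<forall>\<^sub>F (t, \<omega>) in prob_filter M. is_arg_max (agent_loglik A X Y t j \<omega>) (\<lambda>_. True) (mle A X Y t j \<omega>) \<and> dist (mle A X Y t j \<omega>) \<theta>0 < e"
    if "e > 0" for e
    using near[OF that] eventually_prob_filter_time[OF eventually_ge_at_top[of 1]]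
  proof eventually_elim
    case (elim z)
    then show ?case using mle[of "fst z" "snd z" e] by (auto simp: case_prod_unfold)
  qed
  show "((\<lambda>(t, \<omega>). mle A X Y t j \<omega>) \<longlongrightarrow> \<theta>0) (prob_filter M)"
  proof (rule tendstoI)
    fix e :: real assume "e > 0"
    from ev[OF this] show "\<forall>\<^sub>F z in prob_filter M. dist (case z of (t, \<omega>) \<Rightarrow> mle A X Y t j \<omega>) \<theta>0 < e"
      by eventually_elim auto
  qed
  show "\<forall>\<^sub>F (t, \<omega>) in prob_filter M. \<forall>\<theta>. agent_loglik A X Y t j \<omega> \<theta> \<le> agent_loglik A X Y t j \<omega> (mle A X Y t j \<omega>)"
    using ev[OF zero_less_one] by eventually_elim (auto simp: is_arg_max_def not_less)
qed

end

section \<open>Fisher information and the posterior limit\<close>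

lemma borel_measurable_vec_nth [measurable (raw)]:
  fixes f :: "'a \<Rightarrow> real ^ 'n"
  assumes "f \<in> borel_measurable M"
  shows "(\<lambda>x. f x $ a) \<in> borel_measurable M"
  by (rule measurable_compose[OF assms borel_measurable_continuous_onI]) (intro continuous_intros)

lemma inner_square_eq_sum:
  fixes h x :: "real ^ 'n"
  shows "(h \<bullet> x)\<^sup>2 = (\<Sum>a\<in>UNIV. \<Sum>b\<in>UNIV. h $ a * h $ b * (x $ a * x $ b))"
  by (simp add: inner_vec_def power2_eq_square sum_product mult_ac)

lemma quadratic_form_eq_sum:
  "h \<bullet> (A *v h) = (\<Sum>a\<in>UNIV. \<Sum>b\<in>UNIV. h $ a * h $ b * (A $ a $ b :: real))"
  by (simp add: inner_vec_def matrix_vector_mult_def sum_distrib_left mult_ac)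

lemma quadratic_form_weighted_gram:
  fixes x :: "'k \<Rightarrow> real ^ 'n"
  shows "h \<bullet> ((\<chi> a b. (\<Sum>k\<in>K. c k * (x k $ a * l k * x k $ b)) / t) *v h) = (\<Sum>k\<in>K. c k * (l k * (h \<bullet> x k)\<^sup>2)) / t"
proof -
  have "h \<bullet> ((\<chi> a b. (\<Sum>k\<in>K. c k * (x k $ a * l k * x k $ b)) / t) *v h)
    = (\<Sum>a\<in>UNIV. \<Sum>b\<in>UNIV. \<Sum>k\<in>K. c k * (l k * (h $ a * h $ b * (x k $ a * x k $ b))) / t)"
    unfolding quadratic_form_eq_sum
    by (simp add: sum_divide_distrib sum_distrib_left mult_ac)
  also have "\<dots> = (\<Sum>a\<in>UNIV. \<Sum>k\<in>K. \<Sum>b\<in>UNIV. c k * (l k * (h $ a * h $ b * (x k $ a * x k $ b))) / t)"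
    by (intro sum.cong refl sum.swap)
  also have "\<dots> = (\<Sum>k\<in>K. \<Sum>a\<in>UNIV. \<Sum>b\<in>UNIV. c k * (l k * (h $ a * h $ b * (x k $ a * x k $ b))) / t)"
    by (rule sum.swap)
  also have "\<dots> = (\<Sum>k\<in>K. c k * (l k * (h \<bullet> x k)\<^sup>2)) / t"
    unfolding inner_square_eq_sum by (simp add: sum_divide_distrib sum_distrib_left)
  finally show ?thesis .
qed

lemma transpose_V_hat: "transpose (V_hat X \<theta> t \<omega>) = V_hat X \<theta> t \<omega>"
  by (simp add: V_hat_def transpose_def vec_eq_iff mult_ac)

context logistic_network
begin

context
  assumes int2: "\<And>a b. integrable M (\<lambda>\<omega>. X k1 i1 \<omega> $ a * X k1 i1 \<omega> $ b)"
    and inv: "invertible (\<chi> a b. \<integral>\<omega>. X k1 i1 \<omega> $ a * X k1 i1 \<omega> $ b \<partial>M)"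
    and int3: "\<And>a b c. integrable M (\<lambda>\<omega>. \<bar>X k1 i1 \<omega> $ a * X k1 i1 \<omega> $ b * X k1 i1 \<omega> $ c\<bar>)"
begin

text \<open>Such a \<open>v\<close> lies in the kernel of the second-moment matrix, because E[X X^T]
  v = E[X (v \<bullet> X)]. For \<open>v\<close> a difference of parameters this is
  identifiability.\<close>

lemma degenerate_direction_eq_0:
  assumes "AE \<omega> in M. v \<bullet> X k1 i1 \<omega> = 0"
  shows "v = 0"
proof -
  define S where "S = (\<chi> a b. \<integral>\<omega>. X k1 i1 \<omega> $ a * X k1 i1 \<omega> $ b \<partial>M)"
  have "S *v v = 0"
  proof (intro iffD2[OF vec_eq_iff] allI)
    fix a
    have "(S *v v) $ a = (\<Sum>b\<in>UNIV. (\<integral>\<omega>. X k1 i1 \<omega> $ a * X k1 i1 \<omega> $ b * v $ b \<partial>M))"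
      by (simp add: S_def matrix_vector_mult_def)
    also have "\<dots> = (\<integral>\<omega>. (\<Sum>b\<in>UNIV. X k1 i1 \<omega> $ a * X k1 i1 \<omega> $ b * v $ b) \<partial>M)"
      using int2 by (intro Bochner_Integration.integral_sum[symmetric]) auto
    also have "\<dots> = (\<integral>\<omega>. 0 \<partial>M)"
    proof (rule integral_cong_AE)
      show "AE \<omega> in M. (\<Sum>b\<in>UNIV. X k1 i1 \<omega> $ a * X k1 i1 \<omega> $ b * v $ b) = 0"
        using assms
      proof eventually_elim
        case (elim \<omega>)
        have "(\<Sum>b\<in>UNIV. X k1 i1 \<omega> $ a * X k1 i1 \<omega> $ b * v $ b) = X k1 i1 \<omega> $ a * (v \<bullet> X k1 i1 \<omega>)"
          by (simp add: inner_vec_def sum_distrib_left mult_ac)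
        then show ?case using elim by simp
      qed
    qed measurable
    finally show "(S *v v) $ a = 0 $ a" by simp
  qed
  then have "matrix_inv S *v (S *v v) = 0" by simp
  then show ?thesis
    using matrix_inv_mult(2)[OF inv] by (simp add: matrix_vector_mul_assoc S_def)
qed

definition fisher_information :: "real ^ 'p ^ 'p" where
  "fisher_information = (\<chi> a b. \<integral>\<omega>. X k1 i1 \<omega> $ a * logistic_weight (\<theta>0 \<bullet> X k1 i1 \<omega>) * X k1 i1 \<omega> $ b \<partial>M)"

lemma integrable_information: "integrable M (\<lambda>\<omega>. X k1 i1 \<omega> $ a * logistic_weight (\<theta>0 \<bullet> X k1 i1 \<omega>) * X k1 i1 \<omega> $ b)"
proof (rule Bochner_Integration.integrable_bound[OF int2[of a b]])
  show "AE \<omega> in M. norm (X k1 i1 \<omega> $ a * logistic_weight (\<theta>0 \<bullet> X k1 i1 \<omega>) * X k1 i1 \<omega> $ b) \<le> norm (X k1 i1 \<omega> $ a * X k1 i1 \<omega> $ b)"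
  proof (rule AE_I2)
    fix \<omega>
    have "\<bar>X k1 i1 \<omega> $ a * X k1 i1 \<omega> $ b\<bar> * logistic_weight (\<theta>0 \<bullet> X k1 i1 \<omega>) \<le> \<bar>X k1 i1 \<omega> $ a * X k1 i1 \<omega> $ b\<bar> * 1"
      by (intro mult_left_mono logistic_weight_le_1) simp
    then show "norm (X k1 i1 \<omega> $ a * logistic_weight (\<theta>0 \<bullet> X k1 i1 \<omega>) * X k1 i1 \<omega> $ b) \<le> norm (X k1 i1 \<omega> $ a * X k1 i1 \<omega> $ b)"
      using logistic_weight_pos[of "\<theta>0 \<bullet> X k1 i1 \<omega>"] by (simp add: abs_mult mult_ac)
  qed
qed measurable

lemma transpose_fisher_information: "transpose fisher_information = fisher_information"
  by (simp add: fisher_information_def transpose_def vec_eq_iff mult_ac)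

text \<open>The logistic weight is positive everywhere, so a vanishing form would give a degenerate
  direction of the covariate.\<close>

lemma fisher_information_pos_def:
  assumes "h \<noteq> 0"
  shows "0 < h \<bullet> (fisher_information *v h)"
proof -
  define D where "D \<omega> = (\<Sum>a\<in>UNIV. \<Sum>b\<in>UNIV. h $ a * h $ b * (X k1 i1 \<omega> $ a * logistic_weight (\<theta>0 \<bullet> X k1 i1 \<omega>) * X k1 i1 \<omega> $ b))" for \<omega>
  have Dint: "integrable M D"
    unfolding D_def by (intro Bochner_Integration.integrable_sum integrable_mult_right integrable_information)
  have D: "D \<omega> = logistic_weight (\<theta>0 \<bullet> X k1 i1 \<omega>) * (h \<bullet> X k1 i1 \<omega>)\<^sup>2" for \<omega>
    unfolding D_def inner_square_eq_sum by (simp add: sum_distrib_left mult_ac)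
  have eq: "h \<bullet> (fisher_information *v h) = (\<integral>\<omega>. D \<omega> \<partial>M)"
    unfolding quadratic_form_eq_sum D_def fisher_information_def
    by (simp add: Bochner_Integration.integral_sum integrable_information)
  have Dnn: "0 \<le> D \<omega>" for \<omega>
    unfolding D using logistic_weight_pos[of "\<theta>0 \<bullet> X k1 i1 \<omega>"] by simp
  have "(\<integral>\<omega>. D \<omega> \<partial>M) \<noteq> 0"
  proof
    assume "(\<integral>\<omega>. D \<omega> \<partial>M) = 0"
    then have "AE \<omega> in M. D \<omega> = 0" using integral_nonneg_eq_0_iff_AE[OF Dint] Dnn by simp
    then have "AE \<omega> in M. h \<bullet> X k1 i1 \<omega> = 0"
    proof eventually_elim
      case (elim \<omega>)
      then show ?case using logistic_weight_pos[of "\<theta>0 \<bullet> X k1 i1 \<omega>"] by (simp add: D)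
    qed
    with assms degenerate_direction_eq_0 show False by blast
  qed
  moreover have "0 \<le> (\<integral>\<omega>. D \<omega> \<partial>M)" using Dnn by (intro Bochner_Integration.integral_nonneg)
  ultimately show ?thesis using eq by simp
qed

text \<open>The norm is at most the sum of the absolute coordinates, whose cube expands into the
  assumed mixed third moments.\<close>

lemma integrable_norm_X_cube: "integrable M (\<lambda>\<omega>. norm (X k1 i1 \<omega>) ^ 3)"
proof (rule Bochner_Integration.integrable_bound)
  let ?B = "\<lambda>\<omega>. \<Sum>a\<in>UNIV. \<Sum>b\<in>UNIV. \<Sum>c\<in>UNIV. \<bar>X k1 i1 \<omega> $ a * X k1 i1 \<omega> $ b * X k1 i1 \<omega> $ c\<bar>"
  show "integrable M ?B" by (intro Bochner_Integration.integrable_sum int3)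
  show "AE \<omega> in M. norm (norm (X k1 i1 \<omega>) ^ 3) \<le> norm (?B \<omega>)"
  proof (rule AE_I2)
    fix \<omega>
    have "norm (X k1 i1 \<omega>) ^ 3 \<le> (\<Sum>a\<in>UNIV. \<bar>X k1 i1 \<omega> $ a\<bar>) ^ 3"
      by (intro power_mono norm_le_l1_cart) simp
    also have "\<dots> = ?B \<omega>"
      by (simp add: power3_eq_cube sum_product sum_distrib_left sum_distrib_right abs_mult mult_ac)
    finally show "norm (norm (X k1 i1 \<omega>) ^ 3) \<le> norm (?B \<omega>)" by simp
  qed
qed measurable

lemma tendsto_V_hat: "((\<lambda>(t, \<omega>). V_hat X \<theta>0 t \<omega>) \<longlongrightarrow> fisher_information) (prob_filter M)"
proof (intro vec_tendstoI)
  fix a b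
  define \<phi> :: "(real^'p) \<times> real \<Rightarrow> real" where "\<phi> = (\<lambda>(x, y). x $ a * logistic_weight (\<theta>0 \<bullet> x) * x $ b)"
  have \<phi>: "\<phi> \<in> borel_measurable borel" unfolding \<phi>_def borel_prod[symmetric] by measurable
  have "((\<lambda>(t, \<omega>). (\<Sum>(k, i)\<in>{1..t} \<times> UNIV. 1 / real CARD('m) * \<phi> (X k i \<omega>, Y k i \<omega>)) / real t)
    \<longlongrightarrow> expectation (\<lambda>\<omega>. \<phi> (X k1 i1 \<omega>, Y k1 i1 \<omega>))) (prob_filter M)"
    using integrable_information[of a b]
    by (intro law_of_large_numbers[OF \<phi>]) (auto simp: \<phi>_def)
  also have "(\<lambda>(t, \<omega>). (\<Sum>(k, i)\<in>{1..t} \<times> UNIV. 1 / real CARD('m) * \<phi> (X k i \<omega>, Y k i \<omega>)) / real t)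
    = (\<lambda>z. (case z of (t, \<omega>) \<Rightarrow> V_hat X \<theta>0 t \<omega>) $ a $ b)"
  proof (intro ext, clarify)
    fix t \<omega>
    have "V_hat X \<theta>0 t \<omega> $ a $ b = 1 / (real CARD('m) * real t) * (\<Sum>i\<in>UNIV. \<Sum>k=1..t. \<phi> (X k i \<omega>, Y k i \<omega>))"
      by (simp add: V_hat_def \<phi>_def logistic_weight_def)
    also have "\<dots> = (\<Sum>k=1..t. \<Sum>i\<in>UNIV. 1 / real CARD('m) * \<phi> (X k i \<omega>, Y k i \<omega>)) / real t"
      by (subst sum.swap) (simp add: sum_divide_distrib sum_distrib_left field_simps)
    finally show "(\<Sum>(k, i)\<in>{1..t} \<times> UNIV. 1 / real CARD('m) * \<phi> (X k i \<omega>, Y k i \<omega>)) / real t = V_hat X \<theta>0 t \<omega> $ a $ b"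
      by (simp add: sum.cartesian_product)
  qed
  finally show "((\<lambda>z. (case z of (t, \<omega>) \<Rightarrow> V_hat X \<theta>0 t \<omega>) $ a $ b) \<longlongrightarrow> fisher_information $ a $ b) (prob_filter M)"
    by (simp add: \<phi>_def fisher_information_def)
qed

lemma bernstein_von_mises:
  fixes q :: "nat \<Rightarrow> 'm \<Rightarrow> 'w \<Rightarrow> real ^ 'p \<Rightarrow> real"
  assumes \<pi>m[measurable]: "\<pi> \<in> borel_measurable borel" and \<pi>pos: "\<And>\<theta>. 0 < \<pi> \<theta>"
    and \<pi>1: "(\<integral>\<^sup>+ \<theta>. ennreal (\<pi> \<theta>) \<partial>lborel) = 1" and \<pi>c: "isCont \<pi> \<theta>0"
    and qnn: "\<And>t \<omega> x. 0 \<le> q t j \<omega> x"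
    and qd: "\<And>t \<omega>. t \<ge> 1 \<Longrightarrow> \<omega> \<in> space M \<Longrightarrow>
          distributed (posterior A X Y \<pi> t j \<omega>) lborel
            (\<lambda>\<theta>. sqrt (real t) *\<^sub>R (\<theta> - mle A X Y t j \<omega>)) (\<lambda>x. ennreal (q t j \<omega> x))"
  shows "((\<lambda>(t, \<omega>). \<integral>x. \<bar>q t j \<omega> x - mvn_density (matrix_inv (V_hat X \<theta>0 t \<omega>)) x\<bar> \<partial>lborel) \<longlongrightarrow> 0) (prob_filter M)"
proof -
  have \<pi>int: "integrable lborel \<pi>"
    using \<pi>1 \<pi>pos by (intro integrableI_nonneg) (auto simp: less_imp_le)
  have ident: "\<theta> = \<theta>0" if "AE \<omega> in M. \<theta> \<bullet> X k1 i1 \<omega> = \<theta>0 \<bullet> X k1 i1 \<omega>" for \<theta>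
    using degenerate_direction_eq_0[of "\<theta> - \<theta>0"] that by (simp add: inner_diff_left)
  define \<theta>h where "\<theta>h = (\<lambda>(t, \<omega>). mle A X Y t j \<omega>)"
  have \<theta>h: "(\<theta>h \<longlongrightarrow> \<theta>0) (prob_filter M)" unfolding \<theta>h_def by (rule mle_consistent[OF ident])
  define l where "l = (\<lambda>(t, \<omega>). agent_loglik A X Y t j \<omega>)"
  \<comment> \<open>The network-weighted Hessian with opposite sign, divided by t. Its weight is
    taken at \<theta>0, so each summand depends on one data pair only.\<close>
  define H where "H = (\<lambda>(t, \<omega>). \<chi> a b. (\<Sum>p\<in>{1..t} \<times> UNIV. (case p of (k, i) \<Rightarrow> matpow A (t - k) $ j $ i) *
      ((case p of (k, i) \<Rightarrow> X k i \<omega>) $ a * logistic_weight (\<theta>0 \<bullet> (case p of (k, i) \<Rightarrow> X k i \<omega>)) * (case p of (k, i) \<Rightarrow> X k i \<omega>) $ b)) / real t)"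
  have H: "(H \<longlongrightarrow> fisher_information) (prob_filter M)"
  proof (intro vec_tendstoI)
    fix a b
    define \<phi> :: "(real^'p) \<times> real \<Rightarrow> real" where "\<phi> = (\<lambda>(x, y). x $ a * logistic_weight (\<theta>0 \<bullet> x) * x $ b)"
    have \<phi>: "\<phi> \<in> borel_measurable borel" unfolding \<phi>_def borel_prod[symmetric] by measurable
    have "((\<lambda>(t, \<omega>). (\<Sum>(k, i)\<in>{1..t} \<times> UNIV. matpow A (t - k) $ j $ i * \<phi> (X k i \<omega>, Y k i \<omega>)) / real t)
      \<longlongrightarrow> expectation (\<lambda>\<omega>. \<phi> (X k1 i1 \<omega>, Y k1 i1 \<omega>))) (prob_filter M)"
      using integrable_information[of a b] by (intro law_of_large_numbers_matpow[OF \<phi>]) (simp add: \<phi>_def)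
    then show "((\<lambda>z. H z $ a $ b) \<longlongrightarrow> fisher_information $ a $ b) (prob_filter M)"
      by (simp add: H_def \<phi>_def fisher_information_def case_prod_unfold)
  qed
  define m3 where "m3 = expectation (\<lambda>\<omega>. norm (X k1 i1 \<omega>) ^ 3)"
  define M3 where "M3 = (\<lambda>(t, \<omega>). (\<Sum>p\<in>{1..t} \<times> UNIV. (case p of (k, i) \<Rightarrow> matpow A (t - k) $ j $ i) * norm (case p of (k, i) \<Rightarrow> X k i \<omega>) ^ 3) / real t)"
  have M3: "(M3 \<longlongrightarrow> m3) (prob_filter M)"
  proof -
    have \<phi>: "(\<lambda>(x, y). norm x ^ 3) \<in> borel_measurable (borel :: ((real^'p) \<times> real) measure)"
      unfolding borel_prod[symmetric] by measurable
    show ?thesis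
      using law_of_large_numbers_matpow[OF \<phi>, of j] integrable_norm_X_cube
      by (simp add: M3_def m3_def case_prod_unfold)
  qed
  \<comment> \<open>The relative error of the quadratic term: half the distance from the Hessian to
    its limit, as the form carries a factor 1/2, plus the cost of moving from the maximizer to
    \<theta>0.\<close>
  define \<epsilon> where "\<epsilon> z = (\<Sum>a\<in>UNIV. \<Sum>b\<in>UNIV. \<bar>(H z - fisher_information) $ a $ b\<bar>) / 2 + norm (\<theta>h z - \<theta>0) * M3 z" for z
  have \<epsilon>: "(\<epsilon> \<longlongrightarrow> 0) (prob_filter M)"
  proof -
    have "(\<epsilon> \<longlongrightarrow> (\<Sum>a\<in>UNIV. \<Sum>b\<in>UNIV. \<bar>(fisher_information - fisher_information) $ a $ b\<bar>) / 2 + norm (\<theta>0 - \<theta>0) * m3) (prob_filter M)"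
      unfolding \<epsilon>_def by (intro tendsto_intros H M3 \<theta>h) simp
    then show ?thesis by simp
  qed
  define Vh where "Vh = (\<lambda>(t, \<omega>). V_hat X \<theta>0 t \<omega>)"
  have Vh: "(Vh \<longlongrightarrow> fisher_information) (prob_filter M)" unfolding Vh_def by (rule tendsto_V_hat)
  \<comment> \<open>What each selected pair (t, \<omega>) must satisfy. The bound on
    \<open>M3\<close> makes the cubic constant the same for all pairs.\<close>
  define P where "P z \<longleftrightarrow> 1 \<le> fst z \<and> snd z \<in> space M \<and> (\<forall>\<theta>. l z \<theta> \<le> l z (\<theta>h z)) \<and> M3 z < m3 + 1" for z
  have mle_max: "\<forall>\<^sub>F (t, \<omega>) in prob_filter M. \<forall>\<theta>. agent_loglik A X Y t j \<omega> \<theta> \<le> agent_loglik A X Y t j \<omega> (mle A X Y t j \<omega>)"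
    using ident by (rule eventually_mle_maximizes)
  have M3_less: "\<forall>\<^sub>F z in prob_filter M. M3 z < m3 + 1"
    by (rule order_tendstoD(2)[OF M3]) simp
  have P: "eventually P (prob_filter M)"
    using eventually_prob_filter_time[OF eventually_ge_at_top[of 1]] mle_max M3_less
    unfolding P_def l_def \<theta>h_def by eventually_elim auto
  have quad: "\<bar>l z (\<theta>h z + h) - l z (\<theta>h z) + real (fst z) / 2 * (h \<bullet> (fisher_information *v h))\<bar>
      \<le> real (fst z) * ((m3 + 1) * norm h ^ 3 + \<epsilon> z * (norm h)\<^sup>2)" if z: "P z" for z h
  proof -
    obtain t \<omega> where tw: "z = (t, \<omega>)" by (cases z)
    have t: "0 < real t" and max: "\<And>\<theta>. l z \<theta> \<le> l z (\<theta>h z)" and M3z: "M3 z < m3 + 1" using z by (auto simp: P_def tw)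
    define K where "K = {1..t} \<times> (UNIV :: 'm set)"
    define c where "c = (\<lambda>p. case p of (k, i) \<Rightarrow> matpow A (t - k) $ j $ i)"
    define x where "x = (\<lambda>p. case p of (k, i) \<Rightarrow> X k i \<omega>)"
    define y where "y = (\<lambda>p. case p of (k, i) \<Rightarrow> Y k i \<omega>)"
    have l: "l z = (\<lambda>\<theta>. \<Sum>p\<in>K. c p * logit_loglik \<theta> (x p, y p))"
      unfolding l_def tw prod.case agent_loglik_eq[abs_def] K_def c_def x_def y_def by (intro ext sum.cong) auto
    have cnn: "0 \<le> c p" for p unfolding c_def by (cases p) (simp add: matpow_weights)
    have "\<bar>l z (\<theta>h z + h) - l z (\<theta>h z) + (\<Sum>p\<in>K. c p * (logistic_weight (\<theta>0 \<bullet> x p) * (h \<bullet> x p)\<^sup>2)) / 2\<bar>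
      \<le> (\<Sum>p\<in>K. c p * norm (x p) ^ 3) * (norm h ^ 3 + norm (\<theta>h z - \<theta>0) * (norm h)\<^sup>2)"
      using logit_loglik_quadratic_expansion[of K c x y "\<theta>h z" h \<theta>0] cnn max unfolding l by blast
    moreover have "(\<Sum>p\<in>K. c p * (logistic_weight (\<theta>0 \<bullet> x p) * (h \<bullet> x p)\<^sup>2)) = real t * (h \<bullet> (H z *v h))"
    proof -
      have "H z = (\<chi> a b. (\<Sum>p\<in>K. c p * (x p $ a * logistic_weight (\<theta>0 \<bullet> x p) * x p $ b)) / real t)"
        by (simp add: H_def tw K_def c_def x_def)
      then show ?thesis using t by (simp add: quadratic_form_weighted_gram)
    qed
    moreover have "(\<Sum>p\<in>K. c p * norm (x p) ^ 3) = real t * M3 z"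
      using t by (simp add: M3_def tw K_def c_def x_def)
    ultimately have 1: "\<bar>l z (\<theta>h z + h) - l z (\<theta>h z) + real t / 2 * (h \<bullet> (H z *v h))\<bar>
      \<le> real t * (M3 z * (norm h ^ 3 + norm (\<theta>h z - \<theta>0) * (norm h)\<^sup>2))"
      by (simp add: mult_ac)
    have "\<bar>h \<bullet> (fisher_information *v h) - h \<bullet> (H z *v h)\<bar> = \<bar>h \<bullet> ((H z - fisher_information) *v h)\<bar>"
      by (simp add: matrix_vector_mult_diff_rdistrib inner_diff_right abs_minus_commute)
    also have "\<dots> \<le> (\<Sum>a\<in>UNIV. \<Sum>b\<in>UNIV. \<bar>(H z - fisher_information) $ a $ b\<bar>) * (norm h)\<^sup>2"
      by (rule abs_quadratic_form_le)
    finally have "real t / 2 * \<bar>h \<bullet> (fisher_information *v h) - h \<bullet> (H z *v h)\<bar>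
      \<le> real t / 2 * ((\<Sum>a\<in>UNIV. \<Sum>b\<in>UNIV. \<bar>(H z - fisher_information) $ a $ b\<bar>) * (norm h)\<^sup>2)"
      using t by (intro mult_left_mono) auto
    then have 2: "\<bar>real t / 2 * (h \<bullet> (fisher_information *v h)) - real t / 2 * (h \<bullet> (H z *v h))\<bar>
      \<le> real t / 2 * ((\<Sum>a\<in>UNIV. \<Sum>b\<in>UNIV. \<bar>(H z - fisher_information) $ a $ b\<bar>) * (norm h)\<^sup>2)"
      using t by (simp only: right_diff_distrib[symmetric] abs_mult)
    have 3: "real t * (M3 z * norm h ^ 3) \<le> real t * ((m3 + 1) * norm h ^ 3)"
      using M3z t by (intro mult_left_mono mult_right_mono) auto
    have "real t * (M3 z * (norm h ^ 3 + norm (\<theta>h z - \<theta>0) * (norm h)\<^sup>2))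
       + real t / 2 * ((\<Sum>a\<in>UNIV. \<Sum>b\<in>UNIV. \<bar>(H z - fisher_information) $ a $ b\<bar>) * (norm h)\<^sup>2)
      = real t * (M3 z * norm h ^ 3) + real t * (\<epsilon> z * (norm h)\<^sup>2)"
      unfolding \<epsilon>_def by (simp add: algebra_simps)
    with 1 2 3 have "\<bar>l z (\<theta>h z + h) - l z (\<theta>h z) + real t / 2 * (h \<bullet> (fisher_information *v h))\<bar>
      \<le> real t * ((m3 + 1) * norm h ^ 3) + real t * (\<epsilon> z * (norm h)\<^sup>2)"
      by linarith
    then show ?thesis by (simp add: tw distrib_left)
  qed
  have lm[measurable]: "l z \<in> borel_measurable borel" and lc: "concave_on UNIV (l z)" for z
  proof -
    obtain t \<omega> where tw: "z = (t, \<omega>)" by (cases z)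
    have l: "l z = (\<lambda>\<theta>. \<Sum>p\<in>{1..t} \<times> UNIV. (case p of (k, i) \<Rightarrow> matpow A (t - k) $ j $ i) * logit_loglik \<theta> (case p of (k, i) \<Rightarrow> (X k i \<omega>, Y k i \<omega>)))"
      unfolding l_def tw prod.case agent_loglik_eq[abs_def] by (intro ext sum.cong) auto
    show "l z \<in> borel_measurable borel"
      unfolding l by (intro borel_measurable_sum borel_measurable_times borel_measurable_const borel_measurable_logit_loglik)
    show "concave_on UNIV (l z)"
      unfolding l by (rule concave_on_sum_logit_loglik) (auto simp: matpow_weights)
  qed
  define Q where "Q = (\<lambda>(t, \<omega>). q t j \<omega>)"
  have Q: "Q z \<in> borel_measurable borel"
    "AE x in lborel. Q z x = exp (l z (\<theta>h z + x /\<^sub>R sqrt (real (fst z))) - l z (\<theta>h z)) * \<pi> (\<theta>h z + x /\<^sub>R sqrt (real (fst z)))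
       / (\<integral>y. exp (l z (\<theta>h z + y /\<^sub>R sqrt (real (fst z))) - l z (\<theta>h z)) * \<pi> (\<theta>h z + y /\<^sub>R sqrt (real (fst z))) \<partial>lborel)"
    if z: "P z" for z
  proof -
    obtain t \<omega> where tw: "z = (t, \<omega>)" by (cases z)
    have t: "1 \<le> t" and \<omega>: "\<omega> \<in> space M" and max: "\<And>\<theta>. l z \<theta> \<le> l z (\<theta>h z)" using z by (auto simp: P_def tw)
    have "(\<lambda>x. ennreal (q t j \<omega> x)) \<in> borel_measurable lborel"
      using qd[OF t \<omega>] by (auto simp: distributed_def)
    \<comment> \<open>Being a density makes the extended-real version measurable; nonnegativity
      carries this back to \<open>q\<close>.\<close>
    then have "(\<lambda>x. enn2real (ennreal (q t j \<omega> x))) \<in> borel_measurable lborel" by (rule borel_measurable_enn2real)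
    then show "Q z \<in> borel_measurable borel" using qnn by (simp add: Q_def tw)
    show "AE x in lborel. Q z x = exp (l z (\<theta>h z + x /\<^sub>R sqrt (real (fst z))) - l z (\<theta>h z)) * \<pi> (\<theta>h z + x /\<^sub>R sqrt (real (fst z)))
       / (\<integral>y. exp (l z (\<theta>h z + y /\<^sub>R sqrt (real (fst z))) - l z (\<theta>h z)) * \<pi> (\<theta>h z + y /\<^sub>R sqrt (real (fst z))) \<partial>lborel)"
    proof (rule rescaled_posterior_density[OF lm \<pi>m \<pi>pos \<pi>int max])
      show "distributed (density lborel (\<lambda>\<theta>. ennreal (exp (l z \<theta>) * \<pi> \<theta>) / (\<integral>\<^sup>+\<theta>'. ennreal (exp (l z \<theta>') * \<pi> \<theta>') \<partial>lborel))) lborel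
         (\<lambda>\<theta>. sqrt (real (fst z)) *\<^sub>R (\<theta> - \<theta>h z)) (\<lambda>x. ennreal (Q z x))"
        using qd[OF t \<omega>] by (simp add: posterior_def l_def tw \<theta>h_def Q_def agent_loglik_def)
    qed (use t qnn in \<open>auto simp: tw Q_def\<close>)
  qed
  have "((\<lambda>z. \<integral>x. \<bar>Q z x - mvn_density (matrix_inv (Vh z)) x\<bar> \<partial>lborel) \<longlongrightarrow> 0) (prob_filter M)"
  proof (rule tendsto_via_sequences[OF filterlim_fst_prob_filter _ P])
    \<comment> \<open>The three limits are tupled so that every selected sequence has all of them at
      once.\<close>
    show "((\<lambda>z. (\<theta>h z, \<epsilon> z, Vh z)) \<longlongrightarrow> (\<theta>0, 0, fisher_information)) (prob_filter M)"
      by (intro tendsto_Pair \<theta>h \<epsilon> Vh)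
    fix s :: "nat \<Rightarrow> nat \<times> 'w"
    assume Ps: "\<And>n. P (s n)" and t: "filterlim (\<lambda>n. fst (s n)) at_top sequentially"
      and lim: "(\<lambda>n. (\<theta>h (s n), \<epsilon> (s n), Vh (s n))) \<longlonglongrightarrow> (\<theta>0, 0, fisher_information)"
    show "(\<lambda>n. \<integral>x. \<bar>Q (s n) x - mvn_density (matrix_inv (Vh (s n))) x\<bar> \<partial>lborel) \<longlonglongrightarrow> 0"
    proof (rule bernstein_von_mises_sequence[where F="\<lambda>n. l (s n)" and \<theta>="\<lambda>n. \<theta>h (s n)" and e="\<lambda>n. \<epsilon> (s n)"
          and r="\<lambda>n. sqrt (real (fst (s n)))" and ?V0.0=fisher_information and C="m3 + 1" and ?\<theta>0.0=\<theta>0 and \<pi>=\<pi>])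
      show "filterlim (\<lambda>n. sqrt (real (fst (s n)))) at_top sequentially"
        by (rule filterlim_compose[OF sqrt_at_top filterlim_compose[OF filterlim_real_sequentially t]])
      show "(\<lambda>n. \<theta>h (s n)) \<longlonglongrightarrow> \<theta>0" using tendsto_fst[OF lim] by simp
      show "(\<lambda>n. \<epsilon> (s n)) \<longlonglongrightarrow> 0" using tendsto_fst[OF tendsto_snd[OF lim]] by simp
      show "(\<lambda>n. Vh (s n)) \<longlonglongrightarrow> fisher_information" using tendsto_snd[OF tendsto_snd[OF lim]] by simp
      show "0 < sqrt (real (fst (s n)))" for n using Ps[of n] by (auto simp: P_def)
      show "\<bar>l (s n) (\<theta>h (s n) + h) - l (s n) (\<theta>h (s n)) + (sqrt (real (fst (s n))))\<^sup>2 / 2 * (h \<bullet> (fisher_information *v h))\<bar>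
         \<le> (sqrt (real (fst (s n))))\<^sup>2 * ((m3 + 1) * norm h ^ 3 + \<epsilon> (s n) * (norm h)\<^sup>2)" for n h
        using quad[OF Ps[of n], of h] by simp
      show "l (s n) x \<le> l (s n) (\<theta>h (s n))" for n x using Ps[of n] by (auto simp: P_def)
      show "transpose (Vh (s n)) = Vh (s n)" for n unfolding Vh_def by (cases "s n") (simp add: transpose_V_hat)
    qed (use lc lm transpose_fisher_information fisher_information_pos_def \<pi>m \<pi>c \<pi>pos \<pi>int Q[OF Ps] in simp_all)
  qed
  then show ?thesis by (simp add: Q_def Vh_def case_prod_unfold)
qed

end

end

theorem proposition25:
  fixes M :: "'w measure"
    and X :: "nat \<Rightarrow> 'm::finite \<Rightarrow> 'w \<Rightarrow> real ^ 'p"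
    and Y :: "nat \<Rightarrow> 'm \<Rightarrow> 'w \<Rightarrow> real"
    and \<nu> :: "nat \<Rightarrow> 'm \<Rightarrow> 'w \<Rightarrow> real"
    and \<theta>\<^sub>0 :: "real ^ 'p"
    and \<pi> :: "real ^ 'p \<Rightarrow> real"
    and E :: "('m \<times> 'm) set"
    and A :: "real ^ 'm ^ 'm"
    and q :: "nat \<Rightarrow> 'm \<Rightarrow> 'w \<Rightarrow> real ^ 'p \<Rightarrow> real"
    and i\<^sub>1 j :: 'm
  assumes prob: "prob_space M"
    \<comment> \<open>i.i.d. pairs generated by the logistic regression model\<close>
    and indep: "prob_space.indep_vars M (\<lambda>_. borel) (\<lambda>(k, i) \<omega>. (X k i \<omega>, Y k i \<omega>)) ({1..} \<times> UNIV)"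
    and ident_distr: "\<And>k i. k \<ge> 1 \<Longrightarrow>
          distr M borel (\<lambda>\<omega>. (X k i \<omega>, Y k i \<omega>)) = distr M borel (\<lambda>\<omega>. (X 1 i\<^sub>1 \<omega>, Y 1 i\<^sub>1 \<omega>))"
    and binary: "\<And>k i \<omega>. k \<ge> 1 \<Longrightarrow> \<omega> \<in> space M \<Longrightarrow> Y k i \<omega> \<in> {0, 1}"
    and nu_range: "\<And>k i \<omega>. k \<ge> 1 \<Longrightarrow> \<omega> \<in> space M \<Longrightarrow> 0 < \<nu> k i \<omega> \<and> \<nu> k i \<omega> < 1"
    and logit: "\<And>k i \<omega>. k \<ge> 1 \<Longrightarrow> \<omega> \<in> space M \<Longrightarrow>
          ln (\<nu> k i \<omega> / (1 - \<nu> k i \<omega>)) = \<theta>\<^sub>0 \<bullet> X k i \<omega>"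
    and bernoulli: "\<And>k i. k \<ge> 1 \<Longrightarrow>
          AE \<omega> in M. real_cond_exp M (vimage_algebra (space M) (X k i) borel)
                       (\<lambda>\<omega>'. indicator {1} (Y k i \<omega>')) \<omega> = \<nu> k i \<omega>"
    \<comment> \<open>communication graph and weights\<close>
    and undirected: "sym E"
    and connected: "\<And>i i'. (i, i') \<in> E\<^sup>*"
    and adjacency: "weighted_adjacency E A"
    and symmetric: "transpose A = A"
    and stochastic: "row_stochastic A"
    and diagonal: "\<And>i. A $ i $ i > 0"
    and loglik_finite: "\<And>\<theta>. integrable M (\<lambda>\<omega>. \<bar>ln (logistic_lik \<theta> (Y 1 i\<^sub>1 \<omega>) (X 1 i\<^sub>1 \<omega>))\<bar>)"
    \<comment> \<open>prior density with full support\<close>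
    and prior_meas: "\<pi> \<in> borel_measurable borel"
    and prior_pos: "\<And>\<theta>. \<pi> \<theta> > 0"
    and prior_prob: "(\<integral>\<^sup>+ \<theta>. ennreal (\<pi> \<theta>) \<partial>lborel) = 1"
    \<comment> \<open>q is the density of the rescaled posterior\<close>
    and q_nonneg: "\<And>t i \<omega> x. q t i \<omega> x \<ge> 0"
    and q_density: "\<And>t i \<omega>. t \<ge> 1 \<Longrightarrow> \<omega> \<in> space M \<Longrightarrow>
          distributed (posterior A X Y \<pi> t i \<omega>) lborel
            (\<lambda>\<theta>. sqrt (real t) *\<^sub>R (\<theta> - mle A X Y t i \<omega>)) (\<lambda>x. ennreal (q t i \<omega> x))"
  shows "((\<forall>\<theta>. (AE \<omega> in M. \<forall>y\<in>{0, 1}. logistic_lik \<theta> y (X 1 i\<^sub>1 \<omega>) = logistic_lik \<theta>\<^sub>0 y (X 1 i\<^sub>1 \<omega>))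
              \<longrightarrow> \<theta> = \<theta>\<^sub>0)
          \<longrightarrow> tendsto_in_prob M (\<lambda>t. mle A X Y t j) \<theta>\<^sub>0)
       \<and> (isCont \<pi> \<theta>\<^sub>0
          \<and> (\<forall>a b. integrable M (\<lambda>\<omega>. X 1 i\<^sub>1 \<omega> $ a * X 1 i\<^sub>1 \<omega> $ b))
          \<and> invertible (\<chi> a b. \<integral>\<omega>. X 1 i\<^sub>1 \<omega> $ a * X 1 i\<^sub>1 \<omega> $ b \<partial>M)
          \<and> (\<forall>a b c. integrable M (\<lambda>\<omega>. \<bar>X 1 i\<^sub>1 \<omega> $ a * X 1 i\<^sub>1 \<omega> $ b * X 1 i\<^sub>1 \<omega> $ c\<bar>))
          \<longrightarrow> tendsto_in_prob M
                (\<lambda>t \<omega>. \<integral>x. \<bar>q t j \<omega> x - mvn_density (matrix_inv (V_hat X \<theta>\<^sub>0 t \<omega>)) x\<bar> \<partial>lborel) 0)"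
proof -
  interpret prob_space M by (rule prob)
  \<comment> \<open>Solving the logit equation for the success probability.\<close>
  have sig: "\<nu> 1 i\<^sub>1 \<omega> = sigmoid (\<theta>\<^sub>0 \<bullet> X 1 i\<^sub>1 \<omega>)" if "\<omega> \<in> space M" for \<omega>
  proof -
    let ?n = "\<nu> 1 i\<^sub>1 \<omega>"
    have n: "0 < ?n" "?n < 1" using nu_range[of 1 \<omega> i\<^sub>1] that by auto
    then have "exp (\<theta>\<^sub>0 \<bullet> X 1 i\<^sub>1 \<omega>) = ?n / (1 - ?n)"
      using logit[of 1 \<omega> i\<^sub>1] that by (metis diff_gt_0_iff_gt divide_pos_pos exp_ln le_refl)
    moreover have "1 + ?n / (1 - ?n) = 1 / (1 - ?n)" using n by (simp add: field_simps)
    ultimately show ?thesis using n by (simp add: sigmoid_def)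
  qed
  interpret logistic_network M X Y \<theta>\<^sub>0 A 1 i\<^sub>1
  proof
    show "AE \<omega> in M. real_cond_exp M (vimage_algebra (space M) (X 1 i\<^sub>1) borel) (\<lambda>\<omega>'. indicator {1} (Y 1 i\<^sub>1 \<omega>')) \<omega>
      = sigmoid (\<theta>\<^sub>0 \<bullet> X 1 i\<^sub>1 \<omega>)"
      using bernoulli[of 1 i\<^sub>1, OF order.refl] AE_space by eventually_elim (simp only: sig)
    show "Y 1 i\<^sub>1 \<omega> \<in> {0, 1}" if "\<omega> \<in> space M" for \<omega>
      using binary[OF order.refl that] .
  qed (fact indep ident_distr stochastic loglik_finite order.refl)+
  show ?thesis
    unfolding tendsto_in_prob_iff
  proof (intro conjI impI)
    assume id: "\<forall>\<theta>. (AE \<omega> in M. \<forall>y\<in>{0, 1}. logistic_lik \<theta> y (X 1 i\<^sub>1 \<omega>) = logistic_lik \<theta>\<^sub>0 y (X 1 i\<^sub>1 \<omega>)) \<longrightarrow> \<theta> = \<theta>\<^sub>0"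
    show "((\<lambda>(t, \<omega>). mle A X Y t j \<omega>) \<longlongrightarrow> \<theta>\<^sub>0) (prob_filter M)"
    proof (rule mle_consistent)
      fix \<theta> assume "AE \<omega> in M. \<theta> \<bullet> X 1 i\<^sub>1 \<omega> = \<theta>\<^sub>0 \<bullet> X 1 i\<^sub>1 \<omega>"
      \<comment> \<open>For a fixed response the likelihood depends on the parameter only through
        the linear predictor.\<close>
      then have "AE \<omega> in M. \<forall>y\<in>{0, 1}. logistic_lik \<theta> y (X 1 i\<^sub>1 \<omega>) = logistic_lik \<theta>\<^sub>0 y (X 1 i\<^sub>1 \<omega>)"
        by eventually_elim (simp add: logistic_lik_def)
      then show "\<theta> = \<theta>\<^sub>0" using id by blast
    qed
  next
    assume "isCont \<pi> \<theta>\<^sub>0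
          \<and> (\<forall>a b. integrable M (\<lambda>\<omega>. X 1 i\<^sub>1 \<omega> $ a * X 1 i\<^sub>1 \<omega> $ b))
          \<and> invertible (\<chi> a b. \<integral>\<omega>. X 1 i\<^sub>1 \<omega> $ a * X 1 i\<^sub>1 \<omega> $ b \<partial>M)
          \<and> (\<forall>a b c. integrable M (\<lambda>\<omega>. \<bar>X 1 i\<^sub>1 \<omega> $ a * X 1 i\<^sub>1 \<omega> $ b * X 1 i\<^sub>1 \<omega> $ c\<bar>))"
    then have reg: "isCont \<pi> \<theta>\<^sub>0"
        "\<And>a b. integrable M (\<lambda>\<omega>. X 1 i\<^sub>1 \<omega> $ a * X 1 i\<^sub>1 \<omega> $ b)"
        "invertible (\<chi> a b. \<integral>\<omega>. X 1 i\<^sub>1 \<omega> $ a * X 1 i\<^sub>1 \<omega> $ b \<partial>M)"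
        "\<And>a b c. integrable M (\<lambda>\<omega>. \<bar>X 1 i\<^sub>1 \<omega> $ a * X 1 i\<^sub>1 \<omega> $ b * X 1 i\<^sub>1 \<omega> $ c\<bar>)"
      by blast+
    show "((\<lambda>(t, \<omega>). \<integral>x. \<bar>q t j \<omega> x - mvn_density (matrix_inv (V_hat X \<theta>\<^sub>0 t \<omega>)) x\<bar> \<partial>lborel) \<longlongrightarrow> 0) (prob_filter M)"
      using reg by (intro bernstein_von_mises[where \<pi>=\<pi>]) (simp_all only: prior_meas prior_pos prior_prob q_nonneg q_density)
  qed
qed

end
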